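(* Let $\Omega\subset\mathbb{C}$ be a bounded $n$-connected domain with $C^\infty$ smooth boundary and let $\varphi$ be a positive real-valued $C^\infty$ function on $\partial\Omega$. Then the weighted Kerzman--Stein formula $$P_{\varphi}(I+\mathcal{A}_{\varphi})=\mathcal{C}\quad\text{on } C^{\infty}(\partial\Omega)$$ holds, where $I$ denotes the identity operator.
   Context: A bounded $n$-connected domain with $C^\infty$ smooth boundary is a bounded domain in $\mathbb{C}$ whose boundary consists of $n$ pairwise disjoint $C^\infty$ smooth simple closed curves. $ds$ is arc length on $\partial\Omega$ and $T(z)$ is the complex unit tangent vector at $z\in\partial\Omega$ in the direction of the standard (positive) orientation, so $dz=T\,ds$. $L^2_\varphi(\partial\Omega)$ is the Hilbert space of complex-valued functions on $\partial\Omega$ square integrable with respect to $\varphi\,ds$, with inner product $\langle u,v\rangle_\varphi=\int_{\partial\Omega}u\bar v\,\varphi\,ds$. $A^\infty(\Omega)$ is the space of holomorphic functions on $\Omega$ that are in $C^\infty(\overline\Omega)$; the Hardy space $H^2(\partial\Omega)$ is the closure in $L^2(\partial\Omega)$ (equivalently, in $L^2_\varphi(\partial\Omega)$) of the set of boundary values of functions in $A^\infty(\Omega)$. The weighted Szeg\H{o} projection $P_\varphi$ is the orthogonal projection of $L^2_\varphi(\partial\Omega)$ onto $H^2(\partial\Omega)$. For $u\in C^\infty(\partial\Omega)$ the Cauchy transform is $(\mathcal{C}u)(z)=\frac{1}{2\pi i}\int_{\partial\Omega}\frac{u(\zeta)}{\zeta-z}\,d\zeta$, $z\in\Omega$. It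 maps $C^\infty(\partial\Omega)$ into $A^\infty(\Omega)$, and by taking boundary values $\mathcal{C}$ is viewed as an operator from $C^\infty(\partial\Omega)$ into itself. For $v\in C^\infty(\partial\Omega)$ define $\mathcal{C}^*_\varphi v=v-\overline{T}\varphi^{-1}\,\overline{\mathcal{C}(\overline{v\varphi}\,\overline{T})}$ (this satisfies $\langle\mathcal{C}u,v\rangle_\varphi=\langle u,\mathcal{C}^*_\varphi v\rangle_\varphi$ for all $u,v\in C^\infty(\partial\Omega)$). The weighted Kerzman--Stein operator is $\mathcal{A}_\varphi=\mathcal{C}-\mathcal{C}^*_\varphi$. *)

theory Defs
  imports "HOL-Complex_Analysis.Complex_Analysis"
begin

definition smooth_real :: "(real \<Rightarrow> 'a::real_normed_vector) \<Rightarrow> bool" where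
  "smooth_real f \<longleftrightarrow>
     (\<exists>D. D 0 = f \<and> (\<forall>k t. (D k has_vector_derivative D (Suc k) t) (at t)))"

definition smooth_simple_closed_curve :: "(real \<Rightarrow> complex) \<Rightarrow> bool" where
  "smooth_simple_closed_curve c \<longleftrightarrow>
     smooth_real c \<and> (\<forall>t. c (t + 1) = c t) \<and> inj_on c {0..<1} \<and>
     (\<forall>t. vector_derivative c (at t) \<noteq> 0)"

definition boundary_param :: "complex set \<Rightarrow> nat \<Rightarrow> (nat \<Rightarrow> real \<Rightarrow> complex) \<Rightarrow> bool" where
  "boundary_param \<Omega> n \<gamma> \<longleftrightarrow>
     (\<forall>j<n. smooth_simple_closed_curve (\<gamma> j)) \<and>
     (\<forall>i<n. \<forall>j<n. i \<noteq> j \<longrightarrow> range (\<gamma> i) \<inter> range (\<gamma> j) = {}) \<and>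
     frontier \<Omega> = (\<Union>j<n. range (\<gamma> j))"

definition smooth_connected_domain :: "complex set \<Rightarrow> nat \<Rightarrow> bool" where
  "smooth_connected_domain \<Omega> n \<longleftrightarrow>
     open \<Omega> \<and> connected \<Omega> \<and> \<Omega> \<noteq> {} \<and> bounded \<Omega> \<and> (\<exists>\<gamma>. boundary_param \<Omega> n \<gamma>)"

text \<open>Standard orientation: the domain lies to the left of each boundary curve, that is,
  \<open>\<i> * \<gamma>'(t)\<close> is an inward normal.  The notions below that depend on the parametrization
  (arc length, tangent, Cauchy integral) are the same for every positively oriented one.\<close>

definition positively_oriented :: "complex set \<Rightarrow> nat \<Rightarrow> (nat \<Rightarrow> real \<Rightarrow> complex) \<Rightarrow> bool" where
  "positively_oriented \<Omega> n \<gamma> \<longleftrightarrow>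
     (\<forall>j<n. \<forall>t. \<forall>\<^sub>F \<epsilon> in at_right 0.
        \<gamma> j t + of_real \<epsilon> * (\<i> * vector_derivative (\<gamma> j) (at t)) \<in> \<Omega>)"

text \<open>Functions on the boundary are represented by functions on \<open>\<complex>\<close> whose values off the
  boundary are irrelevant; accordingly \<open>arc_length\<close> has space \<open>frontier \<Omega>\<close>.\<close>

definition smooth_on_boundary ::
    "nat \<Rightarrow> (nat \<Rightarrow> real \<Rightarrow> complex) \<Rightarrow> (complex \<Rightarrow> 'a::real_normed_vector) \<Rightarrow> bool" where
  "smooth_on_boundary n \<gamma> u \<longleftrightarrow> (\<forall>j<n. smooth_real (\<lambda>t. u (\<gamma> j t)))"

definition arc_length :: "complex set \<Rightarrow> nat \<Rightarrow> (nat \<Rightarrow> real \<Rightarrow> complex) \<Rightarrow> complex measure" where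
  "arc_length \<Omega> n \<gamma> =
     distr
       (density (count_space {..<n} \<Otimes>\<^sub>M restrict_space lborel {0..1})
         (\<lambda>(j, t). ennreal (norm (vector_derivative (\<gamma> j) (at t)))))
       (restrict_space borel (frontier \<Omega>)) (\<lambda>(j, t). \<gamma> j t)"

definition unit_tangent :: "nat \<Rightarrow> (nat \<Rightarrow> real \<Rightarrow> complex) \<Rightarrow> complex \<Rightarrow> complex" where
  "unit_tangent n \<gamma> z =
     (THE \<tau>. \<exists>j<n. \<exists>t. \<gamma> j t = z \<and> \<tau> = sgn (vector_derivative (\<gamma> j) (at t)))"

definition L2_boundary ::
    "complex set \<Rightarrow> nat \<Rightarrow> (nat \<Rightarrow> real \<Rightarrow> complex) \<Rightarrow> (complex \<Rightarrow> real) \<Rightarrow> (complex \<Rightarrow> complex) set"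
  where
  "L2_boundary \<Omega> n \<gamma> \<phi> =
     {u \<in> borel_measurable (arc_length \<Omega> n \<gamma>).
        integrable (arc_length \<Omega> n \<gamma>) (\<lambda>z. (norm (u z))\<^sup>2 * \<phi> z)}"

definition inner_boundary ::
    "complex set \<Rightarrow> nat \<Rightarrow> (nat \<Rightarrow> real \<Rightarrow> complex) \<Rightarrow> (complex \<Rightarrow> real) \<Rightarrow>
     (complex \<Rightarrow> complex) \<Rightarrow> (complex \<Rightarrow> complex) \<Rightarrow> complex" where
  "inner_boundary \<Omega> n \<gamma> \<phi> u v =
     (LINT z | arc_length \<Omega> n \<gamma>. u z * cnj (v z) * of_real (\<phi> z))"

definition norm_boundary ::
    "complex set \<Rightarrow> nat \<Rightarrow> (nat \<Rightarrow> real \<Rightarrow> complex) \<Rightarrow> (complex \<Rightarrow> real) \<Rightarrow>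
     (complex \<Rightarrow> complex) \<Rightarrow> real" where
  "norm_boundary \<Omega> n \<gamma> \<phi> u = sqrt (Re (inner_boundary \<Omega> n \<gamma> \<phi> u u))"

text \<open>All partial derivatives exist in \<open>\<Omega>\<close> and extend continuously to the closure:
  \<open>D a b\<close> is the derivative of order \<open>a\<close> in the real and \<open>b\<close> in the imaginary direction.\<close>

definition smooth_on_closure :: "complex set \<Rightarrow> (complex \<Rightarrow> complex) \<Rightarrow> bool" where
  "smooth_on_closure \<Omega> f \<longleftrightarrow>
     (\<exists>D :: nat \<Rightarrow> nat \<Rightarrow> complex \<Rightarrow> complex.
        (\<forall>z\<in>closure \<Omega>. D 0 0 z = f z) \<and>
        (\<forall>a b. continuous_on (closure \<Omega>) (D a b)) \<and>
        (\<forall>a b. \<forall>z\<in>\<Omega>. (D a b has_derivative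
            (\<lambda>h. of_real (Re h) * D (Suc a) b z + of_real (Im h) * D a (Suc b) z)) (at z)))"

definition A_infinity :: "complex set \<Rightarrow> (complex \<Rightarrow> complex) set" where
  "A_infinity \<Omega> = {f. f holomorphic_on \<Omega> \<and> smooth_on_closure \<Omega> f}"

text \<open>The closure is taken in the unweighted space.\<close>

definition hardy_space ::
    "complex set \<Rightarrow> nat \<Rightarrow> (nat \<Rightarrow> real \<Rightarrow> complex) \<Rightarrow> (complex \<Rightarrow> complex) set" where
  "hardy_space \<Omega> n \<gamma> =
     {h \<in> L2_boundary \<Omega> n \<gamma> (\<lambda>_. 1).
        \<forall>\<epsilon>>0. \<exists>f\<in>A_infinity \<Omega>. norm_boundary \<Omega> n \<gamma> (\<lambda>_. 1) (\<lambda>z. h z - f z) < \<epsilon>}"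

text \<open>Elements of \<open>L\<^sup>2\<close> are functions rather than classes, so the orthogonal projection is a chosen
  representative, determined up to equality almost everywhere.\<close>

definition szego_projection ::
    "complex set \<Rightarrow> nat \<Rightarrow> (nat \<Rightarrow> real \<Rightarrow> complex) \<Rightarrow> (complex \<Rightarrow> real) \<Rightarrow>
     (complex \<Rightarrow> complex) \<Rightarrow> complex \<Rightarrow> complex" where
  "szego_projection \<Omega> n \<gamma> \<phi> v =
     (SOME h. h \<in> hardy_space \<Omega> n \<gamma> \<and>
        (\<forall>g\<in>hardy_space \<Omega> n \<gamma>. inner_boundary \<Omega> n \<gamma> \<phi> (\<lambda>z. v z - h z) g = 0))"

definition cauchy_integral ::
    "nat \<Rightarrow> (nat \<Rightarrow> real \<Rightarrow> complex) \<Rightarrow> (complex \<Rightarrow> complex) \<Rightarrow> complex \<Rightarrow> complex" where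
  "cauchy_integral n \<gamma> u z =
     1 / (2 * of_real pi * \<i>) * (\<Sum>j<n. contour_integral (\<gamma> j) (\<lambda>\<zeta>. u \<zeta> / (\<zeta> - z)))"

text \<open>The Cauchy transform as an operator on functions on the boundary: boundary values of the
  Cauchy integral, taken from inside \<open>\<Omega>\<close>.\<close>

definition cauchy_transform ::
    "complex set \<Rightarrow> nat \<Rightarrow> (nat \<Rightarrow> real \<Rightarrow> complex) \<Rightarrow> (complex \<Rightarrow> complex) \<Rightarrow> complex \<Rightarrow> complex"
  where
  "cauchy_transform \<Omega> n \<gamma> u w = Lim (at w within \<Omega>) (cauchy_integral n \<gamma> u)"

definition cauchy_adjoint ::
    "complex set \<Rightarrow> nat \<Rightarrow> (nat \<Rightarrow> real \<Rightarrow> complex) \<Rightarrow> (complex \<Rightarrow> real) \<Rightarrow>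
     (complex \<Rightarrow> complex) \<Rightarrow> complex \<Rightarrow> complex" where
  "cauchy_adjoint \<Omega> n \<gamma> \<phi> v z =
     v z - cnj (unit_tangent n \<gamma> z) * inverse (of_real (\<phi> z)) *
       cnj (cauchy_transform \<Omega> n \<gamma>
         (\<lambda>\<zeta>. cnj (v \<zeta> * of_real (\<phi> \<zeta>)) * cnj (unit_tangent n \<gamma> \<zeta>)) z)"

definition kerzman_stein ::
    "complex set \<Rightarrow> nat \<Rightarrow> (nat \<Rightarrow> real \<Rightarrow> complex) \<Rightarrow> (complex \<Rightarrow> real) \<Rightarrow>
     (complex \<Rightarrow> complex) \<Rightarrow> complex \<Rightarrow> complex" where
  "kerzman_stein \<Omega> n \<gamma> \<phi> u z = cauchy_transform \<Omega> n \<gamma> u z - cauchy_adjoint \<Omega> n \<gamma> \<phi> u z"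

end

theory Submission
  imports Defs
begin

text \<open>
The formula says that \<open>\<C>u\<close> is the orthogonal projection of \<open>u + \<A>u\<close>, where \<open>\<C>\<close> is the
Cauchy transform and \<open>\<A> = \<C> - \<C>\<^sup>*\<close>.  It rests on two facts:
\<open>\<C>u\<close> lies in the Hardy space, and the difference \<open>(u + \<A>u) - \<C>u = u - \<C>\<^sup>*u\<close> is
orthogonal to the Hardy space.  By definition of \<open>\<C>\<^sup>*\<close> this difference is
\<open>cnj T * \<phi>\<^sup>-\<^sup>1 * cnj (\<C>w)\<close> with \<open>w = cnj (u * \<phi> * T)\<close>.  Paired with \<open>f \<in> A\<^sup>\<infinity>(\<Omega>)\<close> the weight
cancels, \<open>T ds = dz\<close>, and what remains is the conjugate of \<open>\<integral> \<C>w * f dz\<close>, which vanishes by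
Cauchy's theorem.  Density extends the orthogonality to the whole Hardy space, and positivity of the
weighted inner product makes the projection unique almost everywhere.

Three ingredients have to be built.

\<^item> \<^emph>\<open>Regularity of \<open>\<C>u\<close>.\<close>  For \<open>z \<in> \<Omega>\<close> with nearest boundary point \<open>p\<close>, write \<open>\<C>u(z)\<close> as
  \<open>1 / (2 \<pi> \<i>)\<close> times the integral of \<open>(u(\<zeta>) - u(p)) / (\<zeta> - z)\<close> plus \<open>u(p)\<close> times the total winding number of the
  boundary about \<open>z\<close>.  The latter is constant on the connected set \<open>\<Omega>\<close>.  The integrand is bounded
  because \<open>u\<close> is Lipschitz for the chordal distance and \<open>|\<zeta> - p| \<le> 2 |\<zeta> - z|\<close>; dominated
  convergence therefore gives boundary values, also along tangential approach
  (\<open>cauchy_integral_tendsto_frontier\<close>).  Integration by parts shows that differentiating a Cauchy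
  integral replaces \<open>u\<close> by its tangential derivative, so the same argument applies to every
  derivative (\<open>cauchy_transform_A_infinity\<close>).

\<^item> \<^emph>\<open>The boundary cycle has winding number zero about every point outside.\<close>  The winding number
  of each boundary curve jumps by one from its right to its left side, and \<open>\<Omega>\<close> lies on the left.  With the
  Jordan curve theorem this determines the winding number of each curve on both of its sides
  (\<open>winding_number_sides\<close>).  Janiszewski's theorem shows that \<open>\<Omega>\<close> is the complement of
  the closed sides that do not contain it; these are disjoint and exactly one of them is unbounded, and the
  sum of the winding numbers follows (\<open>winding_numbers_sum_in_hole\<close>).

\<^item> \<^emph>\<open>Cauchy's theorem up to the boundary.\<close>  Pushing the boundary curves a distance \<open>\<epsilon>\<close> along the inner
  normal gives a cycle in \<open>\<Omega>\<close> with the same winding numbers about the points off the closure, to which the homological form of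
  Cauchy's theorem applies; then \<open>\<epsilon> \<rightarrow> 0\<close> (\<open>Cauchy_theorem_closure\<close>).
\<close>

section \<open>Smooth functions of a real variable\<close>

text \<open>Smoothness is a coinductive notion: a function is smooth as soon as it belongs to some set
  of functions that is closed under differentiation.  Closure properties can then be proved by exhibiting
  such a set instead of computing iterated derivatives.\<close>

lemma smooth_real_coinduct:
  assumes "f \<in> S"
    and step: "\<And>g. g \<in> S \<Longrightarrow> \<exists>g'\<in>S. \<forall>t. (g has_vector_derivative g' t) (at t)"
  shows "smooth_real f"
proof -
  obtain N where N: "\<And>g. g \<in> S \<Longrightarrow> N g \<in> S \<and> (\<forall>t. (g has_vector_derivative N g t) (at t))"
    using step by metis
  have S: "(N ^^ k) f \<in> S" for k
    by (induction k) (use assms(1) N in auto)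
  show ?thesis
    unfolding smooth_real_def
    by (rule exI[of _ "\<lambda>k. (N ^^ k) f"]) (use N[OF S] in auto)
qed

lemma smooth_real_has_vector_derivative:
  "smooth_real f \<Longrightarrow> (f has_vector_derivative vector_derivative f (at t)) (at t)"
  unfolding smooth_real_def by (metis vector_derivative_at)

lemma smooth_real_vector_derivative:
  assumes "smooth_real f"
  shows "smooth_real (\<lambda>t. vector_derivative f (at t))"
proof -
  obtain D where D: "D 0 = f" "\<And>k t. (D k has_vector_derivative D (Suc k) t) (at t)"
    using assms unfolding smooth_real_def by blast
  have "(\<lambda>t. vector_derivative f (at t)) = D (Suc 0)"
    using D(2)[of 0] D(1) by (auto simp: vector_derivative_at)
  then show ?thesis
    unfolding smooth_real_def using D(2) by (intro exI[of _ "\<lambda>k. D (Suc k)"]) auto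
qed

lemma smooth_real_continuous_on: "smooth_real f \<Longrightarrow> continuous_on X f"
  by (meson continuous_at_imp_continuous_on has_vector_derivative_continuous
      smooth_real_has_vector_derivative)

text \<open>The ring of functions generated by \<open>B\<close>.  By the sum and product rules it is closed under
  differentiation once it contains the derivatives of its generators.\<close>

inductive_set diff_ring :: "(real \<Rightarrow> complex) set \<Rightarrow> (real \<Rightarrow> complex) set" for B where
  base: "f \<in> B \<Longrightarrow> f \<in> diff_ring B"
| add: "f \<in> diff_ring B \<Longrightarrow> g \<in> diff_ring B \<Longrightarrow> (\<lambda>t. f t + g t) \<in> diff_ring B"
| mult: "f \<in> diff_ring B \<Longrightarrow> g \<in> diff_ring B \<Longrightarrow> (\<lambda>t. f t * g t) \<in> diff_ring B"

lemma smooth_real_diff_ring: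
  assumes "f \<in> diff_ring B"
    and B: "\<And>g. g \<in> B \<Longrightarrow> \<exists>g'\<in>diff_ring B. \<forall>t. (g has_vector_derivative g' t) (at t)"
  shows "smooth_real f"
proof (rule smooth_real_coinduct[OF assms(1)])
  fix g assume "g \<in> diff_ring B"
  then show "\<exists>g'\<in>diff_ring B. \<forall>t. (g has_vector_derivative g' t) (at t)"
  proof induction
    case (add f g)
    then obtain f' g' where
      "f' \<in> diff_ring B" "\<And>t. (f has_vector_derivative f' t) (at t)"
      "g' \<in> diff_ring B" "\<And>t. (g has_vector_derivative g' t) (at t)" by blast
    then show ?case
      by (intro bexI[of _ "\<lambda>t. f' t + g' t"]) (auto intro!: diff_ring.add has_vector_derivative_add)
  next
    case (mult f g)
    then obtain f' g' where fg:
      "f' \<in> diff_ring B" "\<And>t. (f has_vector_derivative f' t) (at t)"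
      "g' \<in> diff_ring B" "\<And>t. (g has_vector_derivative g' t) (at t)" by blast
    then show ?case
      by (intro bexI[of _ "\<lambda>t. f t * g' t + f' t * g t"])
         (auto intro!: diff_ring.add diff_ring.mult mult.hyps has_vector_derivative_mult)
  qed (use B in blast)
qed

lemma smooth_real_divide:
  fixes f g :: "real \<Rightarrow> complex"
  assumes "smooth_real f" "smooth_real g" and nz: "\<And>t. g t \<noteq> 0"
  shows "smooth_real (\<lambda>t. f t / g t)"
proof -
  obtain D where D: "D 0 = f" "\<And>k t. (D k has_vector_derivative D (Suc k) t) (at t)"
    using assms unfolding smooth_real_def by blast
  obtain E where E: "E 0 = g" "\<And>k t. (E k has_vector_derivative E (Suc k) t) (at t)"
    using assms unfolding smooth_real_def by blast
  let ?i = "\<lambda>t. 1 / g t"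
  \<comment> \<open>The quotient rule reads \<open>(1/g)' = (-1) * g' * (1/g) * (1/g)\<close>, so the derivatives of \<open>f\<close> and \<open>g\<close> together with \<open>1/g\<close> and constants generate a ring closed under differentiation.\<close>
  define B where "B = range D \<union> range E \<union> {?i, \<lambda>t. -1, \<lambda>t. 0}"
  have inB: "D k \<in> diff_ring B" "E k \<in> diff_ring B" "?i \<in> diff_ring B" 
    "(\<lambda>t. -1) \<in> diff_ring B" "(\<lambda>t. 0) \<in> diff_ring B" for k
    by (auto simp: B_def intro!: diff_ring.base)
  have "(\<lambda>t. f t * (1 / g t)) \<in> diff_ring B"
    using diff_ring.mult[OF inB(1)[of 0] inB(3)] by (simp add: D(1))
  then have "smooth_real (\<lambda>t. f t * (1 / g t))"
  proof (rule smooth_real_diff_ring)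
    fix h assume "h \<in> B"
    then consider k where "h = D k" | k where "h = E k" | "h = ?i" | c where "h = (\<lambda>t. c)"
      by (auto simp: B_def)
    then show "\<exists>g'\<in>diff_ring B. \<forall>t. (h has_vector_derivative g' t) (at t)"
    proof cases
      case 3
      have "((\<lambda>t. 1 / g t) has_vector_derivative -1 * E 1 t * (1 / g t) * (1 / g t)) (at t)" for t
      proof -
        have "(g has_vector_derivative E 1 t) (at t)"
          using E(2)[of 0 t] E(1) by simp
        from field_vector_diff_chain_at[OF this DERIV_inverse[OF nz]]
        show ?thesis by (simp add: o_def field_simps power2_eq_square)
      qed
      moreover have "(\<lambda>t. -1 * E 1 t * (1 / g t) * (1 / g t)) \<in> diff_ring B"
        by (intro diff_ring.mult inB)
      ultimately show ?thesis
        unfolding 3 by (intro bexI[of _ "\<lambda>t. -1 * E 1 t * (1 / g t) * (1 / g t)"]) auto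
    next
      case 4
      then show ?thesis using inB(5) by (auto intro!: bexI[of _ "\<lambda>t. 0"])
    qed (use D(2) E(2) inB in blast)+
  qed
  then show ?thesis by simp
qed


section \<open>Smooth closed curves\<close>

lemma periodic_of_int:
  fixes g :: "real \<Rightarrow> 'a"
  assumes "\<And>t. g (t + 1) = g t"
  shows "g (t + of_int k) = g t"
proof (induction k arbitrary: t rule: int_induct[of _ 0])
  case (step1 i)
  have "g (t + of_int (i + 1)) = g (t + of_int i + 1)" by (simp add: add.assoc)
  also have "\<dots> = g (t + of_int i)" by (rule assms)
  finally show ?case using step1 by simp
next
  case (step2 i)
  have "g (t + of_int (i - 1)) = g (t + of_int (i - 1) + 1)" by (rule assms[symmetric])
  with step2 show ?case by simp
qed auto

lemma periodic_reduce:
  fixes g :: "real \<Rightarrow> 'a"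
  assumes "\<And>t. g (t + 1) = g t"
  shows "g (frac t) = g t"
  using periodic_of_int[of g t "- floor t", OF assms] by (simp add: frac_def)

lemma periodic_bounded:
  fixes g :: "real \<Rightarrow> 'a::real_normed_vector"
  assumes p: "\<And>t. g (t + 1) = g t" and "continuous_on {0..1} g"
  obtains B where "0 < B" "\<And>t. norm (g t) \<le> B"
proof -
  have "compact (g ` {0..1})"
    using assms by (intro compact_continuous_image) auto
  then obtain B where B: "0 < B" "\<And>t. t \<in> {0..1} \<Longrightarrow> norm (g t) \<le> B"
    by (force dest!: compact_imp_bounded simp: bounded_pos)
  have "norm (g t) \<le> B" for t
    using B(2)[of "frac t"] periodic_reduce[of g t, OF p] frac_lt_1[of t] by auto
  with B(1) show ?thesis using that by blast
qed


lemma periodic_vector_derivative: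
  fixes g :: "real \<Rightarrow> 'a::real_normed_vector"
  assumes p: "\<And>t. g (t + 1) = g t"
  shows "vector_derivative g (at (t + 1)) = vector_derivative g (at t)"
proof -
  have shift: "(h has_vector_derivative D) (at (t + a))
      \<Longrightarrow> ((\<lambda>x. h (x + a)) has_vector_derivative D) (at t)" for h :: "real \<Rightarrow> 'a" and D t a
  proof -
    assume h: "(h has_vector_derivative D) (at (t + a))"
    have "((\<lambda>x. x + a) has_vector_derivative 1) (at t)"
      by (auto intro!: derivative_eq_intros)
    from vector_diff_chain_at[OF this h] show ?thesis by (simp add: o_def)
  qed
  have "(g has_vector_derivative D) (at (t + 1)) \<longleftrightarrow> (g has_vector_derivative D) (at t)" for D
    using shift[of g D t 1] shift[of g D "t + 1" "-1"] p p[of "x - 1" for x] by auto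
  then show ?thesis unfolding vector_derivative_def by simp
qed

lemma smooth_periodic_lipschitz:
  fixes g :: "real \<Rightarrow> 'a::real_normed_vector"
  assumes p: "\<And>t. g (t + 1) = g t" and g: "smooth_real g"
  obtains L where "0 < L" "\<And>s t. norm (g s - g t) \<le> L * \<bar>s - t\<bar>"
proof -
  obtain L where L: "0 < L" "\<And>t. norm (vector_derivative g (at t)) \<le> L"
    using periodic_bounded[of "\<lambda>t. vector_derivative g (at t)", OF periodic_vector_derivative[of g, OF p]
        smooth_real_continuous_on[OF smooth_real_vector_derivative[OF g]]] by blast
  have "norm (g s - g t) \<le> L * norm (s - t)" for s t
  proof (rule differentiable_bound[of UNIV])
    show "(g has_derivative (\<lambda>h. h *\<^sub>R vector_derivative g (at x))) (at x within UNIV)" for x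
      using smooth_real_has_vector_derivative[OF g] by (simp add: has_vector_derivative_def)
    show "onorm (\<lambda>h. h *\<^sub>R vector_derivative g (at x)) \<le> L" for x
      using L(2)[of x] by (intro onorm_le) (auto simp: mult.commute[of L] mult_left_mono)
  qed auto
  with L(1) show ?thesis using that by auto
qed

locale smooth_loop =
  fixes c :: "real \<Rightarrow> complex"
  assumes loop: "smooth_simple_closed_curve c"
begin

abbreviation c' :: "real \<Rightarrow> complex" where "c' t \<equiv> vector_derivative c (at t)"

lemma smooth: "smooth_real c" and periodic: "c (t + 1) = c t" and inj: "inj_on c {0..<1}"
  and c'_nonzero: "c' t \<noteq> 0"
  using loop unfolding smooth_simple_closed_curve_def by auto

lemma has_c': "(c has_vector_derivative c' t) (at t)"
  by (rule smooth_real_has_vector_derivative[OF smooth])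

lemma smooth_c': "smooth_real c'"
  by (rule smooth_real_vector_derivative[OF smooth])

lemma periodic_c': "c' (t + 1) = c' t"
  by (rule periodic_vector_derivative[of c, OF periodic])

lemma continuous_c: "continuous_on X c" and continuous_c': "continuous_on X c'"
  using smooth smooth_c' smooth_real_continuous_on by blast+

lemma c_frac: "c (frac t) = c t"
  using periodic_reduce[of c, OF periodic] .

lemma c_eq_iff: "c s = c t \<longleftrightarrow> s - t \<in> \<int>"
proof
  assume "c s = c t"
  then have "frac s = frac t"
    using inj c_frac[of s] c_frac[of t]
    by (auto simp: inj_on_def frac_lt_1)
  then show "s - t \<in> \<int>"
    by (simp add: frac_def) (metis Ints_of_int add_diff_cancel_left diff_add_cancel diff_diff_eq2 of_int_diff)
next
  assume "s - t \<in> \<int>"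
  then obtain k where "s = t + of_int k" by (metis Ints_cases add.commute diff_add_cancel)
  then show "c s = c t" using periodic_of_int[of c, OF periodic] by simp
qed

lemma c'_cong: "c s = c t \<Longrightarrow> c' s = c' t"
  unfolding c_eq_iff using periodic_of_int[of c', OF periodic_c']
  by (metis Ints_cases add.commute diff_add_cancel)

lemma range_c: "path_image c = range c"
proof -
  have "c t \<in> c ` {0..1}" for t
    using c_frac[of t] frac_lt_1[of t] frac_ge_0[of t]
    by (metis atLeastAtMost_iff imageI less_imp_le)
  then show ?thesis unfolding path_image_def by auto
qed

lemma compact_range_c: "compact (range c)"
  unfolding range_c[symmetric] path_image_def
  by (intro compact_continuous_image continuous_c) auto

lemma valid_path_c: "valid_path c"
  unfolding valid_path_def
  by (intro C1_differentiable_imp_piecewise)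
     (auto simp: C1_differentiable_on_def intro!: exI[of _ c'] has_c' continuous_c')

lemma closed_c: "pathfinish c = pathstart c"
  unfolding pathfinish_def pathstart_def using periodic[of 0] by simp

lemma simple_path_c: "simple_path c"
  unfolding simple_path_def loop_free_def
proof (intro conjI ballI impI)
  show "path c" by (rule valid_path_imp_path[OF valid_path_c])
  fix x y :: real assume xy: "x \<in> {0..1}" "y \<in> {0..1}" "c x = c y"
  then obtain k where k: "x - y = of_int k" using c_eq_iff by (metis Ints_cases)
  with xy have "real_of_int k \<le> 1" "real_of_int k \<ge> -1" by auto
  then have "k = -1 \<or> k = 0 \<or> k = 1" by linarith
  with k xy show "x = y \<or> x = 0 \<and> y = 1 \<or> x = 1 \<and> y = 0" by auto
qed

lemma c'_bounds:
  obtains m B where "0 < m" "0 < B" "\<And>t. m \<le> norm (c' t)" "\<And>t. norm (c' t) \<le> B"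
proof -
  obtain B where B: "0 < B" "\<And>t. norm (c' t) \<le> B"
    using periodic_bounded[of c', OF periodic_c' continuous_c'] by blast
  obtain b where b: "0 < b" "\<And>t. norm (1 / c' t) \<le> b"
  proof (rule periodic_bounded[of "\<lambda>t. 1 / c' t"])
    show "continuous_on {0..1} (\<lambda>t. 1 / c' t)"
      using c'_nonzero by (intro continuous_intros continuous_c') auto
  qed (use periodic_c' in auto)
  have "1 / b \<le> norm (c' t)" for t
    using b(1) b(2)[of t] c'_nonzero[of t] by (simp add: norm_divide pos_divide_le_eq mult.commute)
  with B b that[of "1/b" B] show ?thesis by auto
qed

text \<open>Uniform first-order Taylor estimate.  All later local statements about the curve reduce to it,
  because the speed is bounded away from zero.\<close>

lemma quadratic_approximation:
  obtains M where "0 < M" "\<And>s t. norm (c' s - c' t) \<le> M * \<bar>s - t\<bar>"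
    "\<And>s t. norm (c s - c t - (s - t) *\<^sub>R c' t) \<le> M * \<bar>s - t\<bar>\<^sup>2"
proof -
  obtain M where M: "0 < M" "\<And>s t. norm (c' s - c' t) \<le> M * \<bar>s - t\<bar>"
    using smooth_periodic_lipschitz[of c', OF periodic_c' smooth_c'] by blast
  have "norm (c s - c t - (s - t) *\<^sub>R c' t) \<le> norm (s - t) * (M * \<bar>s - t\<bar>)" for s t
  proof (rule vector_differentiable_bound_linearization[of "closed_segment t s"])
    show "norm (c' x - c' t) \<le> M * \<bar>s - t\<bar>" if "x \<in> closed_segment t s" for x
    proof -
      have "\<bar>x - t\<bar> \<le> \<bar>s - t\<bar>"
        using segment_bound(1)[OF that] by (simp add: abs_minus_commute)
      then show ?thesis using M mult_left_mono[of "\<bar>x - t\<bar>" "\<bar>s - t\<bar>" M] order_trans[OF M(2)[of x t]] by simp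
    qed
  qed (auto intro: has_vector_derivative_at_within has_c')
  then show ?thesis using M that[of M] by (simp add: power2_eq_square algebra_simps)
qed

text \<open>Compactness turns injectivity of the parametrization on a period into a uniform separation of
  points whose parameters are not close modulo the period.\<close>

lemma far_parameters_separated:
  assumes "0 < \<delta>"
  obtains e where "0 < e" "\<And>s t. \<delta> \<le> \<bar>s - t\<bar> \<Longrightarrow> \<bar>s - t\<bar> \<le> 1/2 \<Longrightarrow> e \<le> norm (c s - c t)"
proof (cases "\<delta> \<le> 1/2")
  case True
  let ?K = "{0..1::real} \<times> ({-1/2..-\<delta>} \<union> {\<delta>..1/2})"
  let ?f = "\<lambda>(t, r). norm (c (t + r) - c t)"
  have "compact ?K" by (intro compact_Times compact_Un) auto
  moreover have "continuous_on ?K ?f"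
    unfolding case_prod_unfold
    by (intro continuous_intros continuous_on_compose2[OF continuous_c[of UNIV]]) auto
  moreover have "(0, \<delta>) \<in> ?K" using True by simp
  ultimately obtain p where p: "p \<in> ?K" "\<And>q. q \<in> ?K \<Longrightarrow> ?f p \<le> ?f q"
    using continuous_attains_inf[of ?K ?f] by blast
  obtain t0 r0 where pr: "p = (t0, r0)" by (cases p)
  have r0: "\<bar>r0\<bar> \<le> 1/2" "r0 \<noteq> 0" using p pr assms by auto
  have "r0 \<notin> \<int>"
  proof
    assume "r0 \<in> \<int>"
    then obtain k where "r0 = of_int k" by (auto elim: Ints_cases)
    with r0 have "\<bar>real_of_int k\<bar> < 1" "k \<noteq> 0" by auto
    then show False by linarith
  qed
  then have "c (t0 + r0) \<noteq> c t0" unfolding c_eq_iff by simp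
  then have pos: "?f p > 0" by (simp add: pr)
  have "?f p \<le> norm (c s - c t)" if "\<delta> \<le> \<bar>s - t\<bar>" "\<bar>s - t\<bar> \<le> 1/2" for s t
  proof -
    have "(frac t, s - t) \<in> ?K"
      using that frac_lt_1[of t] by (auto simp: abs_if less_imp_le split: if_splits)
    from p(2)[OF this] have "?f p \<le> norm (c (frac t + (s - t)) - c (frac t))" by simp
    moreover have "c (frac t + (s - t)) = c s" unfolding c_eq_iff by (simp add: frac_def)
    ultimately show ?thesis by (simp add: c_frac)
  qed
  with pos show ?thesis using that by blast
next
  case False
  then show ?thesis using that[of 1] by force
qed

text \<open>The chord-arc property.  Close parameters are handled by the Taylor estimate, the others by
  compactness.  The parameter \<open>s'\<close> is the translate of \<open>s\<close> by an integer that is nearest to \<open>t\<close>.\<close>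

lemma chord_arc:
  obtains K where "0 < K" "\<And>s t. \<exists>s'. c s' = c s \<and> \<bar>s' - t\<bar> \<le> K * norm (c s - c t)"
proof -
  obtain m B where mB: "0 < m" "\<And>t. m \<le> norm (c' t)" using c'_bounds by metis
  obtain M where M: "0 < M" "\<And>s t. norm (c s - c t - (s - t) *\<^sub>R c' t) \<le> M * \<bar>s - t\<bar>\<^sup>2"
    using quadratic_approximation by metis
  define \<delta> where "\<delta> = m / (2 * M)"
  have "\<delta> > 0" using mB M by (simp add: \<delta>_def)
  then obtain e where e: "0 < e" 
    "\<And>s t. \<delta> \<le> \<bar>s - t\<bar> \<Longrightarrow> \<bar>s - t\<bar> \<le> 1/2 \<Longrightarrow> e \<le> norm (c s - c t)"
    using far_parameters_separated by blast
  define K where "K = max (2 / m) (1 / e)"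
  have K: "K > 0" "2 / m \<le> K" "1 / e \<le> K" using mB by (auto simp: K_def less_max_iff_disj)
  have "\<exists>s'. c s' = c s \<and> \<bar>s' - t\<bar> \<le> K * norm (c s - c t)" for s t
  proof -
    define s' where "s' = s - of_int (round (s - t))"
    have cs: "c s' = c s" unfolding c_eq_iff s'_def by simp
    have half: "\<bar>s' - t\<bar> \<le> 1/2"
      using of_int_round_abs_le[of "s - t"] unfolding s'_def by (simp add: abs_if split: if_splits)
    have "\<bar>s' - t\<bar> \<le> K * norm (c s' - c t)"
    proof (cases "\<bar>s' - t\<bar> \<le> \<delta>")
      case True
      have "M * \<bar>s' - t\<bar>\<^sup>2 \<le> m / 2 * \<bar>s' - t\<bar>"
        using mult_right_mono[OF True, of "M * \<bar>s' - t\<bar>"] M mB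
        by (simp add: \<delta>_def power2_eq_square field_simps)
      moreover have "m * \<bar>s' - t\<bar> \<le> norm ((s' - t) *\<^sub>R c' t)"
        using mB(2)[of t] by (simp add: mult.commute[of m] mult_left_mono)
      moreover have "norm ((s' - t) *\<^sub>R c' t) \<le> norm (c s' - c t) + norm (c s' - c t - (s' - t) *\<^sub>R c' t)"
        by (metis norm_triangle_ineq4 diff_diff_eq2 add_diff_cancel_left')
      ultimately have "m / 2 * \<bar>s' - t\<bar> \<le> norm (c s' - c t)"
        using M(2)[of s' t] by linarith
      then have "\<bar>s' - t\<bar> \<le> 2 / m * norm (c s' - c t)" using mB by (simp add: field_simps)
      also have "\<dots> \<le> K * norm (c s' - c t)" by (intro mult_right_mono K) auto
      finally show ?thesis .
    next
      case False
      then have "e \<le> norm (c s' - c t)" using e half by auto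
      then have "1 \<le> 1 / e * norm (c s' - c t)" using e by (simp add: field_simps)
      also have "\<dots> \<le> K * norm (c s' - c t)" by (intro mult_right_mono K) auto
      finally show ?thesis using half by linarith
    qed
    with cs show ?thesis by auto
  qed
  with K that show ?thesis by blast
qed

text \<open>A collar of uniform width.  If \<open>c s\<close> lay on the normal through \<open>c t\<close> at a small distance, dividing the
  Taylor estimate by \<open>c' t\<close> would give \<open>s - t - \<i>\<epsilon> = O((s - t)\<^sup>2)\<close>; the real part forces
  \<open>s = t\<close>, and then the imaginary part forces \<open>\<epsilon> = 0\<close>.\<close>

lemma normal_segment_avoids_curve:
  obtains \<epsilon>0 where "0 < \<epsilon>0"
    "\<And>s t \<epsilon>. 0 < \<bar>\<epsilon>\<bar> \<Longrightarrow> \<bar>\<epsilon>\<bar> < \<epsilon>0 \<Longrightarrow> c t + of_real \<epsilon> * (\<i> * c' t) \<noteq> c s"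
proof -
  obtain m B where mB: "0 < m" "0 < B" "\<And>t. m \<le> norm (c' t)" "\<And>t. norm (c' t) \<le> B"
    using c'_bounds by metis
  obtain M where M: "0 < M" "\<And>s t. norm (c s - c t - (s - t) *\<^sub>R c' t) \<le> M * \<bar>s - t\<bar>\<^sup>2"
    using quadratic_approximation by metis
  define \<delta> where "\<delta> = m / (2 * M)"
  have "\<delta> > 0" using mB M by (simp add: \<delta>_def)
  then obtain e where e: "0 < e" 
    "\<And>s t. \<delta> \<le> \<bar>s - t\<bar> \<Longrightarrow> \<bar>s - t\<bar> \<le> 1/2 \<Longrightarrow> e \<le> norm (c s - c t)"
    using far_parameters_separated by blast
  have "c t + of_real \<epsilon> * (\<i> * c' t) \<noteq> c s" if \<epsilon>: "0 < \<bar>\<epsilon>\<bar>" "\<bar>\<epsilon>\<bar> < e / B" for s t \<epsilon>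
  proof
    assume eq: "c t + of_real \<epsilon> * (\<i> * c' t) = c s"
    define s' where "s' = s - of_int (round (s - t))"
    have cs: "c s' = c s" unfolding c_eq_iff s'_def by simp
    have half: "\<bar>s' - t\<bar> \<le> 1/2"
      using of_int_round_abs_le[of "s - t"] unfolding s'_def by (simp add: abs_if split: if_splits)
    have diff: "c s' - c t = of_real \<epsilon> * (\<i> * c' t)" using eq cs by (simp add: algebra_simps)
    have "norm (c s' - c t) \<le> \<bar>\<epsilon>\<bar> * B"
      unfolding diff using mB(4)[of t] \<epsilon> by (simp add: norm_mult mult_left_mono)
    also have "\<dots> < e" using \<epsilon> mB by (simp add: field_simps)
    finally have near: "\<bar>s' - t\<bar> < \<delta>" using e(2)[of s' t] half by force
    have "c s' - c t - (s' - t) *\<^sub>R c' t = c' t * (of_real \<epsilon> * \<i> - of_real (s' - t))"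
      unfolding diff by (simp add: scaleR_conv_of_real algebra_simps)
    then have "norm (c' t) * norm (of_real \<epsilon> * \<i> - of_real (s' - t)) \<le> M * \<bar>s' - t\<bar>\<^sup>2"
      using M(2)[of s' t] by (metis norm_mult)
    moreover have "m * norm (of_real \<epsilon> * \<i> - of_real (s' - t)) \<le> norm (c' t) * norm (of_real \<epsilon> * \<i> - of_real (s' - t))"
      using mB(3)[of t] by (intro mult_right_mono) auto
    ultimately have *: "m * norm (of_real \<epsilon> * \<i> - of_real (s' - t)) \<le> M * \<bar>s' - t\<bar>\<^sup>2" by linarith
    have "\<bar>s' - t\<bar> \<le> norm (of_real \<epsilon> * \<i> - complex_of_real (s' - t))"
      using abs_Re_le_cmod[of "of_real \<epsilon> * \<i> - complex_of_real (s' - t)"] by simp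
    then have "m * \<bar>s' - t\<bar> \<le> M * \<bar>s' - t\<bar> * \<bar>s' - t\<bar>"
      using * mB(1) by (smt (verit, best) mult_left_mono power2_eq_square mult.assoc)
    moreover have "M * \<bar>s' - t\<bar> < m"
      using near M mB by (simp add: \<delta>_def field_simps)
    ultimately have "s' = t" using mB
      by (smt (verit, best) mult_less_cancel_right zero_less_abs_iff eq_iff_diff_eq_0)
    with * mB have "norm (of_real \<epsilon> * \<i> :: complex) \<le> 0"
      by (simp add: mult_le_0_iff)
    with \<epsilon> show False by simp
  qed
  then show ?thesis using e mB that[of "e / B"] by auto
qed

end

section \<open>Domains bounded by smooth curves\<close>

locale smooth_domain =
  fixes \<Omega> :: "complex set" and n :: nat and \<gamma> :: "nat \<Rightarrow> real \<Rightarrow> complex"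
  assumes domain: "smooth_connected_domain \<Omega> n"
    and boundary: "boundary_param \<Omega> n \<gamma>" and oriented: "positively_oriented \<Omega> n \<gamma>"
begin

lemma open_\<Omega>: "open \<Omega>" and connected_\<Omega>: "connected \<Omega>" and nonempty_\<Omega>: "\<Omega> \<noteq> {}"
  and bounded_\<Omega>: "bounded \<Omega>"
  using domain unfolding smooth_connected_domain_def by auto

lemma loop_\<gamma>: "j < n \<Longrightarrow> smooth_loop (\<gamma> j)"
  using boundary unfolding boundary_param_def smooth_loop_def by auto

lemma disjoint_\<gamma>: "i < n \<Longrightarrow> j < n \<Longrightarrow> i \<noteq> j \<Longrightarrow> range (\<gamma> i) \<inter> range (\<gamma> j) = {}"
  and frontier_\<Omega>: "frontier \<Omega> = (\<Union>j<n. range (\<gamma> j))"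
  using boundary unfolding boundary_param_def by auto

lemma \<gamma>_frontier: "j < n \<Longrightarrow> \<gamma> j t \<in> frontier \<Omega>"
  unfolding frontier_\<Omega> by auto

lemma frontierE:
  assumes "z \<in> frontier \<Omega>"
  obtains j t where "j < n" "z = \<gamma> j t"
  using assms unfolding frontier_\<Omega> by auto

lemma frontier_disjoint: "frontier \<Omega> \<inter> \<Omega> = {}"
  using open_\<Omega> frontier_disjoint_eq by blast

lemma compact_frontier_\<Omega>: "compact (frontier \<Omega>)"
  using bounded_\<Omega> by (rule compact_frontier_bounded)

lemma \<gamma>_not_in_\<Omega>: "j < n \<Longrightarrow> z \<in> \<Omega> \<Longrightarrow> z \<notin> path_image (\<gamma> j)"
  using frontier_disjoint smooth_loop.range_c[OF loop_\<gamma>] unfolding frontier_\<Omega> by blast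

text \<open>Functions on the boundary that are Lipschitz in the parameter are Lipschitz for the chordal
  distance: on one curve by the chord-arc property, and between two curves because these have a positive
  distance.  This is the form of regularity under which Cauchy integrals are estimated below.\<close>

lemma lipschitz_on_frontier:
  fixes u :: "complex \<Rightarrow> 'a::real_normed_vector"
  assumes u: "\<And>j. j < n \<Longrightarrow> \<exists>L\<ge>0. \<forall>s t. norm (u (\<gamma> j s) - u (\<gamma> j t)) \<le> L * \<bar>s - t\<bar>"
  obtains L where "L-lipschitz_on (frontier \<Omega>) u"
proof -
  have "\<exists>L\<ge>0. \<forall>s t. norm (u (\<gamma> i s) - u (\<gamma> j t)) \<le> L * norm (\<gamma> i s - \<gamma> j t)"
    if ij: "i < n" "j < n" for i j
  proof (cases "i = j")
    case True
    interpret smooth_loop "\<gamma> j" using loop_\<gamma>[OF ij(2)] .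
    obtain L where L: "L \<ge> 0" "\<And>s t. norm (u (\<gamma> j s) - u (\<gamma> j t)) \<le> L * \<bar>s - t\<bar>"
      using u[OF ij(2)] by blast
    obtain K where K: "0 < K" "\<And>s t. \<exists>s'. \<gamma> j s' = \<gamma> j s \<and> \<bar>s' - t\<bar> \<le> K * norm (\<gamma> j s - \<gamma> j t)"
      using chord_arc by blast
    have "norm (u (\<gamma> j s) - u (\<gamma> j t)) \<le> L * K * norm (\<gamma> j s - \<gamma> j t)" for s t
    proof -
      obtain s' where "\<gamma> j s' = \<gamma> j s" "\<bar>s' - t\<bar> \<le> K * norm (\<gamma> j s - \<gamma> j t)"
        using K(2) by blast
      then show ?thesis using L(2)[of s' t] mult_left_mono[OF _ L(1)]
        by (metis mult.assoc order_trans)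
    qed
    then show ?thesis using True L K by (intro exI[of _ "L * K"]) auto
  next
    case False
    have c: "compact (range (\<gamma> i))" "compact (range (\<gamma> j))"
      using smooth_loop.compact_range_c loop_\<gamma> ij by blast+
    obtain d where d: "d > 0" "\<And>x y. x \<in> range (\<gamma> i) \<Longrightarrow> y \<in> range (\<gamma> j) \<Longrightarrow> d \<le> dist x y"
      using separate_compact_closed[OF c(1) compact_imp_closed[OF c(2)] disjoint_\<gamma>[OF ij False]]
      by metis
    have bd: "\<exists>B\<ge>0. \<forall>t. norm (u (\<gamma> k t)) \<le> B" if k: "k < n" for k
    proof -
      interpret smooth_loop "\<gamma> k" using loop_\<gamma>[OF k] .
      obtain L where L: "L \<ge> 0" "\<And>s t. norm (u (\<gamma> k s) - u (\<gamma> k t)) \<le> L * \<bar>s - t\<bar>"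
        using u[OF k] by blast
      have "norm (u (\<gamma> k t)) \<le> norm (u (\<gamma> k 0)) + L" for t
      proof -
        have "norm (u (\<gamma> k (frac t)) - u (\<gamma> k 0)) \<le> L * 1"
          using order_trans[OF L(2) mult_left_mono[of "\<bar>frac t - 0\<bar>" 1 L]] L(1) frac_lt_1[of t] by simp
        then show ?thesis
          using norm_triangle_ineq2[of "u (\<gamma> k (frac t))" "u (\<gamma> k 0)"] by (simp add: c_frac)
      qed
      with L(1) show ?thesis by (intro exI[of _ "norm (u (\<gamma> k 0)) + L"]) auto
    qed
    obtain B where B: "B \<ge> 0" "\<And>t. norm (u (\<gamma> i t)) \<le> B" using bd[OF ij(1)] by blast
    obtain C where C: "C \<ge> 0" "\<And>t. norm (u (\<gamma> j t)) \<le> C" using bd[OF ij(2)] by blast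
    have "norm (u (\<gamma> i s) - u (\<gamma> j t)) \<le> (B + C) / d * norm (\<gamma> i s - \<gamma> j t)" for s t
    proof -
      have "norm (u (\<gamma> i s) - u (\<gamma> j t)) \<le> B + C"
        using norm_triangle_ineq4[of "u (\<gamma> i s)" "u (\<gamma> j t)"] B(2)[of s] C(2)[of t] by linarith
      also have "\<dots> \<le> (B + C) / d * norm (\<gamma> i s - \<gamma> j t)"
        using d(2)[of "\<gamma> i s" "\<gamma> j t"] d(1) B C mult_left_mono[of d "norm (\<gamma> i s - \<gamma> j t)" "B + C"]
        by (auto simp: dist_norm field_simps)
      finally show ?thesis .
    qed
    then show ?thesis using B C d by (intro exI[of _ "(B + C) / d"]) auto
  qed
  then obtain L where L: "\<And>i j. i < n \<Longrightarrow> j < n \<Longrightarrow> L i j \<ge> (0::real)"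
    "\<And>i j s t. i < n \<Longrightarrow> j < n \<Longrightarrow> norm (u (\<gamma> i s) - u (\<gamma> j t)) \<le> L i j * norm (\<gamma> i s - \<gamma> j t)"
    by metis
  have le: "L i j \<le> (\<Sum>i<n. \<Sum>j<n. L i j)" if "i < n" "j < n" for i j
    using member_le_sum[of j "{..<n}" "L i"] member_le_sum[of i "{..<n}" "\<lambda>i. \<Sum>j<n. L i j"] that L(1)
    by (force intro: sum_nonneg order_trans)
  show ?thesis
  proof (rule that, rule lipschitz_onI)
    fix z w assume "z \<in> frontier \<Omega>" "w \<in> frontier \<Omega>"
    then obtain i s j t where *: "i < n" "z = \<gamma> i s" "j < n" "w = \<gamma> j t" by (metis frontierE)
    then show "dist (u z) (u w) \<le> (\<Sum>i<n. \<Sum>j<n. L i j) * dist z w"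
      using order_trans[OF L(2)[of i j s t] mult_right_mono[OF le[of i j]]] by (simp add: dist_norm)
  qed (auto intro!: sum_nonneg L)
qed

lemma smooth_on_boundary_lipschitz:
  fixes u :: "complex \<Rightarrow> 'a::real_normed_vector"
  assumes u: "smooth_on_boundary n \<gamma> u"
  obtains L where "L-lipschitz_on (frontier \<Omega>) u"
proof -
  have "\<exists>L\<ge>0. \<forall>s t. norm (u (\<gamma> j s) - u (\<gamma> j t)) \<le> L * \<bar>s - t\<bar>" if "j < n" for j
    using smooth_periodic_lipschitz[of "\<lambda>t. u (\<gamma> j t)"] smooth_loop.periodic[OF loop_\<gamma>[OF that]]
      u that unfolding smooth_on_boundary_def by (metis less_imp_le)
  then show ?thesis using lipschitz_on_frontier[of u] that by blast
qed

text \<open>The orientation hypothesis places points of the normal in \<open>\<Omega>\<close> for \<open>\<epsilon>\<close> depending on the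
  boundary point.  Since short normal segments avoid the whole boundary, each of them lies entirely in \<open>\<Omega>\<close>, and the
  width becomes uniform.\<close>

lemma inner_collar:
  obtains \<epsilon>0 where "0 < \<epsilon>0"
    "\<And>j t \<epsilon>. j < n \<Longrightarrow> 0 < \<epsilon> \<Longrightarrow> \<epsilon> < \<epsilon>0 \<Longrightarrow>
       \<gamma> j t + of_real \<epsilon> * (\<i> * vector_derivative (\<gamma> j) (at t)) \<in> \<Omega>"
proof -
  let ?\<nu> = "\<lambda>j t \<epsilon>. \<gamma> j t + of_real \<epsilon> * (\<i> * vector_derivative (\<gamma> j) (at t))"
  have avoid: "\<exists>\<epsilon>0>0. \<forall>t s. \<forall>\<epsilon>. 0 < \<epsilon> \<and> \<epsilon> < \<epsilon>0 \<longrightarrow> ?\<nu> j t \<epsilon> \<noteq> \<gamma> k s" if jk: "j < n" "k < n" for j k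
  proof -
    interpret smooth_loop "\<gamma> j" using loop_\<gamma>[OF jk(1)] .
    obtain m B where mB: "0 < m" "0 < B" "\<And>t. m \<le> norm (c' t)" "\<And>t. norm (c' t) \<le> B"
      using c'_bounds by metis
    have small: "norm (?\<nu> j t \<epsilon> - \<gamma> j t) \<le> \<epsilon> * B" if "0 < \<epsilon>" for t \<epsilon>
      using mB(4)[of t] that by (simp add: norm_mult)
    show ?thesis
    proof (cases "j = k")
      case False
      have c: "compact (range (\<gamma> j))" "compact (range (\<gamma> k))"
        using smooth_loop.compact_range_c loop_\<gamma> jk by blast+
      obtain d where d: "d > 0" "\<And>x y. x \<in> range (\<gamma> j) \<Longrightarrow> y \<in> range (\<gamma> k) \<Longrightarrow> d \<le> dist x y"
        using separate_compact_closed[OF c(1) compact_imp_closed[OF c(2)] disjoint_\<gamma>[OF jk False]]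
        by metis
      have "?\<nu> j t \<epsilon> \<noteq> \<gamma> k s" if "0 < \<epsilon>" "\<epsilon> < d / B" for s t \<epsilon>
        using small[OF that(1), of t] d(2)[of "\<gamma> j t" "\<gamma> k s"] that mB
        by (fastforce simp: dist_norm norm_minus_commute[of "\<gamma> j t"] pos_less_divide_eq)
      then show ?thesis using d mB by (intro exI[of _ "d / B"]) auto
    next
      case True
      obtain \<epsilon>0 where "0 < \<epsilon>0"
        "\<And>s t \<epsilon>. 0 < \<bar>\<epsilon>\<bar> \<Longrightarrow> \<bar>\<epsilon>\<bar> < \<epsilon>0 \<Longrightarrow> \<gamma> j t + of_real \<epsilon> * (\<i> * c' t) \<noteq> \<gamma> j s"
        using normal_segment_avoids_curve by blast
      then show ?thesis using True by (intro exI[of _ \<epsilon>0]) auto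
    qed
  qed
  then obtain E where E: "\<And>j k. j < n \<Longrightarrow> k < n \<Longrightarrow> E j k > (0::real)"
    "\<And>j k t s \<epsilon>. j < n \<Longrightarrow> k < n \<Longrightarrow> 0 < \<epsilon> \<Longrightarrow> \<epsilon> < E j k \<Longrightarrow> ?\<nu> j t \<epsilon> \<noteq> \<gamma> k s"
    by metis
  define S where "S = insert 1 ((\<lambda>(j,k). E j k) ` ({..<n} \<times> {..<n}))"
  have fin: "finite S" "S \<noteq> {}" by (auto simp: S_def)
  have pos: "Min S > 0" using fin E(1) by (auto simp: S_def)
  have le: "Min S \<le> E j k" if "j < n" "k < n" for j k
    using that fin by (intro Min_le) (auto simp: S_def)
  have "?\<nu> j t \<epsilon> \<in> \<Omega>" if j: "j < n" and \<epsilon>: "0 < \<epsilon>" "\<epsilon> < Min S" for j t \<epsilon>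
  proof -
    interpret smooth_loop "\<gamma> j" using loop_\<gamma>[OF j] .
    let ?C = "(\<lambda>\<epsilon>. ?\<nu> j t \<epsilon>) ` {0<..<Min S}"
    have "connected ?C"
      by (intro connected_continuous_image continuous_intros) auto
    moreover have "?C \<inter> frontier \<Omega> = {}"
      using E(2)[OF j] le[OF j] unfolding frontier_\<Omega> by (force simp: image_iff)
    moreover have "?C \<inter> \<Omega> \<noteq> {}"
    proof -
      have "\<forall>\<^sub>F \<epsilon> in at_right 0. ?\<nu> j t \<epsilon> \<in> \<Omega>" using oriented j unfolding positively_oriented_def by blast
      moreover have "\<forall>\<^sub>F \<epsilon> in at_right 0. \<epsilon> \<in> {0<..<Min S}"
        using pos eventually_at_right_real by blast
      ultimately have "\<forall>\<^sub>F \<epsilon> in at_right 0. ?\<nu> j t \<epsilon> \<in> \<Omega> \<and> \<epsilon> \<in> {0<..<Min S}"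
        by eventually_elim auto
      then show ?thesis using eventually_happens'[OF trivial_limit_at_right_real] by blast
    qed
    ultimately have "?C \<subseteq> \<Omega>" using connected_Int_frontier[of ?C \<Omega>] by blast
    moreover have "?\<nu> j t \<epsilon> \<in> ?C" using \<epsilon> by (intro imageI) auto
    ultimately show ?thesis by blast
  qed
  with pos show ?thesis using that by blast
qed

end


section \<open>Boundary values of Cauchy integrals\<close>

context smooth_loop begin

lemma finite_preimage: "finite {t \<in> {0..1}. c t = w}"
proof (cases "\<exists>t\<in>{0..1}. c t = w")
  case True
  then obtain t0 where t0: "t0 \<in> {0..1}" "c t0 = w" by blast
  have "{t \<in> {0..1}. c t = w} \<subseteq> {t0, 0, 1}"
    using t0 simple_path_c unfolding simple_path_def loop_free_def by fastforce
  then show ?thesis by (rule finite_subset) auto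
next
  case False
  then have "{t \<in> {0..1}. c t = w} = {}" by blast
  then show ?thesis by (simp only: finite.emptyI)
qed

lemma contour_integral_c: "contour_integral c f = integral {0..1} (\<lambda>t. f (c t) * c' t)"
  by (rule contour_integral_integral)

lemma contour_integrable_c:
  assumes "continuous_on (range c) f"
  shows "f contour_integrable_on c"
  unfolding contour_integrable_on
  by (intro integrable_continuous_real continuous_intros continuous_c'
        continuous_on_compose2[OF assms continuous_c]) auto

text \<open>Here \<open>p z\<close> is a point of the boundary \<open>S\<close> nearest to \<open>z\<close>.  Then
  \<open>|\<zeta> - p z| \<le> |\<zeta> - z| + |z - p z| \<le> 2 |\<zeta> - z|\<close> for \<open>\<zeta>\<close> on the boundary, so the divided
  differences are bounded by \<open>2 L\<close> however \<open>z\<close> approaches \<open>w\<close>, and dominated convergence applies.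
  Subtracting \<open>f w\<close> instead of \<open>f (p z)\<close> would only give such a bound for nontangential approach.\<close>

lemma tendsto_divided_difference_integral:
  assumes f: "L-lipschitz_on S f" and S: "range c \<subseteq> S" "w \<in> S"
    and p: "\<And>z. z \<in> \<Omega> \<Longrightarrow> p z \<in> S" "\<And>z \<zeta>. z \<in> \<Omega> \<Longrightarrow> \<zeta> \<in> S \<Longrightarrow> dist z (p z) \<le> dist z \<zeta>"
    and disj: "\<Omega> \<inter> S = {}"
  shows "((\<lambda>z. contour_integral c (\<lambda>\<zeta>. (f \<zeta> - f (p z)) / (\<zeta> - z)))
           \<longlongrightarrow> contour_integral c (\<lambda>\<zeta>. (f \<zeta> - f w) / (\<zeta> - w))) (at w within \<Omega>)"
  unfolding tendsto_at_iff_sequentially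
proof (intro allI impI)
  fix X :: "nat \<Rightarrow> complex"
  assume X: "\<forall>i. X i \<in> \<Omega> - {w}" "X \<longlonglongrightarrow> w"
  obtain m B where B: "0 < B" "\<And>t. norm (c' t) \<le> B" using c'_bounds by metis
  have L: "L \<ge> 0" using f by (rule lipschitz_on_nonneg)
  have XO: "X k \<in> \<Omega>" for k using X(1) by blast
  have cS: "c t \<in> S" for t using S(1) by blast
  have pw: "(\<lambda>k. p (X k)) \<longlonglongrightarrow> w"
  proof (rule metric_tendsto_imp_tendsto)
    show "(\<lambda>k. 2 * dist (X k) w) \<longlonglongrightarrow> 0"
      using tendsto_mult_left[OF tendsto_dist[OF X(2) tendsto_const[of w]], of 2] by simp
    show "\<forall>\<^sub>F k in sequentially. dist (p (X k)) w \<le> dist (2 * dist (X k) w) 0"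
    proof (intro always_eventually allI)
      fix k
      have "dist (p (X k)) w \<le> dist (X k) (p (X k)) + dist (X k) w"
        using dist_triangle[of "p (X k)" w "X k"] by (simp add: dist_commute)
      also have "dist (X k) (p (X k)) \<le> dist (X k) w" by (rule p(2)[OF XO S(2)])
      finally show "dist (p (X k)) w \<le> dist (2 * dist (X k) w) 0" by simp
    qed
  qed
  have "continuous_on S f" using f by (rule lipschitz_on_continuous_on)
  then have fp: "(\<lambda>k. f (p (X k))) \<longlonglongrightarrow> f w"
    by (rule continuous_on_tendsto_compose[OF _ pw S(2)]) (simp add: p(1)[OF XO])
  \<comment> \<open>The integrands need not converge at the finitely many parameters of \<open>w\<close>, which are removed.\<close>
  define T where "T = {t \<in> {0..1}. c t \<noteq> w}"
  have neg: "negligible {t \<in> {0..1}. c t = w}" by (rule negligible_finite[OF finite_preimage])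
  let ?g = "\<lambda>k t. (f (c t) - f (p (X k))) / (c t - X k) * c' t"
  let ?h = "\<lambda>t. (f (c t) - f w) / (c t - w) * c' t"
  have ne: "c t \<noteq> X k" for t k
    using XO[of k] cS[of t] disj by auto
  have diff: "negligible ({0..1} - T \<union> (T - {0..1}))"
    by (rule negligible_subset[OF neg]) (auto simp: T_def)
  have T: "integral {0..1} q = integral T q" for q :: "real \<Rightarrow> complex"
    by (rule integral_spike_set) (rule negligible_subset[OF diff], blast)+
  have "(\<lambda>k. integral T (?g k)) \<longlonglongrightarrow> integral T ?h"
  proof (rule dominated_convergence(2)[where h = "\<lambda>_. 2 * L * B"])
    fix k
    have "?g k integrable_on {0..1}"
    proof (intro integrable_continuous_real continuous_intros continuous_c continuous_c')
      show "continuous_on {0..1} (\<lambda>t. f (c t))"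
        by (rule continuous_on_compose2[OF \<open>continuous_on S f\<close> continuous_c]) (use S(1) in auto)
    qed (use ne in auto)
    then show "?g k integrable_on T"
      by (rule integrable_spike_set_eq[OF diff, THEN iffD1])
    fix t assume "t \<in> T"
    have "norm (f (c t) - f (p (X k))) \<le> L * dist (c t) (p (X k))"
      using lipschitz_onD[OF f, of "c t" "p (X k)"] cS p(1)[OF XO] by (auto simp: dist_norm)
    also have "dist (c t) (p (X k)) \<le> 2 * norm (c t - X k)"
    proof -
      have "dist (c t) (p (X k)) \<le> dist (c t) (X k) + dist (X k) (p (X k))" by (rule dist_triangle)
      moreover have "dist (X k) (p (X k)) \<le> dist (X k) (c t)" by (rule p(2)[OF XO cS])
      ultimately show ?thesis by (simp add: dist_norm norm_minus_commute)
    qed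
    finally have "norm ((f (c t) - f (p (X k))) / (c t - X k)) \<le> 2 * L"
      using L ne[of t k] by (simp add: norm_divide divide_le_eq mult_left_mono)
    then show "norm (?g k t) \<le> 2 * L * B"
      using B(2)[of t] L B(1) unfolding norm_mult by (intro mult_mono) auto
  next
    show "(\<lambda>_. 2 * L * B) integrable_on T"
      by (rule integrable_spike_set_eq[OF diff, THEN iffD1]) auto
  next
    fix t assume "t \<in> T"
    then show "(\<lambda>k. ?g k t) \<longlonglongrightarrow> ?h t"
      using X(2) fp by (intro tendsto_intros) (auto simp: T_def)
  qed
  then show "((\<lambda>z. contour_integral c (\<lambda>\<zeta>. (f \<zeta> - f (p z)) / (\<zeta> - z))) \<circ> X)
      \<longlonglongrightarrow> contour_integral c (\<lambda>\<zeta>. (f \<zeta> - f w) / (\<zeta> - w))"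
    unfolding contour_integral_c o_def T .
qed

end

context smooth_domain begin

lemma winding_numbers_constant:
  obtains C where "\<And>z. z \<in> \<Omega> \<Longrightarrow> (\<Sum>j<n. winding_number (\<gamma> j) z) = C"
proof -
  have "winding_number (\<gamma> j) constant_on \<Omega>" if "j < n" for j
  proof -
    interpret smooth_loop "\<gamma> j" using loop_\<gamma>[OF that] .
    show ?thesis
      using winding_number_constant[OF valid_path_imp_path[OF valid_path_c] closed_c connected_\<Omega>]
        \<gamma>_not_in_\<Omega>[OF that] by blast
  qed
  then obtain W where "\<And>j z. j < n \<Longrightarrow> z \<in> \<Omega> \<Longrightarrow> winding_number (\<gamma> j) z = W j"
    unfolding constant_on_def by metis
  then show ?thesis using that[of "\<Sum>j<n. W j"] by simp
qed

text \<open>The Cauchy integral splits into a divided-difference integral and \<open>f (p z)\<close> times the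
  total winding number, which is constant on \<open>\<Omega>\<close>; both parts have limits at \<open>w\<close>.\<close>

lemma cauchy_integral_tendsto_frontier:
  assumes f: "L-lipschitz_on (frontier \<Omega>) f" and w: "w \<in> frontier \<Omega>"
  shows "\<exists>l. (cauchy_integral n \<gamma> f \<longlongrightarrow> l) (at w within \<Omega>)"
proof -
  define p where "p = closest_point (frontier \<Omega>)"
  have p: "p z \<in> frontier \<Omega>" "\<And>\<zeta>. \<zeta> \<in> frontier \<Omega> \<Longrightarrow> dist z (p z) \<le> dist z \<zeta>" for z
    unfolding p_def using closest_point_exists[of "frontier \<Omega>" z] w by auto
  obtain C where C: "\<And>z. z \<in> \<Omega> \<Longrightarrow> (\<Sum>j<n. winding_number (\<gamma> j) z) = C"
    using winding_numbers_constant by blast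
  have cont: "continuous_on (frontier \<Omega>) f" using f by (rule lipschitz_on_continuous_on)
  have "(p \<longlongrightarrow> w) (at w within \<Omega>)"
  proof (rule metric_tendsto_imp_tendsto)
    show "((\<lambda>z. 2 * dist z w) \<longlongrightarrow> 0) (at w within \<Omega>)"
      using tendsto_mult_left[OF tendsto_dist[OF tendsto_ident_at tendsto_const[of w]], of 2 w \<Omega>] by simp
    show "\<forall>\<^sub>F z in at w within \<Omega>. dist (p z) w \<le> dist (2 * dist z w) 0"
    proof (intro always_eventually allI)
      fix z
      have "dist (p z) w \<le> dist z (p z) + dist z w"
        using dist_triangle[of "p z" w z] by (simp add: dist_commute)
      also have "dist z (p z) \<le> dist z w" using p(2) w by auto
      finally show "dist (p z) w \<le> dist (2 * dist z w) 0" by simp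
    qed
  qed
  then have fp: "((\<lambda>z. f (p z)) \<longlongrightarrow> f w) (at w within \<Omega>)"
    by (rule continuous_on_tendsto_compose[OF cont]) (auto simp: w p)
  have lim: "((\<lambda>z. 1 / (2 * of_real pi * \<i>) *
       (\<Sum>j<n. contour_integral (\<gamma> j) (\<lambda>\<zeta>. (f \<zeta> - f (p z)) / (\<zeta> - z))) + f (p z) * C)
     \<longlongrightarrow> 1 / (2 * of_real pi * \<i>) *
       (\<Sum>j<n. contour_integral (\<gamma> j) (\<lambda>\<zeta>. (f \<zeta> - f w) / (\<zeta> - w))) + f w * C) (at w within \<Omega>)"
    by (intro tendsto_intros fp smooth_loop.tendsto_divided_difference_integral[OF loop_\<gamma> f])
       (use w p frontier_disjoint \<gamma>_frontier in auto)
  have eq: "1 / (2 * of_real pi * \<i>) *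
       (\<Sum>j<n. contour_integral (\<gamma> j) (\<lambda>\<zeta>. (f \<zeta> - f (p z)) / (\<zeta> - z))) + f (p z) * C
      = cauchy_integral n \<gamma> f z" if z: "z \<in> \<Omega>" for z
  proof -
    have "contour_integral (\<gamma> j) (\<lambda>\<zeta>. (f \<zeta> - f (p z)) / (\<zeta> - z))
       = contour_integral (\<gamma> j) (\<lambda>\<zeta>. f \<zeta> / (\<zeta> - z))
         - f (p z) * (2 * pi * \<i> * winding_number (\<gamma> j) z)" if j: "j < n" for j
    proof -
      interpret smooth_loop "\<gamma> j" using loop_\<gamma>[OF j] .
      have zj: "z \<notin> path_image (\<gamma> j)" using \<gamma>_not_in_\<Omega>[OF j z] .
      have "continuous_on (range (\<gamma> j)) f" 
        by (rule continuous_on_subset[OF cont]) (use \<gamma>_frontier[OF j] in auto)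
      then have "(\<lambda>\<zeta>. f \<zeta> / (\<zeta> - z)) contour_integrable_on \<gamma> j"
        using zj unfolding range_c by (intro contour_integrable_c continuous_intros) auto
      from has_contour_integral_diff[OF has_contour_integral_integral[OF this]
          has_contour_integral_lmul[OF has_contour_integral_winding_number[OF valid_path_c zj], of "f (p z)"]]
      show ?thesis by (simp add: contour_integral_unique diff_divide_distrib)
    qed
    then have "(\<Sum>j<n. contour_integral (\<gamma> j) (\<lambda>\<zeta>. (f \<zeta> - f (p z)) / (\<zeta> - z)))
      = (\<Sum>j<n. contour_integral (\<gamma> j) (\<lambda>\<zeta>. f \<zeta> / (\<zeta> - z))) - f (p z) * (2 * pi * \<i>) * C"
      unfolding C[OF z, symmetric] by (simp add: sum_subtractf sum_distrib_left mult.assoc)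
    then show ?thesis unfolding cauchy_integral_def by (simp add: field_simps)
  qed
  have "\<forall>\<^sub>F z in at w within \<Omega>. z \<in> \<Omega>" by (simp add: eventually_at_filter)
  then have "\<forall>\<^sub>F z in at w within \<Omega>. 1 / (2 * of_real pi * \<i>) *
       (\<Sum>j<n. contour_integral (\<gamma> j) (\<lambda>\<zeta>. (f \<zeta> - f (p z)) / (\<zeta> - z))) + f (p z) * C
      = cauchy_integral n \<gamma> f z"
    by eventually_elim (rule eq)
  from Lim_transform_eventually[OF lim this] show ?thesis by blast
qed

lemma within_\<Omega>_nontrivial: "w \<in> closure \<Omega> \<Longrightarrow> \<not> trivial_limit (at w within \<Omega>)"
  using islimpt_closure_open[OF open_\<Omega> refl, of w] by (simp add: trivial_limit_within limpt_of_closure)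

lemma contour_integrable_cauchy_kernel:
  assumes "continuous_on (frontier \<Omega>) f" "j < n" "z \<in> \<Omega>"
  shows "(\<lambda>\<zeta>. f \<zeta> / (\<zeta> - z) ^ k) contour_integrable_on \<gamma> j"
proof -
  interpret smooth_loop "\<gamma> j" using loop_\<gamma> assms by blast
  have "continuous_on (range (\<gamma> j)) f" 
    by (rule continuous_on_subset[OF assms(1)]) (use \<gamma>_frontier assms in auto)
  then show ?thesis
    using \<gamma>_not_in_\<Omega>[OF assms(2,3)] unfolding range_c
    by (intro contour_integrable_c continuous_intros) auto
qed

lemma cauchy_integral_has_derivative_square:
  assumes cont: "continuous_on (frontier \<Omega>) f" and z: "z \<in> \<Omega>"
  shows "(cauchy_integral n \<gamma> f has_field_derivative
     1 / (2 * of_real pi * \<i>) * (\<Sum>j<n. contour_integral (\<gamma> j) (\<lambda>\<zeta>. f \<zeta> / (\<zeta> - z)\<^sup>2))) (at z)"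
proof -
  have "((\<lambda>z. contour_integral (\<gamma> j) (\<lambda>\<zeta>. f \<zeta> / (\<zeta> - z))) has_field_derivative
       contour_integral (\<gamma> j) (\<lambda>\<zeta>. f \<zeta> / (\<zeta> - z)\<^sup>2)) (at z)" if j: "j < n" for j
  proof -
    interpret smooth_loop "\<gamma> j" using loop_\<gamma>[OF j] .
    obtain m B where B: "0 < B" "\<And>t. norm (c' t) \<le> B" using c'_bounds by metis
    have cf: "continuous_on (path_image (\<gamma> j)) f" unfolding range_c
      by (rule continuous_on_subset[OF cont]) (use \<gamma>_frontier[OF j] in auto)
    have "((\<lambda>z. contour_integral (\<gamma> j) (\<lambda>\<zeta>. f \<zeta> / (\<zeta> - z))) has_field_derivative
        of_nat 1 * contour_integral (\<gamma> j) (\<lambda>\<zeta>. f \<zeta> / (\<zeta> - z) ^ Suc 1)) (at z)"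
    proof (rule Cauchy_next_derivative(2)[OF cf B(2) _ _ open_\<Omega> valid_path_c])
      show "((\<lambda>\<zeta>. f \<zeta> / (\<zeta> - w) ^ 1) has_contour_integral
              contour_integral (\<gamma> j) (\<lambda>\<zeta>. f \<zeta> / (\<zeta> - w))) (\<gamma> j)"
        if "w \<in> \<Omega> - path_image (\<gamma> j)" for w
        using has_contour_integral_integral[OF contour_integrable_cauchy_kernel[OF cont j, of w 1]] that
        by simp
    qed (use z \<gamma>_not_in_\<Omega>[OF j z] in auto)
    then show ?thesis by (simp add: power2_eq_square numeral_2_eq_2)
  qed
  then show ?thesis
    unfolding cauchy_integral_def by (auto intro!: derivative_eq_intros)
qed

lemma cauchy_integral_holomorphic:
  assumes "continuous_on (frontier \<Omega>) f"
  shows "cauchy_integral n \<gamma> f holomorphic_on \<Omega>"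
  using cauchy_integral_has_derivative_square[OF assms] open_\<Omega> by (auto simp: holomorphic_on_open)

lemma cauchy_transform_interior:
  assumes "continuous_on (frontier \<Omega>) f" "z \<in> \<Omega>"
  shows "cauchy_transform \<Omega> n \<gamma> f z = cauchy_integral n \<gamma> f z"
proof -
  have "continuous_on \<Omega> (cauchy_integral n \<gamma> f)"
    using cauchy_integral_holomorphic[OF assms(1)] by (rule holomorphic_on_imp_continuous_on)
  then have "(cauchy_integral n \<gamma> f \<longlongrightarrow> cauchy_integral n \<gamma> f z) (at z within \<Omega>)"
    using assms(2) by (simp add: continuous_on_def)
  then show ?thesis
    unfolding cauchy_transform_def
    using within_\<Omega>_nontrivial[of z] assms(2) closure_subset by (intro tendsto_Lim) auto
qed

lemma cauchy_integral_tendsto_transform: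
  assumes f: "L-lipschitz_on (frontier \<Omega>) f" and w: "w \<in> closure \<Omega>"
  shows "(cauchy_integral n \<gamma> f \<longlongrightarrow> cauchy_transform \<Omega> n \<gamma> f w) (at w within \<Omega>)"
proof -
  have cont: "continuous_on (frontier \<Omega>) f" using f by (rule lipschitz_on_continuous_on)
  have "\<exists>l. (cauchy_integral n \<gamma> f \<longlongrightarrow> l) (at w within \<Omega>)"
  proof (cases "w \<in> \<Omega>")
    case True
    then show ?thesis
      using holomorphic_on_imp_continuous_on[OF cauchy_integral_holomorphic[OF cont]]
      by (auto simp: continuous_on_def)
  next
    case False
    then have "w \<in> frontier \<Omega>" using w open_\<Omega> by (simp add: frontier_def interior_open)
    then show ?thesis by (rule cauchy_integral_tendsto_frontier[OF f])
  qed
  then show ?thesis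
    unfolding cauchy_transform_def using within_\<Omega>_nontrivial[OF w] tendsto_Lim by metis
qed

text \<open>A function defined by limits from \<open>\<Omega>\<close> is continuous on the closure: values at two nearby points of the
  closure are compared through a point of \<open>\<Omega>\<close>.\<close>

lemma cauchy_transform_continuous:
  assumes f: "L-lipschitz_on (frontier \<Omega>) f"
  shows "continuous_on (closure \<Omega>) (cauchy_transform \<Omega> n \<gamma> f)"
  unfolding continuous_on_iff
proof (intro ballI allI impI)
  let ?F = "cauchy_transform \<Omega> n \<gamma> f" and ?f = "cauchy_integral n \<gamma> f"
  have cont: "continuous_on (frontier \<Omega>) f" using f by (rule lipschitz_on_continuous_on)
  note near = cauchy_integral_tendsto_transform[OF f, unfolded tendsto_iff eventually_at, rule_format]
  fix w e assume w: "w \<in> closure \<Omega>" and e: "(0::real) < e"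
  obtain d where d: "d > 0" "\<And>z. z \<in> \<Omega> \<Longrightarrow> z \<noteq> w \<Longrightarrow> dist z w < d \<Longrightarrow> dist (?f z) (?F w) < e/2"
    using near[OF w, of "e/2"] e by auto
  have d': "dist (?f z) (?F w) < e/2" if "z \<in> \<Omega>" "dist z w < d" for z
    using d(2)[of z] that e cauchy_transform_interior[OF cont, of z] by (cases "z = w") auto
  show "\<exists>d>0. \<forall>x\<in>closure \<Omega>. dist x w < d \<longrightarrow> dist (?F x) (?F w) < e"
  proof (intro exI[of _ "d/2"] conjI ballI impI)
    fix x assume x: "x \<in> closure \<Omega>" "dist x w < d/2"
    obtain r where r: "r > 0" "\<And>z. z \<in> \<Omega> \<Longrightarrow> z \<noteq> x \<Longrightarrow> dist z x < r \<Longrightarrow> dist (?f z) (?F x) < e/2"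
      using near[OF x(1), of "e/2"] e by auto
    obtain z where z: "z \<in> \<Omega>" "dist z x < min r (d/2)"
      using x(1) r(1) d(1) closure_approachable by (metis min_less_iff_conj half_gt_zero)
    have "dist (?f z) (?F x) < e/2"
      using r(2)[of z] z e cauchy_transform_interior[OF cont, of z] by (cases "z = x") auto
    moreover have "dist (?f z) (?F w) < e/2"
      using d'[OF z(1)] z(2) x(2) dist_triangle[of z w x] by auto
    ultimately show "dist (?F x) (?F w) < e"
      by (metis dist_commute dist_triangle_half_l)
  qed (use d in auto)
qed

end

section \<open>Derivatives of Cauchy integrals\<close>

text \<open>The derivative of \<open>u\<close> along the boundary divided by the derivative of the parametrization,
  that is, \<open>du/dz\<close> along the boundary.  Periodicity makes the choice of the parameter immaterial.\<close>

definition tangential_derivative ::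
    "nat \<Rightarrow> (nat \<Rightarrow> real \<Rightarrow> complex) \<Rightarrow> (complex \<Rightarrow> complex) \<Rightarrow> complex \<Rightarrow> complex" where
  "tangential_derivative n \<gamma> u z =
     (case (SOME (j, t). j < n \<and> \<gamma> j t = z) of (j, t) \<Rightarrow>
        vector_derivative (\<lambda>s. u (\<gamma> j s)) (at t) / vector_derivative (\<gamma> j) (at t))"

context smooth_domain begin

lemma tangential_derivative_eq:
  assumes j: "j < n"
  shows "tangential_derivative n \<gamma> u (\<gamma> j t)
    = vector_derivative (\<lambda>s. u (\<gamma> j s)) (at t) / vector_derivative (\<gamma> j) (at t)"
proof -
  interpret smooth_loop "\<gamma> j" using loop_\<gamma>[OF j] .
  obtain i s where some: "(SOME (i, s). i < n \<and> \<gamma> i s = \<gamma> j t) = (i, s)" by fastforce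
  have "case (i, s) of (i, s) \<Rightarrow> i < n \<and> \<gamma> i s = \<gamma> j t"
    unfolding some[symmetric] by (rule someI[of _ "(j, t)"]) (use j in auto)
  then have i: "i < n" "\<gamma> i s = \<gamma> j t" by auto
  have "i = j" using disjoint_\<gamma>[OF i(1) j] i(2) by (metis disjoint_iff rangeI)
  with i have "s - t \<in> \<int>" using c_eq_iff by simp
  then obtain k where k: "s = t + of_int k" by (metis Ints_cases add.commute diff_add_cancel)
  have "vector_derivative (\<lambda>s. u (\<gamma> j s)) (at (t + 1)) = vector_derivative (\<lambda>s. u (\<gamma> j s)) (at t)" for t
    by (rule periodic_vector_derivative) (simp add: periodic)
  from periodic_of_int[of "\<lambda>t. vector_derivative (\<lambda>s. u (\<gamma> j s)) (at t)" t k, OF this]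
  show ?thesis
    unfolding tangential_derivative_def some using \<open>i = j\<close> k c'_cong[of s t] i(2) by simp
qed

lemma tangential_derivative_smooth:
  assumes "smooth_on_boundary n \<gamma> u"
  shows "smooth_on_boundary n \<gamma> (tangential_derivative n \<gamma> u)"
  unfolding smooth_on_boundary_def
proof (intro allI impI)
  fix j assume j: "j < n"
  interpret smooth_loop "\<gamma> j" using loop_\<gamma>[OF j] .
  have "smooth_real (\<lambda>t. u (\<gamma> j t))" using assms j unfolding smooth_on_boundary_def by blast
  then show "smooth_real (\<lambda>t. tangential_derivative n \<gamma> u (\<gamma> j t))"
    unfolding tangential_derivative_eq[OF j]
    by (intro smooth_real_divide smooth_real_vector_derivative smooth_c' c'_nonzero)
qed

lemma smooth_on_boundary_continuous:
  assumes "smooth_on_boundary n \<gamma> u"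
  shows "continuous_on (frontier \<Omega>) u"
  using smooth_on_boundary_lipschitz[OF assms] lipschitz_on_continuous_on by blast

text \<open>Differentiating the kernel gives \<open>u / (\<zeta> - z)\<^sup>2\<close>, and
  \<open>d(u / (\<zeta> - z)) = du / (\<zeta> - z) - u d\<zeta> / (\<zeta> - z)\<^sup>2\<close> integrates to zero over a closed curve.  Thus the derivative
  is again a Cauchy integral of a smooth density.\<close>

lemma cauchy_integral_has_derivative_tangential:
  assumes u: "smooth_on_boundary n \<gamma> u" and z: "z \<in> \<Omega>"
  shows "(cauchy_integral n \<gamma> u has_field_derivative
     cauchy_integral n \<gamma> (tangential_derivative n \<gamma> u) z) (at z)"
proof -
  have "contour_integral (\<gamma> j) (\<lambda>\<zeta>. u \<zeta> / (\<zeta> - z)\<^sup>2)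
      = contour_integral (\<gamma> j) (\<lambda>\<zeta>. tangential_derivative n \<gamma> u \<zeta> / (\<zeta> - z))" if j: "j < n" for j
  proof -
    interpret smooth_loop "\<gamma> j" using loop_\<gamma>[OF j] .
    have ne: "\<gamma> j t - z \<noteq> 0" for t using \<gamma>_not_in_\<Omega>[OF j z] range_c by auto
    let ?u = "\<lambda>t. u (\<gamma> j t)"
    have su: "smooth_real ?u" using u j unfolding smooth_on_boundary_def by blast
    have du: "(?u has_vector_derivative vector_derivative ?u (at t)) (at t)" for t
      by (rule smooth_real_has_vector_derivative[OF su])
    have inv: "((\<lambda>t. inverse (\<gamma> j t - z)) has_vector_derivative
        c' t * - (inverse (\<gamma> j t - z) ^ Suc (Suc 0))) (at t)" for t
    proof -
      have "((\<lambda>t. \<gamma> j t - z) has_vector_derivative c' t) (at t)"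
        using has_vector_derivative_diff[OF has_c'[of t] has_vector_derivative_const, of z] by simp
      from field_vector_diff_chain_at[OF this DERIV_inverse[OF ne]] show ?thesis by (simp add: o_def)
    qed
    have "((\<lambda>t. ?u t * (c' t * - (inverse (\<gamma> j t - z) ^ Suc (Suc 0)))
           + vector_derivative ?u (at t) * inverse (\<gamma> j t - z))
       has_integral ?u 1 * inverse (\<gamma> j 1 - z) - ?u 0 * inverse (\<gamma> j 0 - z)) {0..1}"
      by (rule fundamental_theorem_of_calculus)
         (simp, rule has_vector_derivative_at_within, rule has_vector_derivative_mult[OF du inv])
    moreover have "\<gamma> j 1 = \<gamma> j 0" using periodic[of 0] by simp
    ultimately have "((\<lambda>t. ?u t * (c' t * - (inverse (\<gamma> j t - z) ^ Suc (Suc 0)))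
           + vector_derivative ?u (at t) * inverse (\<gamma> j t - z)) has_integral 0) {0..1}"
      by (simp only: diff_self)
    then have I: "((\<lambda>t. tangential_derivative n \<gamma> u (\<gamma> j t) / (\<gamma> j t - z) * c' t
        - u (\<gamma> j t) / (\<gamma> j t - z)\<^sup>2 * c' t) has_integral 0) {0..1}"
    proof (rule has_integral_eq[rotated])
      fix t :: real
      have t: "tangential_derivative n \<gamma> u (\<gamma> j t) / (\<gamma> j t - z) * c' t
        = vector_derivative ?u (at t) * inverse (\<gamma> j t - z)"
        using c'_nonzero[of t] by (simp add: tangential_derivative_eq[OF j] divide_inverse)
      have u: "?u t * (c' t * - (inverse (\<gamma> j t - z) ^ Suc (Suc 0)))
        = - (u (\<gamma> j t) / (\<gamma> j t - z)\<^sup>2 * c' t)"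
        by (simp add: power2_eq_square divide_inverse)
      show "?u t * (c' t * - (inverse (\<gamma> j t - z) ^ Suc (Suc 0)))
           + vector_derivative ?u (at t) * inverse (\<gamma> j t - z)
        = tangential_derivative n \<gamma> u (\<gamma> j t) / (\<gamma> j t - z) * c' t
          - u (\<gamma> j t) / (\<gamma> j t - z)\<^sup>2 * c' t"
        unfolding t u by (rule uminus_add_conv_diff)
    qed
    have A: "(\<lambda>t. tangential_derivative n \<gamma> u (\<gamma> j t) / (\<gamma> j t - z) * c' t) integrable_on {0..1}"
      using contour_integrable_cauchy_kernel[OF smooth_on_boundary_continuous[OF tangential_derivative_smooth[OF u]] j z, of 1]
      by (simp add: contour_integrable_on)
    have B: "(\<lambda>t. u (\<gamma> j t) / (\<gamma> j t - z)\<^sup>2 * c' t) integrable_on {0..1}"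
      using contour_integrable_cauchy_kernel[OF smooth_on_boundary_continuous[OF u] j z, of 2]
      by (simp add: contour_integrable_on)
    show ?thesis
      unfolding contour_integral_c using trans[OF integral_diff[OF A B, symmetric] integral_unique[OF I]]
      by (simp only: right_minus_eq)
  qed
  then show ?thesis
    using cauchy_integral_has_derivative_square[OF smooth_on_boundary_continuous[OF u] z]
    unfolding cauchy_integral_def[of n \<gamma> "tangential_derivative n \<gamma> u"] by simp
qed

text \<open>By iteration every complex derivative of \<open>\<C>u\<close> is the Cauchy transform of a smooth function, hence
  continuous up to the boundary.  The mixed partial derivatives differ from these by powers of \<open>\<i>\<close>.\<close>

lemma cauchy_transform_A_infinity:
  assumes u: "smooth_on_boundary n \<gamma> u"
  shows "cauchy_transform \<Omega> n \<gamma> u \<in> A_infinity \<Omega>"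
proof -
  define U where "U k = (tangential_derivative n \<gamma> ^^ k) u" for k
  have U: "smooth_on_boundary n \<gamma> (U k)" for k
    by (induction k) (auto simp: U_def u intro: tangential_derivative_smooth)
  let ?C = "cauchy_transform \<Omega> n \<gamma>"
  define D where "D a b z = \<i> ^ b * ?C (U (a + b)) z" for a b z
  have deriv: "(?C (U k) has_field_derivative ?C (U (Suc k)) z) (at z)" if z: "z \<in> \<Omega>" for k z
  proof -
    have "(cauchy_integral n \<gamma> (U k) has_field_derivative cauchy_integral n \<gamma> (U (Suc k)) z) (at z)"
      using cauchy_integral_has_derivative_tangential[OF U z] by (simp add: U_def)
    then show ?thesis
      unfolding cauchy_transform_interior[OF smooth_on_boundary_continuous[OF U] z]
      by (rule has_field_derivative_transform_within_open[OF _ open_\<Omega> z])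
         (simp add: cauchy_transform_interior[OF smooth_on_boundary_continuous[OF U]])
  qed
  have "smooth_on_closure \<Omega> (?C u)"
    unfolding smooth_on_closure_def
  proof (intro exI[of _ D] conjI allI ballI)
    show "D 0 0 z = ?C u z" for z by (simp add: D_def U_def)
    show "continuous_on (closure \<Omega>) (D a b)" for a b
    proof -
      obtain L where "L-lipschitz_on (frontier \<Omega>) (U (a + b))" using smooth_on_boundary_lipschitz[OF U] by blast
      then show ?thesis
        unfolding D_def by (intro continuous_intros cauchy_transform_continuous)
    qed
    fix a b z assume z: "z \<in> \<Omega>"
    have "(D a b has_derivative (*) (\<i> ^ b * ?C (U (Suc (a + b))) z)) (at z)"
    proof -
      have "((\<lambda>z. \<i> ^ b * ?C (U (a + b)) z) has_field_derivative \<i> ^ b * ?C (U (Suc (a + b))) z) (at z)"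
        by (rule DERIV_cmult[OF deriv[OF z]])
      then show ?thesis unfolding has_field_derivative_def D_def .
    qed
    also have "(*) (\<i> ^ b * ?C (U (Suc (a + b))) z)
      = (\<lambda>h. of_real (Re h) * D (Suc a) b z + of_real (Im h) * D a (Suc b) z)"
    proof
      fix h
      have "\<i> ^ b * ?C (U (Suc (a + b))) z * h
        = \<i> ^ b * ?C (U (Suc (a + b))) z * (of_real (Re h) + \<i> * of_real (Im h))"
        by (simp add: complex_eq[symmetric])
      then show "\<i> ^ b * ?C (U (Suc (a + b))) z * h
        = of_real (Re h) * D (Suc a) b z + of_real (Im h) * D a (Suc b) z"
        by (simp add: D_def algebra_simps)
    qed
    finally show "(D a b has_derivative
       (\<lambda>h. of_real (Re h) * D (Suc a) b z + of_real (Im h) * D a (Suc b) z)) (at z)" .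
  qed
  moreover have "?C u holomorphic_on \<Omega>"
    using deriv[of _ 0] open_\<Omega> by (auto simp: holomorphic_on_open U_def)
  ultimately show ?thesis unfolding A_infinity_def by blast
qed

end


section \<open>The jump of the winding number across a curve\<close>

text \<open>The model case of the jump relation: the curve is replaced by its tangent line, with the parameter centred at \<open>1/2\<close>.
  As \<open>\<epsilon>\<close> tends to zero the value tends to \<open>2 \<pi> \<i>\<close>.\<close>

lemma arctan_integral:
  fixes \<epsilon> :: real
  assumes "0 < \<epsilon>"
  shows "((\<lambda>t. 1 / (of_real (t - 1/2) - \<i> * of_real \<epsilon>) - 1 / (of_real (t - 1/2) - \<i> * of_real (- \<epsilon>)))
     has_integral 4 * \<i> * of_real (arctan (1 / (2 * \<epsilon>)))) {0..1}"
proof -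
  have "((\<lambda>t. 2 * \<epsilon> / ((t - 1/2)\<^sup>2 + \<epsilon>\<^sup>2)) has_integral
      2 * arctan ((1 - 1/2) / \<epsilon>) - 2 * arctan ((0 - 1/2) / \<epsilon>)) {0..1}"
  proof (rule fundamental_theorem_of_calculus)
    fix t :: real
    have "\<epsilon>\<^sup>2 + (t - 1/2)\<^sup>2 > 0" using assms by (simp add: add_pos_nonneg)
    then have "((\<lambda>t. 2 * arctan ((t - 1/2) / \<epsilon>)) has_real_derivative 2 * \<epsilon> / ((t - 1/2)\<^sup>2 + \<epsilon>\<^sup>2)) (at t)"
      using assms
      by (auto intro!: derivative_eq_intros simp: inverse_eq_divide divide_simps power2_eq_square add.commute)
    then show "((\<lambda>t. 2 * arctan ((t - 1/2) / \<epsilon>)) has_vector_derivative 2 * \<epsilon> / ((t - 1/2)\<^sup>2 + \<epsilon>\<^sup>2))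
        (at t within {0..1})"
      by (simp add: has_real_derivative_iff_has_vector_derivative has_vector_derivative_at_within)
  qed simp
  moreover have "(0 - 1/2) / \<epsilon> = - (1 / (2 * \<epsilon>))" "(1 - 1/2) / \<epsilon> = 1 / (2 * \<epsilon>)" by auto
  ultimately have "((\<lambda>t. 2 * \<epsilon> / ((t - 1/2)\<^sup>2 + \<epsilon>\<^sup>2)) has_integral 4 * arctan (1 / (2 * \<epsilon>))) {0..1}"
    by (simp add: arctan_minus)
  then have "((\<lambda>t. of_real (2 * \<epsilon> / ((t - 1/2)\<^sup>2 + \<epsilon>\<^sup>2)) :: complex) has_integral
      of_real (4 * arctan (1 / (2 * \<epsilon>)))) {0..1}"
    by (rule has_integral_of_real)
  then have "((\<lambda>t. \<i> * of_real (2 * \<epsilon> / ((t - 1/2)\<^sup>2 + \<epsilon>\<^sup>2)) :: complex) has_integral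
      \<i> * of_real (4 * arctan (1 / (2 * \<epsilon>)))) {0..1}"
    by (rule has_integral_mult_right)
  then have "((\<lambda>t. 1 / (of_real (t - 1/2) - \<i> * of_real \<epsilon>) - 1 / (of_real (t - 1/2) - \<i> * of_real (- \<epsilon>)))
     has_integral \<i> * of_real (4 * arctan (1 / (2 * \<epsilon>)))) {0..1}"
  proof (rule has_integral_eq[rotated])
    fix t :: real
    define \<tau> where "\<tau> = t - 1/2"
    have nz: "of_real \<tau> - \<i> * of_real \<epsilon> \<noteq> 0" "of_real \<tau> + \<i> * of_real \<epsilon> \<noteq> 0"
      using assms by (auto simp: complex_eq_iff)
    have "of_real (\<tau>\<^sup>2 + \<epsilon>\<^sup>2) = (of_real \<tau> - \<i> * of_real \<epsilon>) * (of_real \<tau> + \<i> * of_real \<epsilon>)"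
      by (simp add: algebra_simps power2_eq_square)
    then have "\<i> * of_real (2 * \<epsilon> / (\<tau>\<^sup>2 + \<epsilon>\<^sup>2)) =
      \<i> * 2 * of_real \<epsilon> / ((of_real \<tau> - \<i> * of_real \<epsilon>) * (of_real \<tau> + \<i> * of_real \<epsilon>))"
      by (simp only: of_real_divide of_real_mult) simp
    also have "\<dots> = 1 / (of_real \<tau> - \<i> * of_real \<epsilon>) - 1 / (of_real \<tau> + \<i> * of_real \<epsilon>)"
      using nz by (simp add: diff_frac_eq)
    finally show "\<i> * of_real (2 * \<epsilon> / ((t - 1/2)\<^sup>2 + \<epsilon>\<^sup>2))
      = 1 / (of_real (t - 1/2) - \<i> * of_real \<epsilon>) - 1 / (of_real (t - 1/2) - \<i> * of_real (- \<epsilon>))"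
      by (simp add: \<tau>_def)
  qed
  then show ?thesis by (simp add: mult.assoc mult.left_commute)
qed

context smooth_loop begin

text \<open>The function \<open>q\<close> is the curve in the coordinate in which its point at \<open>1/2\<close> is the origin and its velocity there is \<open>1\<close>.
  It agrees with \<open>t - 1/2\<close> to second order, so the Cauchy kernels of the
  curve and of its tangent line at the same point \<open>\<i>\<epsilon>\<close> of the normal differ by a quantity that is bounded independently of
  \<open>\<epsilon>\<close>, although each of them blows up.\<close>

lemma pole_comparison_bounded:
  defines "q \<equiv> \<lambda>t. (c t - c (1/2)) / c' (1/2)"
  obtains K \<epsilon>0 where "0 < \<epsilon>0" "\<And>\<epsilon> t. 0 < \<bar>\<epsilon>\<bar> \<Longrightarrow> \<bar>\<epsilon>\<bar> < \<epsilon>0 \<Longrightarrow> t \<in> {0..1} \<Longrightarrow>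
      norm (c' t / c' (1/2) / (q t - \<i> * of_real \<epsilon>) - 1 / (of_real (t - 1/2) - \<i> * of_real \<epsilon>)) \<le> K"
proof -
  let ?v = "c' (1/2)"
  obtain m B where mB: "0 < m" "0 < B" "\<And>t. m \<le> norm (c' t)" "\<And>t. norm (c' t) \<le> B"
    using c'_bounds by metis
  obtain M0 where M0: "0 < M0" "\<And>s t. norm (c' s - c' t) \<le> M0 * \<bar>s - t\<bar>"
    "\<And>s t. norm (c s - c t - (s - t) *\<^sub>R c' t) \<le> M0 * \<bar>s - t\<bar>\<^sup>2"
    using quadratic_approximation by metis
  define M where "M = M0 / norm ?v"
  have v: "norm ?v > 0" using c'_nonzero by simp
  have M: "M > 0" using M0 v by (simp add: M_def)
  have q1: "norm (c' t / ?v - 1) \<le> M * \<bar>t - 1/2\<bar>" for t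
  proof -
    have "c' t / ?v - 1 = (c' t - ?v) / ?v" using c'_nonzero by (simp add: diff_divide_distrib)
    then show ?thesis using M0(2)[of t "1/2"] v by (simp add: M_def norm_divide divide_right_mono)
  qed
  have q2: "norm (q t - of_real (t - 1/2)) \<le> M * \<bar>t - 1/2\<bar>\<^sup>2" for t
  proof -
    have "q t - of_real (t - 1/2) = (c t - c (1/2) - (t - 1/2) *\<^sub>R ?v) / ?v"
      using c'_nonzero by (simp add: q_def diff_divide_distrib scaleR_conv_of_real)
    then show ?thesis using M0(3)[of t "1/2"] v by (simp add: M_def norm_divide divide_right_mono)
  qed
  define \<delta> where "\<delta> = 1 / (2 * M)"
  have \<delta>: "\<delta> > 0" using M by (simp add: \<delta>_def)
  obtain e0 where e0: "0 < e0"
    "\<And>s t. \<delta> \<le> \<bar>s - t\<bar> \<Longrightarrow> \<bar>s - t\<bar> \<le> 1/2 \<Longrightarrow> e0 \<le> norm (c s - c t)"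
    using far_parameters_separated[OF \<delta>] by blast
  define e where "e = e0 / norm ?v"
  have e: "e > 0" using e0 v by (simp add: e_def)
  have far: "e \<le> norm (q t)" if "\<delta> \<le> \<bar>t - 1/2\<bar>" "t \<in> {0..1}" for t
  proof -
    have "\<bar>t - 1/2\<bar> \<le> 1/2" using that(2) unfolding abs_le_iff by auto
    then show ?thesis
      using e0(2)[OF that(1)] v by (simp add: q_def e_def norm_divide divide_right_mono)
  qed
  define K where "K = max (4 * M) (B / m * (2 / e) + 1 / \<delta>)"
  have "norm (c' t / ?v / (q t - \<i> * of_real \<epsilon>) - 1 / (of_real (t - 1/2) - \<i> * of_real \<epsilon>)) \<le> K"
    if \<epsilon>: "0 < \<bar>\<epsilon>\<bar>" "\<bar>\<epsilon>\<bar> < e / 2" and t: "t \<in> {0..1}" for \<epsilon> t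
  proof -
    define \<tau> where "\<tau> = t - 1/2"
    let ?p = "of_real \<tau> - \<i> * of_real \<epsilon> :: complex" and ?q = "q t - \<i> * of_real \<epsilon>" and ?r = "c' t / ?v"
    have p: "\<bar>\<tau>\<bar> \<le> norm ?p" "\<bar>\<epsilon>\<bar> \<le> norm ?p"
      using abs_Re_le_cmod[of ?p] abs_Im_le_cmod[of ?p] by auto
    then have p0: "norm ?p > 0" using \<epsilon> by linarith
    show ?thesis
    proof (cases "\<bar>\<tau>\<bar> < \<delta>")
      case True
      \<comment> \<open>\<open>\<delta>\<close> is chosen so that the quadratic error is at most half of the distance to the pole.\<close>
      have "M * \<bar>\<tau>\<bar>\<^sup>2 \<le> \<bar>\<tau>\<bar> / 2"
        using mult_right_mono[OF less_imp_le[OF True], of "M * \<bar>\<tau>\<bar>"] M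
        by (simp add: \<delta>_def power2_eq_square field_simps)
      then have "norm (?q - ?p) \<le> norm ?p / 2"
      proof -
        have "?q - ?p = q t - of_real \<tau>" by simp
        then have "norm (?q - ?p) = norm (q t - of_real \<tau>)" by (simp only:)
        then show ?thesis
          using q2[of t, folded \<tau>_def] p(1) \<open>M * \<bar>\<tau>\<bar>\<^sup>2 \<le> \<bar>\<tau>\<bar> / 2\<close> by linarith
      qed
      then have q: "norm ?p / 2 \<le> norm ?q"
        using norm_triangle_ineq2[of ?p ?q] by (simp add: norm_minus_commute)
      then have nz: "?p \<noteq> 0" "?q \<noteq> 0" using p0 by auto
      have "?r / ?q - 1 / ?p = ((?r - 1) * ?p - (q t - of_real \<tau>)) / (?q * ?p)"
      proof -
        have "r / b - 1 / a = ((r - 1) * a - (b - a)) / (b * a)" if "a \<noteq> 0" "b \<noteq> 0" for r a b :: complex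
          using that by (simp add: field_simps)
        moreover have "?q - ?p = q t - of_real \<tau>" by simp
        ultimately show ?thesis using nz by metis
      qed
      then have "norm (?r / ?q - 1 / ?p) = norm ((?r - 1) * ?p - (q t - of_real \<tau>)) / (norm ?q * norm ?p)"
        by (simp only: norm_divide norm_mult)
      also have "\<dots> \<le> 2 * M * (norm ?p)\<^sup>2 / (norm ?p / 2 * norm ?p)"
      proof (rule frac_le)
        have "norm ((?r - 1) * ?p - (q t - of_real \<tau>)) \<le> norm (?r - 1) * norm ?p + norm (q t - of_real \<tau>)"
          by (metis norm_triangle_ineq4 norm_mult)
        also have "\<dots> \<le> (M * norm ?p) * norm ?p + M * (norm ?p)\<^sup>2"
        proof (intro add_mono mult_right_mono)
          show "norm (?r - 1) \<le> M * norm ?p"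
            using q1[of t, folded \<tau>_def] mult_left_mono[OF p(1), of M] M by linarith
          have "\<bar>\<tau>\<bar>\<^sup>2 \<le> (norm ?p)\<^sup>2" using p(1) by (intro power_mono) auto
          then show "norm (q t - of_real \<tau>) \<le> M * (norm ?p)\<^sup>2"
            using q2[of t, folded \<tau>_def] mult_left_mono[of "\<bar>\<tau>\<bar>\<^sup>2" "(norm ?p)\<^sup>2" M] M by linarith
        qed auto
        also have "\<dots> = 2 * M * (norm ?p)\<^sup>2" by (simp add: power2_eq_square)
        finally show "norm ((?r - 1) * ?p - (q t - of_real \<tau>)) \<le> 2 * M * (norm ?p)\<^sup>2" .
        show "norm ?p / 2 * norm ?p \<le> norm ?q * norm ?p" using q by (intro mult_right_mono) auto
        show "0 < norm ?p / 2 * norm ?p" using p0 by simp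
        show "0 \<le> 2 * M * (norm ?p)\<^sup>2" using M by simp
      qed
      also have "\<dots> = 4 * M"
      proof -
        have "2 * M * x\<^sup>2 / (x / 2 * x) = 4 * M" if "x > 0" for x :: real
          using that by (simp add: power2_eq_square)
        from this[OF p0] show ?thesis .
      qed
      also have "\<dots> \<le> K" by (simp add: K_def)
      finally show ?thesis by (simp add: \<tau>_def)
    next
      case False
      have "norm (q t) \<ge> e" using far[of t] False t by (simp add: \<tau>_def)
      then have q: "norm ?q \<ge> e / 2"
        using norm_triangle_ineq2[of "q t" "\<i> * of_real \<epsilon>"] \<epsilon> by (simp add: norm_mult)
      have "norm (?r / ?q - 1 / ?p) \<le> norm (?r / ?q) + norm (1 / ?p)" by (rule norm_triangle_ineq4)
      also have "norm (?r / ?q) = norm (c' t) / norm ?v / norm ?q" by (simp only: norm_divide)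
      also have "\<dots> \<le> B / m / (e / 2)"
        using mB q e by (intro frac_le) auto
      also have "norm (1 / ?p) \<le> 1 / \<delta>"
        using False p(1) \<delta> by (simp add: norm_divide frac_le)
      finally show ?thesis by (simp add: K_def \<tau>_def)
    qed
  qed
  with e that[of "e / 2" K] show ?thesis by auto
qed

text \<open>The difference between the kernels of the curve and of its tangent has the same limit from both sides, by
  dominated convergence, so it does not contribute to the jump; the tangent line contributes
  \<open>(2 / \<pi>) * arctan (1 / (2 \<epsilon>))\<close>, which tends to \<open>1\<close>.  Winding numbers of closed curves are integers, hence the jump equals
  \<open>1\<close> already for some small \<open>\<epsilon>\<close>.  The parameter \<open>1/2\<close> is an interior point of the parameter interval, which keeps the
  singularity away from the end points.\<close>

lemma winding_number_jump:
  assumes "0 < r"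
  obtains \<epsilon> where "0 < \<epsilon>" "\<epsilon> < r" 
    "c (1/2) - of_real \<epsilon> * (\<i> * c' (1/2)) \<notin> path_image c"
    "winding_number c (c (1/2) + of_real \<epsilon> * (\<i> * c' (1/2)))
      - winding_number c (c (1/2) - of_real \<epsilon> * (\<i> * c' (1/2))) = 1"
proof -
  let ?v = "c' (1/2)"
  let ?z = "\<lambda>\<epsilon>::real. c (1/2) + of_real \<epsilon> * (\<i> * ?v)"
  define q where "q = (\<lambda>t. (c t - c (1/2)) / ?v)"
  define D where "D = (\<lambda>\<epsilon> t. c' t / ?v / (q t - \<i> * of_real \<epsilon>) - 1 / (of_real (t - 1/2) - \<i> * of_real \<epsilon>))"
  obtain K \<epsilon>1 where K: "0 < \<epsilon>1" 
    "\<And>\<epsilon> t. 0 < \<bar>\<epsilon>\<bar> \<Longrightarrow> \<bar>\<epsilon>\<bar> < \<epsilon>1 \<Longrightarrow> t \<in> {0..1} \<Longrightarrow> norm (D \<epsilon> t) \<le> K"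
    unfolding D_def q_def by (rule pole_comparison_bounded) blast
  obtain \<epsilon>2 where \<epsilon>2: "0 < \<epsilon>2" "\<And>s t \<epsilon>. 0 < \<bar>\<epsilon>\<bar> \<Longrightarrow> \<bar>\<epsilon>\<bar> < \<epsilon>2 \<Longrightarrow> c t + of_real \<epsilon> * (\<i> * c' t) \<noteq> c s"
    using normal_segment_avoids_curve by blast
  define R where "R = min r (min \<epsilon>1 \<epsilon>2)"
  have R: "R > 0" "R \<le> r" "R \<le> \<epsilon>1" "R \<le> \<epsilon>2" using assms K \<epsilon>2 by (auto simp: R_def)
  have off: "?z \<epsilon> \<notin> path_image c" if "0 < \<bar>\<epsilon>\<bar>" "\<bar>\<epsilon>\<bar> < R" for \<epsilon>
    using \<epsilon>2(2)[of \<epsilon> "1/2"] that R unfolding range_c by auto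
  have q_ne: "q t - \<i> * of_real \<epsilon> \<noteq> 0" if "0 < \<bar>\<epsilon>\<bar>" "\<bar>\<epsilon>\<bar> < R" for t \<epsilon>
  proof
    assume "q t - \<i> * of_real \<epsilon> = 0"
    then have "c t = ?z \<epsilon>" using c'_nonzero[of "1/2"] by (simp add: q_def field_simps)
    then show False using off[OF that] unfolding range_c by (metis rangeI)
  qed
  have \<tau>_ne: "of_real (t - 1/2) - \<i> * of_real \<epsilon> \<noteq> (0::complex)" if "0 < \<bar>\<epsilon>\<bar>" for t \<epsilon> :: real
    using that by (auto simp: complex_eq_iff)
  have contq: "continuous_on {0..1} q"
    unfolding q_def by (intro continuous_intros continuous_c) (use c'_nonzero in auto)
  have int1: "(\<lambda>t. c' t / ?v / (q t - \<i> * of_real \<epsilon>)) integrable_on {0..1}"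
    if "0 < \<bar>\<epsilon>\<bar>" "\<bar>\<epsilon>\<bar> < R" for \<epsilon>
    by (intro integrable_continuous_real continuous_intros continuous_c' contq)
       (use c'_nonzero q_ne[OF that] in auto)
  have int2: "(\<lambda>t. 1 / (of_real (t - 1/2) - \<i> * of_real \<epsilon>) :: complex) integrable_on {0..1}"
    if "0 < \<bar>\<epsilon>\<bar>" for \<epsilon>
    by (intro integrable_continuous_real continuous_intros) (use \<tau>_ne[OF that] in auto)
  have intD: "D \<epsilon> integrable_on {0..1}" if "0 < \<bar>\<epsilon>\<bar>" "\<bar>\<epsilon>\<bar> < R" for \<epsilon>
    unfolding D_def by (rule integrable_diff[OF int1[OF that] int2[OF that(1)]])
  have wn: "winding_number c (?z \<epsilon>) = 1 / (2 * pi * \<i>) * 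
       (integral {0..1} (D \<epsilon>) + integral {0..1} (\<lambda>t. 1 / (of_real (t - 1/2) - \<i> * of_real \<epsilon>)))"
    if \<epsilon>: "0 < \<bar>\<epsilon>\<bar>" "\<bar>\<epsilon>\<bar> < R" for \<epsilon>
  proof -
    have "1 / (c t - ?z \<epsilon>) * c' t = c' t / ?v / (q t - \<i> * of_real \<epsilon>)" for t
    proof -
      have "?v * q t = c t - c (1/2)"
        using c'_nonzero[of "1/2"] by (simp add: q_def)
      then have "c t - ?z \<epsilon> = ?v * (q t - \<i> * of_real \<epsilon>)"
        unfolding right_diff_distrib by (simp add: mult_ac)
      then show ?thesis by (simp add: divide_divide_eq_left)
    qed
    then have "contour_integral c (\<lambda>w. 1 / (w - ?z \<epsilon>)) = integral {0..1} (\<lambda>t. c' t / ?v / (q t - \<i> * of_real \<epsilon>))"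
      unfolding contour_integral_c by (simp only:)
    also have "\<dots> = integral {0..1} (D \<epsilon>) + integral {0..1} (\<lambda>t. 1 / (of_real (t - 1/2) - \<i> * of_real \<epsilon>))"
      unfolding integral_add[OF intD[OF \<epsilon>] int2[OF \<epsilon>(1)], symmetric] by (simp add: D_def)
    finally show ?thesis
      unfolding winding_number_valid_path[OF valid_path_c off[OF \<epsilon>]] by simp
  qed
  \<comment> \<open>A sequence in the open interval \<open>(0, R)\<close> tending to zero.\<close>
  define X where "X = (\<lambda>k::nat. R / (real k + 2))"
  have X: "0 < X k" "X k < R" for k
  proof -
    have "R * 1 < R * (real k + 2)" by (rule mult_strict_left_mono) (use R(1) in auto)
    then show "0 < X k" "X k < R" using R(1) by (auto simp: X_def pos_divide_less_eq)
  qed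
  have lin: "filterlim (\<lambda>k. real k + 2) at_top sequentially"
    by (rule filterlim_at_top_mono[OF filterlim_real_sequentially]) auto
  have X0: "X \<longlonglongrightarrow> 0"
    unfolding X_def by (rule real_tendsto_divide_at_top[OF tendsto_const lin])
  define T where "T = {0..1} - {1/2::real}"
  have diff: "negligible ({0..1} - T \<union> (T - {0..1}))"
    by (rule negligible_subset[of "{1/2}"]) (auto simp: T_def)
  have spike: "integral {0..1} g = integral T g" for g :: "real \<Rightarrow> complex"
    by (rule integral_spike_set) (rule negligible_subset[OF diff], blast)+
  have T_int: "g integrable_on {0..1} \<Longrightarrow> g integrable_on T" for g :: "real \<Rightarrow> complex"
    by (rule integrable_spike_set_eq[OF diff, THEN iffD1])
  have lim: "(\<lambda>k. integral {0..1} (D (s * X k))) \<longlonglongrightarrow> integral T (\<lambda>t. c' t / ?v / q t - 1 / of_real (t - 1/2))"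
    if s: "s = 1 \<or> s = -1" for s
    unfolding spike
  proof (rule dominated_convergence(2)[where h = "\<lambda>_. K"])
    have sX: "0 < \<bar>s * X k\<bar>" "\<bar>s * X k\<bar> < R" for k using s X[of k] by auto
    show "D (s * X k) integrable_on T" for k by (rule T_int[OF intD[OF sX]])
    show "(\<lambda>_. K) integrable_on T"
      by (rule integrable_spike_set_eq[OF diff, THEN iffD1]) auto
    show "norm (D (s * X k) t) \<le> K" if "t \<in> T" for k t
      using K(2)[OF sX(1), of k t] sX(2)[of k] R(3) that by (simp add: T_def)
    fix t assume t: "t \<in> T"
    have "c t \<noteq> c (1/2)"
    proof
      assume "c t = c (1/2)"
      then obtain k where k: "t - 1/2 = of_int k" unfolding c_eq_iff by (rule Ints_cases)
      moreover have "0 \<le> t" "t \<le> 1" "t \<noteq> 1/2" using t by (auto simp: T_def)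
      ultimately have "\<bar>real_of_int k\<bar> < 1" "real_of_int k \<noteq> 0" unfolding k[symmetric] by auto
      then have "\<bar>k\<bar> < 1" "k \<noteq> 0" by linarith+
      then show False by linarith
    qed
    then have qt: "q t \<noteq> 0" using c'_nonzero by (simp add: q_def)
    have "(\<lambda>k. s * X k) \<longlonglongrightarrow> s * 0" by (intro tendsto_intros X0)
    then have lim0: "(\<lambda>k. complex_of_real (s * X k)) \<longlonglongrightarrow> of_real 0"
      by (intro tendsto_of_real) simp
    have "(\<lambda>k. c' t / ?v / (q t - \<i> * of_real (s * X k)) - 1 / (of_real (t - 1/2) - \<i> * of_real (s * X k)))
        \<longlonglongrightarrow> c' t / ?v / (q t - \<i> * of_real 0) - 1 / (of_real (t - 1/2) - \<i> * of_real 0)"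
    proof (intro tendsto_diff tendsto_divide tendsto_const tendsto_mult lim0)
      show "complex_of_real (t - 1/2) - \<i> * of_real 0 \<noteq> 0"
        using t by (simp add: T_def complex_eq_iff)
    qed (use qt c'_nonzero in auto)
    then show "(\<lambda>k. D (s * X k) t) \<longlonglongrightarrow> c' t / ?v / q t - 1 / of_real (t - 1/2)"
      unfolding D_def by simp
  qed
  have arct: "integral {0..1} (\<lambda>t. 1 / (of_real (t - 1/2) - \<i> * of_real \<epsilon>))
      - integral {0..1} (\<lambda>t. 1 / (of_real (t - 1/2) - \<i> * of_real (-\<epsilon>)))
      = 4 * \<i> * of_real (arctan (1 / (2 * \<epsilon>)))" if "0 < \<epsilon>" for \<epsilon> :: real
    using integral_diff[OF int2[of \<epsilon>] int2[of "-\<epsilon>"]] integral_unique[OF arctan_integral[OF that]] that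
    by simp
  let ?J = "\<lambda>k. winding_number c (?z (X k)) - winding_number c (?z (- X k))"
  have J: "?J k = 1 / (2 * pi * \<i>) * (integral {0..1} (D (1 * X k)) - integral {0..1} (D (-1 * X k)))
       + of_real (2 / pi * arctan (1 / (2 * X k)))" for k
  proof -
    have "?J k = 1 / (2 * pi * \<i>) * ((integral {0..1} (D (X k)) - integral {0..1} (D (- X k)))
      + (integral {0..1} (\<lambda>t. 1 / (of_real (t - 1/2) - \<i> * of_real (X k)))
      - integral {0..1} (\<lambda>t. 1 / (of_real (t - 1/2) - \<i> * of_real (- X k)))))"
      using X[of k] by (simp only: wn abs_minus_cancel abs_of_pos)
         (simp only: right_diff_distrib[symmetric] add_diff_add)
    also have "\<dots> = 1 / (2 * pi * \<i>) * (integral {0..1} (D (X k)) - integral {0..1} (D (- X k)))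
      + 1 / (2 * pi * \<i>) * (4 * \<i> * of_real (arctan (1 / (2 * X k))))"
      unfolding arct[OF X(1)] distrib_left ..
    finally show ?thesis by simp
  qed
  have "(\<lambda>k. arctan (1 / (2 * X k))) \<longlonglongrightarrow> pi / 2"
  proof (rule filterlim_compose[OF tendsto_arctan_at_top])
    have "filterlim (\<lambda>k. (1 / (2 * R)) * (real k + 2)) at_top sequentially"
      using R(1) by (intro filterlim_tendsto_pos_mult_at_top[OF tendsto_const _ lin]) auto
    then show "filterlim (\<lambda>k. 1 / (2 * X k)) at_top sequentially"
      using R(1) by (simp add: X_def field_simps)
  qed
  then have "(\<lambda>k. 1 / (2 * pi * \<i>) * (integral {0..1} (D (1 * X k)) - integral {0..1} (D (-1 * X k)))
       + of_real (2 / pi * arctan (1 / (2 * X k)))) \<longlonglongrightarrow> 1 / (2 * pi * \<i>) * 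
       (integral T (\<lambda>t. c' t / ?v / q t - 1 / of_real (t - 1/2)) 
         - integral T (\<lambda>t. c' t / ?v / q t - 1 / of_real (t - 1/2))) + of_real (2 / pi * (pi / 2))"
    by (intro tendsto_add tendsto_mult tendsto_const tendsto_diff lim tendsto_of_real) auto
  then have "?J \<longlonglongrightarrow> 1" unfolding J by simp
  then obtain k where k: "dist (?J k) 1 < 1"
    unfolding lim_sequentially using zero_less_one by blast
  have "?J k \<in> \<int>"
    using X[of k] by (intro Ints_diff integer_winding_number closed_c valid_path_imp_path valid_path_c off) auto
  then obtain i where i: "?J k = of_int i" by (rule Ints_cases)
  have "norm (of_int (i - 1) :: complex) < 1" using k unfolding i dist_norm by simp
  then have "\<bar>real_of_int (i - 1)\<bar> < 1" by (simp only: norm_of_int)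
  then have "i = 1" by linarith
  with i have "?J k = 1" by simp
  then show ?thesis
    using that[of "X k"] X[of k] R(2) off[of "- X k"] by simp
qed

end


section \<open>Winding numbers of the boundary cycle\<close>

text \<open>Disjoint closed sets that do not separate the plane do not separate it jointly, by
  Janiszewski's theorem.  That theorem requires one of its two sets to be compact, which holds at each step if at most one of
  the sets, here \<open>K a\<close>, is unbounded.\<close>

lemma connected_complement_of_disjoint_union:
  fixes K :: "'i \<Rightarrow> complex set"
  assumes "finite I" and "\<And>i. i \<in> I \<Longrightarrow> closed (K i)" "\<And>i. i \<in> I \<Longrightarrow> connected (- K i)"
    and "\<And>i. i \<in> I \<Longrightarrow> i \<noteq> a \<Longrightarrow> compact (K i)"
    and "\<And>i j. i \<in> I \<Longrightarrow> j \<in> I \<Longrightarrow> i \<noteq> j \<Longrightarrow> K i \<inter> K j = {}"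
  shows "connected (- (\<Union>i\<in>I. K i))"
  using assms
proof (induction I rule: finite_induct)
  case (insert i I)
  have IH: "connected (- (\<Union>i\<in>I. K i))" using insert by auto
  have disj: "K i \<inter> (\<Union>i\<in>I. K i) = {}" using insert.hyps insert.prems(4)[of i] by auto
  have cl: "closed (\<Union>i\<in>I. K i)" using insert by (intro closed_UN) auto
  show ?case
  proof (cases "i = a")
    case False
    have "connected (- (K i \<union> (\<Union>i\<in>I. K i)))"
      by (rule Janiszewski_connected) (use insert.prems False IH cl disj in auto)
    then show ?thesis by simp
  next
    case True
    have "compact (\<Union>i\<in>I. K i)" using insert.prems(3) insert.hyps True by (intro compact_UN) auto
    then have "connected (- ((\<Union>i\<in>I. K i) \<union> K i))"
      by (rule Janiszewski_connected) (use insert.prems IH disj in \<open>auto simp: Int_commute\<close>)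
    then show ?thesis by (simp add: Un_commute)
  qed
qed auto

context smooth_domain begin

text \<open>The component of the complement of the \<open>j\<close>-th boundary curve that does not contain \<open>\<Omega>\<close>.  For the
  outer boundary curve it is unbounded.\<close>

definition hole :: "nat \<Rightarrow> complex set" where
  "hole j = (if \<Omega> \<subseteq> inside (path_image (\<gamma> j)) then outside (path_image (\<gamma> j)) else inside (path_image (\<gamma> j)))"

lemma sides:
  assumes j: "j < n"
  shows "open (inside (path_image (\<gamma> j)))" "connected (inside (path_image (\<gamma> j)))"
    "inside (path_image (\<gamma> j)) \<noteq> {}" "bounded (inside (path_image (\<gamma> j)))"
    "frontier (inside (path_image (\<gamma> j))) = path_image (\<gamma> j)"
    "open (outside (path_image (\<gamma> j)))" "connected (outside (path_image (\<gamma> j)))"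
    "outside (path_image (\<gamma> j)) \<noteq> {}" "\<not> bounded (outside (path_image (\<gamma> j)))"
    "frontier (outside (path_image (\<gamma> j))) = path_image (\<gamma> j)"
  using Jordan_inside_outside[of "\<gamma> j"] smooth_loop.simple_path_c[OF loop_\<gamma>[OF j]]
    smooth_loop.closed_c[OF loop_\<gamma>[OF j]] by auto

lemma \<Omega>_one_side:
  assumes j: "j < n"
  shows "\<Omega> \<subseteq> inside (path_image (\<gamma> j)) \<or> \<Omega> \<subseteq> outside (path_image (\<gamma> j))"
proof -
  have "path_image (\<gamma> j) \<inter> \<Omega> = {}" using \<gamma>_not_in_\<Omega>[OF j] by blast
  then have "inside (path_image (\<gamma> j)) \<inter> \<Omega> = {} \<or> outside (path_image (\<gamma> j)) \<inter> \<Omega> = {}"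
    using inside_outside_intersect_connected[OF connected_\<Omega>] by blast
  moreover have "\<Omega> \<subseteq> inside (path_image (\<gamma> j)) \<union> outside (path_image (\<gamma> j))"
    using \<gamma>_not_in_\<Omega>[OF j] by (auto simp: inside_Un_outside)
  ultimately show ?thesis by blast
qed

text \<open>The winding number is \<open>0\<close> outside and \<open>1\<close> or \<open>-1\<close> inside.  The sign is determined by crossing the curve once:
  the left point lies in \<open>\<Omega>\<close> and its winding number exceeds that of the right point by one.\<close>

lemma winding_number_sides:
  assumes j: "j < n"
  shows "z \<in> outside (path_image (\<gamma> j)) \<Longrightarrow> winding_number (\<gamma> j) z = 0"
    "z \<in> inside (path_image (\<gamma> j)) \<Longrightarrow>
       winding_number (\<gamma> j) z = (if \<Omega> \<subseteq> inside (path_image (\<gamma> j)) then 1 else -1)"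
proof -
  interpret smooth_loop "\<gamma> j" using loop_\<gamma>[OF j] .
  let ?I = "inside (path_image (\<gamma> j))" and ?O = "outside (path_image (\<gamma> j))"
  have out: "winding_number (\<gamma> j) z = 0" if "z \<in> ?O" for z
    using winding_number_zero_in_outside[OF valid_path_imp_path[OF valid_path_c] closed_c that] .
  then show "z \<in> ?O \<Longrightarrow> winding_number (\<gamma> j) z = 0" .
  assume z: "z \<in> ?I"
  obtain s :: complex where s: "s = 1 \<or> s = -1" "\<And>z. z \<in> ?I \<Longrightarrow> winding_number (\<gamma> j) z = s"
    using simple_closed_path_winding_number_inside[OF simple_path_c] by metis
  obtain \<epsilon>0 where \<epsilon>0: "0 < \<epsilon>0" "\<And>j t \<epsilon>. j < n \<Longrightarrow> 0 < \<epsilon> \<Longrightarrow> \<epsilon> < \<epsilon>0 \<Longrightarrow>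
       \<gamma> j t + of_real \<epsilon> * (\<i> * vector_derivative (\<gamma> j) (at t)) \<in> \<Omega>"
    using inner_collar by metis
  obtain \<epsilon> where \<epsilon>: "0 < \<epsilon>" "\<epsilon> < \<epsilon>0"
    "\<gamma> j (1/2) - of_real \<epsilon> * (\<i> * c' (1/2)) \<notin> path_image (\<gamma> j)"
    "winding_number (\<gamma> j) (\<gamma> j (1/2) + of_real \<epsilon> * (\<i> * c' (1/2)))
      - winding_number (\<gamma> j) (\<gamma> j (1/2) - of_real \<epsilon> * (\<i> * c' (1/2))) = 1"
    using winding_number_jump[OF \<epsilon>0(1)] by metis
  define l r where "l = \<gamma> j (1/2) + of_real \<epsilon> * (\<i> * c' (1/2))"
    and "r = \<gamma> j (1/2) - of_real \<epsilon> * (\<i> * c' (1/2))"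
  have l: "l \<in> \<Omega>" unfolding l_def by (rule \<epsilon>0(2)[OF j \<epsilon>(1,2)])
  have r: "r \<in> ?I \<or> r \<in> ?O" using \<epsilon>(3) unfolding r_def[symmetric] by (metis ComplI UnE inside_Un_outside)
  have J: "winding_number (\<gamma> j) l - winding_number (\<gamma> j) r = 1" using \<epsilon>(4) unfolding l_def r_def .
  show "winding_number (\<gamma> j) z = (if \<Omega> \<subseteq> ?I then 1 else -1)"
  proof (cases "\<Omega> \<subseteq> ?I")
    case True
    then show ?thesis using s(1) s(2)[OF z] s(2)[of l] l r J s(2)[of r] out[of r] by auto
  next
    case False
    then have "\<Omega> \<subseteq> ?O" using \<Omega>_one_side[OF j] by blast
    then show ?thesis using s(1) s(2)[OF z] out[of l] l r J s(2)[of r] out[of r] False by auto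
  qed
qed

lemma hole_props:
  assumes j: "j < n"
  shows "open (hole j)" "connected (hole j)" "hole j \<noteq> {}" "hole j \<inter> \<Omega> = {}"
    "frontier (hole j) = range (\<gamma> j)" "connected (- closure (hole j))"
    "\<Omega> \<subseteq> - closure (hole j)"
proof -
  have rng: "path_image (\<gamma> j) = range (\<gamma> j)" using smooth_loop.range_c[OF loop_\<gamma>[OF j]] .
  let ?I = "inside (path_image (\<gamma> j))" and ?O = "outside (path_image (\<gamma> j))"
  have IO: "?I \<inter> ?O = {}" "?I \<union> ?O = - path_image (\<gamma> j)" by (auto simp: inside_Un_outside)
  note S = sides[OF j]
  show op: "open (hole j)" and "connected (hole j)" and "hole j \<noteq> {}"
    and fr: "frontier (hole j) = range (\<gamma> j)"
    using S unfolding hole_def rng by auto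
  show d: "hole j \<inter> \<Omega> = {}"
  proof (cases "\<Omega> \<subseteq> ?I")
    case True
    then show ?thesis using IO(1) unfolding hole_def by (simp only: if_True) blast
  next
    case False
    then show ?thesis using IO(1) \<Omega>_one_side[OF j] unfolding hole_def by (simp only: if_False) blast
  qed
  have cl: "closure (hole j) = hole j \<union> range (\<gamma> j)"
    using fr closure_Un_frontier[of "hole j"] by simp
  have "- closure (hole j) = (if \<Omega> \<subseteq> ?I then ?I else ?O)"
  proof (cases "\<Omega> \<subseteq> ?I")
    case True
    then have "hole j = ?O" by (simp add: hole_def)
    then show ?thesis using True IO unfolding cl rng[symmetric] by (simp only: if_True) blast
  next
    case False
    then have "hole j = ?I" by (simp add: hole_def)
    then show ?thesis using False IO unfolding cl rng[symmetric] by (simp only: if_False) blast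
  qed
  then show "connected (- closure (hole j))" using S by simp
  show "\<Omega> \<subseteq> - closure (hole j)" using d \<gamma>_not_in_\<Omega>[OF j] unfolding cl rng by blast
qed

lemma hole_frontier: 
  assumes j: "j < n" shows "hole j \<inter> frontier \<Omega> = {}"
proof -
  have "hole j \<inter> closure \<Omega> = {}"
    using open_Int_closure_eq_empty[OF hole_props(1)[OF j], of \<Omega>] hole_props(4)[OF j] by simp
  then show ?thesis unfolding frontier_def by blast
qed

lemma closure_hole: "j < n \<Longrightarrow> closure (hole j) = hole j \<union> range (\<gamma> j)"
  using closure_Un_frontier[of "hole j"] by (simp only: hole_props(5))

text \<open>A hole is connected and avoids the boundaries of the other holes, so two holes that meet contain
  each other and have the same boundary curve.\<close>

lemma holes_disjoint:
  assumes j: "j < n" and k: "k < n" and "j \<noteq> k"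
  shows "closure (hole j) \<inter> closure (hole k) = {}"
proof -
  have sub: "hole i \<subseteq> hole l" if "i < n" "l < n" "hole i \<inter> hole l \<noteq> {}" for i l
  proof -
    have "hole i \<inter> frontier (hole l) = {}"
    proof -
      have "range (\<gamma> l) \<subseteq> frontier \<Omega>" using that(2) unfolding frontier_\<Omega> by blast
      then show ?thesis using hole_frontier[OF that(1)] unfolding hole_props(5)[OF that(2)] by blast
    qed
    then show ?thesis
      using connected_Int_frontier[OF hole_props(2)[OF that(1)] that(3)] by blast
  qed
  have jk: "hole j \<inter> hole k = {}"
  proof (rule ccontr)
    assume ne: "hole j \<inter> hole k \<noteq> {}"
    have "hole j \<subseteq> hole k" by (rule sub[OF j k ne])
    moreover have "hole k \<subseteq> hole j" using sub[OF k j] ne by (simp add: Int_commute)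
    ultimately have "frontier (hole j) = frontier (hole k)" by simp
    then show False unfolding hole_props(5)[OF j] hole_props(5)[OF k] using disjoint_\<gamma>[OF assms] by simp
  qed
  have rng: "range (\<gamma> j) \<subseteq> frontier \<Omega>" "range (\<gamma> k) \<subseteq> frontier \<Omega>"
    using j k unfolding frontier_\<Omega> by blast+
  have "hole j \<inter> range (\<gamma> k) = {}" "range (\<gamma> j) \<inter> hole k = {}"
    using rng hole_frontier[OF j] hole_frontier[OF k] by blast+
  with jk disjoint_\<gamma>[OF assms] show ?thesis
    unfolding closure_hole[OF j] closure_hole[OF k] Int_Un_distrib Int_Un_distrib2 by simp
qed

lemma bounded_hole_iff:
  assumes j: "j < n" shows "bounded (hole j) \<longleftrightarrow> \<not> \<Omega> \<subseteq> inside (path_image (\<gamma> j))"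
  using sides[OF j] unfolding hole_def by auto

text \<open>Two unbounded holes would both contain a neighbourhood of infinity, while different holes are disjoint.\<close>

lemma unbounded_hole_unique:
  assumes j: "j < n" "\<not> bounded (hole j)" and k: "k < n" "\<not> bounded (hole k)"
  shows "j = k"
proof (rule ccontr)
  assume "j \<noteq> k"
  then have "hole j \<inter> hole k = {}" using holes_disjoint[OF j(1) k(1)] closure_subset by blast
  then have "hole k \<subseteq> - hole j" by blast
  moreover have "bounded (- hole j)"
  proof -
    have "bounded (path_image (\<gamma> j))"
      unfolding smooth_loop.range_c[OF loop_\<gamma>[OF j(1)]]
      by (rule compact_imp_bounded[OF smooth_loop.compact_range_c[OF loop_\<gamma>[OF j(1)]]])
    then have "bounded (- outside (path_image (\<gamma> j)))" by (rule cobounded_outside)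
    moreover have "hole j = outside (path_image (\<gamma> j))"
      using j bounded_hole_iff unfolding hole_def by simp
    ultimately show ?thesis by simp
  qed
  ultimately show False using k bounded_subset by blast
qed

text \<open>The complement of the closed holes is connected and does not meet the boundary of \<open>\<Omega>\<close>, so it cannot
  exceed \<open>\<Omega>\<close>.\<close>

lemma \<Omega>_complement_of_holes: "\<Omega> = - (\<Union>j<n. closure (hole j))"
proof -
  let ?R = "- (\<Union>j<n. closure (hole j))"
  have "\<exists>a. \<forall>j<n. j \<noteq> a \<longrightarrow> bounded (hole j)"
  proof (cases "\<exists>a<n. \<not> bounded (hole a)")
    case True
    then obtain a where "a < n" "\<not> bounded (hole a)" by blast
    then show ?thesis using unbounded_hole_unique[of a] by blast
  qed blast
  then obtain a where a: "\<And>j. j < n \<Longrightarrow> j \<noteq> a \<Longrightarrow> bounded (hole j)" by blast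
  have "connected ?R"
    by (rule connected_complement_of_disjoint_union[where a = a])
       (use hole_props holes_disjoint a in \<open>auto simp: compact_closure\<close>)
  moreover have sub: "\<Omega> \<subseteq> ?R" using hole_props(7) by blast
  moreover have "?R \<inter> frontier \<Omega> = {}"
    unfolding frontier_\<Omega> using closure_hole by auto
  ultimately have "?R \<subseteq> \<Omega>"
    using connected_Int_frontier[of ?R \<Omega>] nonempty_\<Omega> by blast
  with sub show ?thesis by blast
qed

lemma exists_unbounded_hole: "\<exists>a<n. \<not> bounded (hole a)"
proof (rule ccontr)
  assume "\<not> (\<exists>a<n. \<not> bounded (hole a))"
  then have "bounded (\<Union>j<n. closure (hole j))" by (auto intro: bounded_closure)
  then have "bounded (- \<Omega>)" using \<Omega>_complement_of_holes by (metis double_compl)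
  then show False using bounded_\<Omega> by (metis Compl_partition bounded_Un not_bounded_UNIV)
qed

text \<open>At points of \<open>\<Omega>\<close> the winding numbers add up to \<open>1\<close>, contributed by the outer curve.  Passing from \<open>\<Omega>\<close> into
  a hole crosses exactly one boundary curve from left to right, which lowers the sum by one.\<close>

lemma winding_numbers_sum_in_hole:
  assumes k: "k < n" and w: "w \<in> hole k"
  shows "(\<Sum>j<n. winding_number (\<gamma> j) w) = 0"
proof -
  define W :: "nat \<Rightarrow> complex" where "W j = (if \<Omega> \<subseteq> inside (path_image (\<gamma> j)) then 1 else 0)" for j
  have other: "winding_number (\<gamma> j) w = W j" if j: "j < n" "j \<noteq> k" for j
  proof -
    have "w \<notin> closure (hole j)" using holes_disjoint[OF j(1) k j(2)] w closure_subset by blast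
    then have "w \<notin> hole j" "w \<notin> path_image (\<gamma> j)"
      unfolding closure_hole[OF j(1)] smooth_loop.range_c[OF loop_\<gamma>[OF j(1)]] by auto
    moreover from this have "w \<in> inside (path_image (\<gamma> j)) \<or> w \<in> outside (path_image (\<gamma> j))"
      by (metis ComplI UnE inside_Un_outside)
    ultimately show ?thesis
      using winding_number_sides[OF j(1), of w] unfolding hole_def W_def by (auto split: if_splits)
  qed
  have own: "winding_number (\<gamma> k) w = W k - 1"
    using winding_number_sides[OF k, of w] w unfolding hole_def W_def by (auto split: if_splits)
  obtain a where a: "a < n" "\<not> bounded (hole a)" using exists_unbounded_hole by blast
  have "(\<Sum>j<n. W j) = (\<Sum>j<n. if j = a then 1 else 0)"
  proof (rule sum.cong)
    fix j assume "j \<in> {..<n}"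
    then have "j < n" by simp
    then have "\<Omega> \<subseteq> inside (path_image (\<gamma> j)) \<longleftrightarrow> j = a"
      using bounded_hole_iff[OF \<open>j < n\<close>] unbounded_hole_unique[OF \<open>j < n\<close> _ a] a(2) by blast
    then show "W j = (if j = a then 1 else 0)" by (simp add: W_def)
  qed simp
  then have "(\<Sum>j<n. W j) = 1" using a(1) by simp
  moreover have "(\<Sum>j<n. winding_number (\<gamma> j) w) = (\<Sum>j<n. W j - (if j = k then 1 else 0))"
    using other own by (intro sum.cong) auto
  ultimately show ?thesis using k by (simp add: sum_subtractf)
qed

lemma outside_closure_in_hole:
  assumes "w \<notin> closure \<Omega>"
  obtains k where "k < n" "w \<in> hole k"
proof -
  have "w \<notin> \<Omega>" "w \<notin> frontier \<Omega>" using assms closure_Un_frontier[of \<Omega>] by auto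
  then obtain k where k: "k < n" "w \<in> closure (hole k)" using \<Omega>_complement_of_holes by blast
  then have "w \<in> hole k"
    using \<open>w \<notin> frontier \<Omega>\<close> k(1) unfolding frontier_\<Omega> closure_hole[OF k(1)] by blast
  with k that show ?thesis by blast
qed

lemma hole_disjoint_closure: "k < n \<Longrightarrow> hole k \<inter> closure \<Omega> = {}"
  using hole_props(4)[of k] hole_frontier[of k] closure_Un_frontier[of \<Omega>] by blast

lemma frontier_adherent_to_holes:
  assumes "w \<in> frontier \<Omega>"
  obtains k where "k < n" "w \<in> closure (hole k)"
  using assms closure_hole unfolding frontier_\<Omega> by blast

end


section \<open>Cauchy's theorem up to the boundary\<close>

text \<open>A cycle in a connected open set can be replaced by a single closed path: the loops are joined by
  connecting paths which are traversed once in each direction.  This reduces Cauchy's theorem for cycles to the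
  theorem for one path.\<close>

lemma loops_joinable:
  fixes g :: "nat \<Rightarrow> real \<Rightarrow> complex"
  assumes S: "open S" "connected S" "S \<noteq> {}"
    and g: "\<And>j. j < n \<Longrightarrow> valid_path (g j)" "\<And>j. j < n \<Longrightarrow> pathfinish (g j) = pathstart (g j)"
      "\<And>j. j < n \<Longrightarrow> path_image (g j) \<subseteq> S"
  shows "\<exists>G. valid_path G \<and> pathfinish G = pathstart G \<and> path_image G \<subseteq> S \<and>
    (\<forall>f. f holomorphic_on S \<longrightarrow> contour_integral G f = (\<Sum>j<n. contour_integral (g j) f))"
  using g
proof (induction n)
  case 0
  obtain a where "a \<in> S" using S by blast
  then have "path_image (linepath a a) \<subseteq> S" by simp
  moreover have "contour_integral (linepath a a) f = (\<Sum>j<0. contour_integral (g j) f)" for f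
    by (simp only: contour_integral_trivial lessThan_0 sum.empty)
  moreover have "pathfinish (linepath a a) = pathstart (linepath a a)"
    by (simp only: pathfinish_linepath pathstart_linepath)
  ultimately show ?case using valid_path_linepath[of a a] by blast
next
  case (Suc n)
  then obtain G where G: "valid_path G" "pathfinish G = pathstart G" "path_image G \<subseteq> S"
    "\<And>f. f holomorphic_on S \<Longrightarrow> contour_integral G f = (\<Sum>j<n. contour_integral (g j) f)"
    by (metis less_SucI)
  have gn: "valid_path (g n)" "pathfinish (g n) = pathstart (g n)" "path_image (g n) \<subseteq> S"
    using Suc.prems by auto
  have "pathstart G \<in> S" "pathstart (g n) \<in> S"
    using G(3) gn(3) pathstart_in_path_image by blast+
  then obtain p where p: "polynomial_function p" "path_image p \<subseteq> S"
    "pathstart p = pathstart G" "pathfinish p = pathstart (g n)"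
    using connected_open_polynomial_connected[OF S(1,2)] by metis
  have vp: "valid_path p" using p(1) by (rule valid_path_polynomial_function)
  define q where "q = g n +++ reversepath p"
  define r where "r = p +++ q"
  have q: "valid_path q" "path_image q \<subseteq> S" "pathstart q = pathstart (g n)" "pathfinish q = pathstart p"
    unfolding q_def using gn vp p by (auto simp: path_image_join intro!: valid_path_join)
  have r: "valid_path r" "path_image r \<subseteq> S" "pathstart r = pathstart p" "pathfinish r = pathstart p"
    unfolding r_def using q vp p by (auto simp: path_image_join intro!: valid_path_join)
  have "valid_path (G +++ r)" "pathfinish (G +++ r) = pathstart (G +++ r)" "path_image (G +++ r) \<subseteq> S"
    using G r p by (auto simp: path_image_join intro!: valid_path_join)
  moreover have "contour_integral (G +++ r) f = (\<Sum>j<Suc n. contour_integral (g j) f)"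
    if f: "f holomorphic_on S" for f
  proof -
    have ci: "f contour_integrable_on h" if "valid_path h" "path_image h \<subseteq> S" for h
      by (rule contour_integrable_holomorphic_simple[OF f S(1) that])
    have "contour_integral (G +++ r) f = contour_integral G f + contour_integral r f"
      by (rule contour_integral_join) (use ci G r in auto)
    also have "contour_integral r f = contour_integral p f + contour_integral q f"
      unfolding r_def by (rule contour_integral_join) (use ci q vp p in auto)
    also have "contour_integral q f = contour_integral (g n) f + contour_integral (reversepath p) f"
      unfolding q_def by (rule contour_integral_join) (use ci gn vp p in auto)
    also have "contour_integral (reversepath p) f = - contour_integral p f"
      by (rule contour_integral_reversepath[OF vp])
    finally show ?thesis using G(4)[OF f] by simp
  qed
  ultimately show ?case by blast
qed

lemma Cauchy_theorem_cycle:
  fixes g :: "nat \<Rightarrow> real \<Rightarrow> complex"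
  assumes S: "open S" "connected S" "S \<noteq> {}"
    and g: "\<And>j. j < n \<Longrightarrow> valid_path (g j)" "\<And>j. j < n \<Longrightarrow> pathfinish (g j) = pathstart (g j)"
      "\<And>j. j < n \<Longrightarrow> path_image (g j) \<subseteq> S"
    and zero: "\<And>w. w \<notin> S \<Longrightarrow> (\<Sum>j<n. winding_number (g j) w) = 0"
    and f: "f holomorphic_on S"
  shows "(\<Sum>j<n. contour_integral (g j) f) = 0"
proof -
  obtain G where G: "valid_path G" "pathfinish G = pathstart G" "path_image G \<subseteq> S"
    "\<And>f. f holomorphic_on S \<Longrightarrow> contour_integral G f = (\<Sum>j<n. contour_integral (g j) f)"
    using loops_joinable[OF S, where g = g and n = n] g by blast
  have "winding_number G w = 0" if w: "w \<notin> S" for w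
  proof -
    have "w \<notin> path_image G" using G(3) w by blast
    moreover have "(\<lambda>z. 1 / (z - w)) holomorphic_on S" using w by (auto intro!: holomorphic_intros)
    moreover have "winding_number (g j) w = 1 / (2 * pi * \<i>) * contour_integral (g j) (\<lambda>z. 1 / (z - w))"
      if "j < n" for j
      using g(1,3)[OF that] w by (intro winding_number_valid_path) auto
    ultimately show ?thesis
      using zero[OF w] G(1,4) by (simp add: winding_number_valid_path flip: sum_divide_distrib)
  qed
  from Cauchy_theorem_global[OF S(1) f G(1,2,3) this] G(4)[OF f] show ?thesis
    by (metis contour_integral_unique)
qed

context smooth_domain begin

text \<open>The boundary curves are pushed into \<open>\<Omega>\<close> along the inner normal.  The pushed cycle has total winding
  number zero about every point outside \<open>\<Omega>\<close>, so the integral over it vanishes; and the integral depends continuously on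
  the distance \<open>\<epsilon>\<close>, down to \<open>\<epsilon> = 0\<close>.\<close>

lemma Cauchy_theorem_closure:
  assumes hol: "f holomorphic_on \<Omega>" and cont: "continuous_on (closure \<Omega>) f"
  shows "(\<Sum>j<n. contour_integral (\<gamma> j) f) = 0"
proof -
  obtain \<epsilon>0 where \<epsilon>0: "0 < \<epsilon>0" "\<And>j t \<epsilon>. j < n \<Longrightarrow> 0 < \<epsilon> \<Longrightarrow> \<epsilon> < \<epsilon>0 \<Longrightarrow>
       \<gamma> j t + of_real \<epsilon> * (\<i> * vector_derivative (\<gamma> j) (at t)) \<in> \<Omega>"
    using inner_collar by metis
  define g where "g \<epsilon> j t = \<gamma> j t + of_real \<epsilon> * (\<i> * vector_derivative (\<gamma> j) (at t))" for \<epsilon> j t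
  define g' where "g' \<epsilon> j t = vector_derivative (\<gamma> j) (at t) +
      of_real \<epsilon> * (\<i> * vector_derivative (\<lambda>t. vector_derivative (\<gamma> j) (at t)) (at t))" for \<epsilon> j t
  have g\<Omega>: "g \<epsilon> j t \<in> \<Omega>" if "j < n" "0 < \<epsilon>" "\<epsilon> < \<epsilon>0" for \<epsilon> j t
    using \<epsilon>0(2)[OF that] unfolding g_def .
  have gcl: "g \<epsilon> j t \<in> closure \<Omega>" if "j < n" "0 \<le> \<epsilon>" "\<epsilon> < \<epsilon>0" for \<epsilon> j t
  proof (cases "\<epsilon> = 0")
    case True
    then show ?thesis using \<gamma>_frontier[OF that(1), of t] by (simp add: g_def frontier_def)
  next
    case False
    then show ?thesis using g\<Omega>[of j \<epsilon> t] that closure_subset by auto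
  qed
  have g': "(g \<epsilon> j has_vector_derivative g' \<epsilon> j t) (at t)" if "j < n" for \<epsilon> j t
  proof -
    interpret smooth_loop "\<gamma> j" using loop_\<gamma>[OF that] .
    show ?thesis unfolding g_def g'_def
      by (intro has_vector_derivative_add has_c' has_vector_derivative_mult_right
          smooth_real_has_vector_derivative[OF smooth_c'])
  qed
  have cont_g': "continuous_on X (\<lambda>t. g' \<epsilon> j t)" if "j < n" for \<epsilon> j X
  proof -
    interpret smooth_loop "\<gamma> j" using loop_\<gamma>[OF that] .
    show ?thesis unfolding g'_def
      by (intro continuous_intros continuous_c'
          smooth_real_continuous_on[OF smooth_real_vector_derivative[OF smooth_c']])
  qed
  have valid: "valid_path (g \<epsilon> j)" if "j < n" for \<epsilon> j
    unfolding valid_path_def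
    by (intro C1_differentiable_imp_piecewise)
       (auto simp: C1_differentiable_on_def intro!: exI[of _ "g' \<epsilon> j"] g' cont_g' that)
  have closed: "pathfinish (g \<epsilon> j) = pathstart (g \<epsilon> j)" if "j < n" for \<epsilon> j
  proof -
    interpret smooth_loop "\<gamma> j" using loop_\<gamma>[OF that] .
    show ?thesis using periodic[of 0] periodic_c'[of 0] by (simp add: pathfinish_def pathstart_def g_def)
  qed
  have image: "path_image (g \<epsilon> j) \<subseteq> \<Omega>" if "j < n" "0 < \<epsilon>" "\<epsilon> < \<epsilon>0" for \<epsilon> j
    using g\<Omega>[OF that] by (auto simp: path_image_def)
  \<comment> \<open>Off the closure, the homotopy along the normals stays in the closure and preserves the winding numbers.\<close>
  have outer: "(\<Sum>j<n. winding_number (g \<epsilon> j) w) = 0"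
    if w: "w \<notin> closure \<Omega>" and \<epsilon>: "0 < \<epsilon>" "\<epsilon> < \<epsilon>0" for w \<epsilon>
  proof -
    have "winding_number (g \<epsilon> j) w = winding_number (\<gamma> j) w" if j: "j < n" for j
    proof (rule winding_number_homotopic_loops, rule homotopic_loops_linear)
      interpret smooth_loop "\<gamma> j" using loop_\<gamma>[OF j] .
      show "path (\<gamma> j)" "pathfinish (\<gamma> j) = pathstart (\<gamma> j)"
        by (rule valid_path_imp_path[OF valid_path_c], rule closed_c)
      show "path (g \<epsilon> j)" "pathfinish (g \<epsilon> j) = pathstart (g \<epsilon> j)"
        by (rule valid_path_imp_path[OF valid[OF j]], rule closed[OF j])
      fix t :: real
      show "closed_segment (g \<epsilon> j t) (\<gamma> j t) \<subseteq> - {w}"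
      proof
        fix x assume "x \<in> closed_segment (g \<epsilon> j t) (\<gamma> j t)"
        then obtain s where s: "0 \<le> s" "s \<le> 1" "x = (1 - s) *\<^sub>R g \<epsilon> j t + s *\<^sub>R \<gamma> j t"
          by (auto simp: closed_segment_def)
        have "x = g ((1 - s) * \<epsilon>) j t"
          unfolding s(3) g_def by (simp add: scaleR_conv_of_real algebra_simps)
        moreover have "0 \<le> (1 - s) * \<epsilon>" using s \<epsilon> by simp
        moreover have "(1 - s) * \<epsilon> < \<epsilon>0"
          using s(1) \<epsilon> mult_right_mono[of "1 - s" 1 \<epsilon>] by linarith
        ultimately have "x \<in> closure \<Omega>" using gcl[OF j] by blast
        then show "x \<in> - {w}" using w by auto
      qed
    qed
    then have "(\<Sum>j<n. winding_number (g \<epsilon> j) w) = (\<Sum>j<n. winding_number (\<gamma> j) w)" by simp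
    also obtain k where "k < n" "w \<in> hole k" using outside_closure_in_hole[OF w] by blast
    then have "(\<Sum>j<n. winding_number (\<gamma> j) w) = 0" by (rule winding_numbers_sum_in_hole)
    finally show ?thesis .
  qed
  \<comment> \<open>At a boundary point, local constancy of the winding numbers allows a move into an adjacent hole.\<close>
  have zero: "(\<Sum>j<n. winding_number (g \<epsilon> j) w) = 0"
    if w: "w \<notin> \<Omega>" and \<epsilon>: "0 < \<epsilon>" "\<epsilon> < \<epsilon>0" for w \<epsilon>
  proof (cases "w \<in> closure \<Omega>")
    case True
    then have "w \<in> frontier \<Omega>" using w open_\<Omega> by (simp add: frontier_def interior_open)
    then obtain k where k: "k < n" "w \<in> closure (hole k)" by (rule frontier_adherent_to_holes)
    define U where "U = (\<Inter>j<n. {z. z \<notin> path_image (g \<epsilon> j) \<and> winding_number (g \<epsilon> j) z = winding_number (g \<epsilon> j) w})"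
    have "open U" unfolding U_def
      by (intro open_INT ballI open_winding_number_levelsets)
         (use valid closed in \<open>auto intro: valid_path_imp_path\<close>)
    moreover have "w \<in> U" unfolding U_def using image \<epsilon> w by blast
    ultimately obtain z where z: "z \<in> U" "z \<in> hole k"
      using k(2) by (meson closure_iff_nhds_not_empty disjoint_iff subset_refl)
    have "z \<notin> closure \<Omega>" using z(2) hole_disjoint_closure[OF k(1)] by blast
    from outer[OF this \<epsilon>] show ?thesis using z(1) by (simp add: U_def)
  qed (rule outer[OF _ \<epsilon>])
  define I where "I \<epsilon> = (\<Sum>j<n. integral (cbox 0 1) (\<lambda>t. f (g \<epsilon> j t) * g' \<epsilon> j t))" for \<epsilon>
  have I_eq: "I \<epsilon> = (\<Sum>j<n. contour_integral (g \<epsilon> j) f)" for \<epsilon>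
    unfolding I_def contour_integral_integral using vector_derivative_at[OF g']
    by (intro sum.cong) auto
  have I0: "I \<epsilon> = 0" if "\<epsilon> \<in> {0<..<\<epsilon>0 / 2}" for \<epsilon>
    unfolding I_eq
    by (rule Cauchy_theorem_cycle[OF open_\<Omega> connected_\<Omega> nonempty_\<Omega> valid closed image zero hol])
       (use that \<epsilon>0(1) in auto)
  have cl: "closure {0<..<\<epsilon>0 / 2} = {0..\<epsilon>0 / 2}" using \<epsilon>0(1) by (simp add: closure_greaterThanLessThan)
  have "continuous_on {0..\<epsilon>0 / 2} I"
    unfolding I_def
  proof (intro continuous_on_sum integral_continuous_on_param)
    fix j assume "j \<in> {..<n}"
    then have j: "j < n" by simp
    interpret smooth_loop "\<gamma> j" using loop_\<gamma>[OF j] .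
    have c1: "continuous_on X (\<lambda>p::real \<times> real. \<gamma> j (snd p))" for X
      by (rule continuous_on_compose2[OF continuous_c[of UNIV]]) (auto intro: continuous_intros)
    have c2: "continuous_on X (\<lambda>p::real \<times> real. c' (snd p))" for X
      by (rule continuous_on_compose2[OF continuous_c'[of UNIV]]) (auto intro: continuous_intros)
    have c3: "continuous_on X (\<lambda>p::real \<times> real. vector_derivative c' (at (snd p)))" for X
      by (rule continuous_on_compose2[OF
            smooth_real_continuous_on[OF smooth_real_vector_derivative[OF smooth_c'], of UNIV]])
         (auto intro: continuous_intros)
    have "continuous_on ({0..\<epsilon>0 / 2} \<times> cbox 0 1) (\<lambda>p. f (g (fst p) j (snd p)))"
    proof (rule continuous_on_compose2[OF cont])
      show "continuous_on ({0..\<epsilon>0 / 2} \<times> cbox 0 1) (\<lambda>p. g (fst p) j (snd p))"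
        unfolding g_def by (intro continuous_intros c1 c2)
      show "(\<lambda>p. g (fst p) j (snd p)) ` ({0..\<epsilon>0 / 2} \<times> cbox 0 1) \<subseteq> closure \<Omega>"
        using gcl[OF j] \<epsilon>0(1) by auto
    qed
    moreover have "continuous_on ({0..\<epsilon>0 / 2} \<times> cbox 0 1) (\<lambda>p. g' (fst p) j (snd p))"
      unfolding g'_def by (intro continuous_intros c2 c3)
    ultimately show "continuous_on ({0..\<epsilon>0 / 2} \<times> cbox 0 1) (\<lambda>(\<epsilon>, t). f (g \<epsilon> j t) * g' \<epsilon> j t)"
      unfolding case_prod_unfold by (rule continuous_on_mult)
  qed
  then have "I 0 = 0"
    by (intro continuous_constant_on_closure[of "{0<..<\<epsilon>0 / 2}" I 0 0]) (use cl I0 \<epsilon>0(1) in auto)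
  moreover have "g 0 j = \<gamma> j" for j by (simp add: g_def fun_eq_iff)
  ultimately show ?thesis by (simp add: I_eq)
qed

end


section \<open>Integration with respect to arc length\<close>

context smooth_domain begin

abbreviation param_space :: "(nat \<times> real) measure" where
  "param_space \<equiv> count_space {..<n} \<Otimes>\<^sub>M restrict_space lborel {0..1}"

abbreviation speed :: "nat \<times> real \<Rightarrow> real" where
  "speed \<equiv> \<lambda>(j, t). norm (vector_derivative (\<gamma> j) (at t))"

lemma space_arc_length [simp]: "space (arc_length \<Omega> n \<gamma>) = frontier \<Omega>"
  by (simp add: arc_length_def space_restrict_space)

lemma sets_arc_length: "sets (arc_length \<Omega> n \<gamma>) = sets (restrict_space borel (frontier \<Omega>))"
  by (simp add: arc_length_def)

lemma arc_length_distr: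
  "arc_length \<Omega> n \<gamma> = distr (density param_space (\<lambda>p. ennreal (speed p)))
     (restrict_space borel (frontier \<Omega>)) (\<lambda>(j, t). \<gamma> j t)"
  unfolding arc_length_def by (simp add: case_prod_unfold)

lemma measurable_on_param_space:
  fixes f :: "nat \<Rightarrow> real \<Rightarrow> 'a::topological_space"
  assumes "\<And>j. j < n \<Longrightarrow> continuous_on UNIV (f j)"
  shows "(\<lambda>(j, t). f j t) \<in> borel_measurable param_space"
proof (rule measurable_pair_measure_countable1)
  fix j assume "j \<in> {..<n}"
  then have "f j \<in> borel_measurable borel"
    using assms by (intro borel_measurable_continuous_onI) auto
  then show "(\<lambda>t. case (j, t) of (j, t) \<Rightarrow> f j t) \<in> borel_measurable (restrict_space lborel {0..1})"
    by (auto intro: measurable_restrict_space1)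
qed auto

lemma measurable_param:
  "(\<lambda>(j, t). \<gamma> j t) \<in> measurable param_space (restrict_space borel (frontier \<Omega>))"
proof (rule measurable_restrict_space2)
  show "(\<lambda>(j, t). \<gamma> j t) \<in> space param_space \<rightarrow> frontier \<Omega>"
    using \<gamma>_frontier by (auto simp: space_pair_measure)
  show "(\<lambda>(j, t). \<gamma> j t) \<in> borel_measurable param_space"
    by (rule measurable_on_param_space) (use smooth_loop.continuous_c loop_\<gamma> in blast)
qed

lemma measurable_speed: "speed \<in> borel_measurable param_space"
  by (rule measurable_on_param_space)
     (use smooth_loop.continuous_c' loop_\<gamma> in \<open>auto intro!: continuous_on_norm\<close>)

lemma finite_measure_param_space: "finite_measure param_space"
proof (rule finite_measure_pair_measure)
  show "finite_measure (restrict_space lborel {0..1::real})"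
    by (rule finite_measureI) (simp add: emeasure_restrict_space space_restrict_space)
  show "finite_measure (count_space {..<n})" by (rule finite_measure_count_space) simp
qed

lemma speed_bounded: obtains B where "0 < B" "\<And>j t. j < n \<Longrightarrow> speed (j, t) \<le> B"
proof -
  have "\<forall>j<n. \<exists>B>0. \<forall>t. norm (vector_derivative (\<gamma> j) (at t)) \<le> B"
    using smooth_loop.c'_bounds[OF loop_\<gamma>] by metis
  then obtain B where B: "\<And>j. j < n \<Longrightarrow> B j > 0" "\<And>j t. j < n \<Longrightarrow> norm (vector_derivative (\<gamma> j) (at t)) \<le> B j"
    by metis
  have "speed (j, t) \<le> 1 + (\<Sum>j<n. B j)" if "j < n" for j t
    using B(2)[OF that, of t] member_le_sum[of j "{..<n}" B] B(1) that by (force simp: less_imp_le)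
  moreover have "(\<Sum>j<n. B j) \<ge> 0" by (rule sum_nonneg) (simp add: B(1) less_imp_le)
  then have "0 < 1 + (\<Sum>j<n. B j)" by linarith
  ultimately show ?thesis using that by blast
qed

lemma finite_measure_arc_length: "finite_measure (arc_length \<Omega> n \<gamma>)"
proof -
  interpret P: finite_measure param_space by (rule finite_measure_param_space)
  obtain B where B: "0 < B" "\<And>j t. j < n \<Longrightarrow> speed (j, t) \<le> B" using speed_bounded by blast
  have "finite_measure (density param_space (\<lambda>p. ennreal (speed p)))"
  proof (rule finite_measureI)
    have "emeasure (density param_space (\<lambda>p. ennreal (speed p))) (space param_space)
      = (\<integral>\<^sup>+p. ennreal (speed p) * indicator (space param_space) p \<partial>param_space)"
      using measurable_speed by (intro emeasure_density) auto
    also have "\<dots> \<le> (\<integral>\<^sup>+p. ennreal B \<partial>param_space)"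
      using B(2) by (intro nn_integral_mono)
        (auto simp: space_pair_measure split: split_indicator intro!: ennreal_leI)
    also have "\<dots> < \<infinity>"
    proof -
      have "emeasure param_space (space param_space) < top"
        using P.emeasure_finite[of "space param_space"] unfolding infinity_ennreal_def less_top .
      then show ?thesis by (simp add: ennreal_mult_less_top)
    qed
    finally show "emeasure (density param_space (\<lambda>p. ennreal (speed p)))
       (space (density param_space (\<lambda>p. ennreal (speed p)))) \<noteq> \<infinity>" by simp
  qed
  then interpret D: finite_measure "density param_space (\<lambda>p. ennreal (speed p))" .
  show ?thesis
    unfolding arc_length_distr by (rule D.finite_measure_distr) (use measurable_param in simp)
qed

lemma continuous_borel_measurable_arc_length:
  assumes "continuous_on (frontier \<Omega>) f"
  shows "f \<in> borel_measurable (arc_length \<Omega> n \<gamma>)"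
  using borel_measurable_continuous_on_restrict[OF assms] measurable_cong_sets[OF sets_arc_length refl]
  by blast

lemma bounded_on_frontier:
  fixes f :: "complex \<Rightarrow> 'a::real_normed_vector"
  assumes "continuous_on (frontier \<Omega>) f"
  obtains B where "0 < B" "\<And>z. z \<in> frontier \<Omega> \<Longrightarrow> norm (f z) \<le> B"
  using compact_imp_bounded[OF compact_continuous_image[OF assms compact_frontier_\<Omega>]]
  by (force simp: bounded_pos)

lemma continuous_integrable_arc_length:
  fixes f :: "complex \<Rightarrow> 'a::{banach, second_countable_topology}"
  assumes "continuous_on (frontier \<Omega>) f"
  shows "integrable (arc_length \<Omega> n \<gamma>) f"
proof -
  interpret finite_measure "arc_length \<Omega> n \<gamma>" by (rule finite_measure_arc_length)
  obtain B where "\<And>z. z \<in> frontier \<Omega> \<Longrightarrow> norm (f z) \<le> B" using bounded_on_frontier[OF assms] by blast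
  then show ?thesis
    by (intro integrable_const_bound[where B = B] continuous_borel_measurable_arc_length assms) auto
qed

lemma integral_arc_length:
  fixes f :: "complex \<Rightarrow> complex"
  assumes cont: "continuous_on (frontier \<Omega>) f"
  shows "(LINT z | arc_length \<Omega> n \<gamma>. f z)
    = (\<Sum>j<n. integral {0..1} (\<lambda>t. f (\<gamma> j t) * of_real (norm (vector_derivative (\<gamma> j) (at t)))))"
proof -
  let ?D = "density param_space (\<lambda>p. ennreal (speed p))"
  let ?g = "\<lambda>j t. speed (j, t) *\<^sub>R f (\<gamma> j t)"
  have mf: "f \<in> borel_measurable (restrict_space borel (frontier \<Omega>))"
    by (rule borel_measurable_continuous_on_restrict[OF cont])
  have mD: "(\<lambda>(j, t). \<gamma> j t) \<in> measurable ?D (restrict_space borel (frontier \<Omega>))"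
    using measurable_param by simp
  have mc: "(\<lambda>p. f (case p of (j, t) \<Rightarrow> \<gamma> j t)) \<in> borel_measurable param_space"
    by (rule measurable_compose[OF measurable_param mf])
  have "integrable (arc_length \<Omega> n \<gamma>) f" by (rule continuous_integrable_arc_length[OF cont])
  then have "integrable ?D (\<lambda>p. f (case p of (j, t) \<Rightarrow> \<gamma> j t))"
    unfolding arc_length_distr using integrable_distr_eq[OF mD mf] by simp
  then have int: "integrable param_space (\<lambda>p. speed p *\<^sub>R f (case p of (j, t) \<Rightarrow> \<gamma> j t))"
    using integrable_density[OF mc measurable_speed] by (simp add: case_prod_unfold)
  have "(LINT z | arc_length \<Omega> n \<gamma>. f z) = (LINT p | ?D. f (case p of (j, t) \<Rightarrow> \<gamma> j t))"
    unfolding arc_length_distr by (rule integral_distr[OF mD mf])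
  also have "\<dots> = (LINT p | param_space. speed p *\<^sub>R f (case p of (j, t) \<Rightarrow> \<gamma> j t))"
    by (rule integral_density[OF mc measurable_speed]) (simp add: case_prod_unfold)
  also have "\<dots> = (LINT j | count_space {..<n}. LINT t | restrict_space lborel {0..1}. ?g j t)"
  proof -
    interpret A: finite_measure "count_space {..<n}" by (rule finite_measure_count_space) simp
    interpret B: finite_measure "restrict_space lborel {0..1::real}"
      by (rule finite_measureI) (simp add: emeasure_restrict_space space_restrict_space)
    interpret pair_sigma_finite "count_space {..<n}" "restrict_space lborel {0..1::real}" ..
    show ?thesis using integral_fst'[OF int] by simp
  qed
  also have "\<dots> = (\<Sum>j<n. LINT t | restrict_space lborel {0..1}. ?g j t)"
    by (simp add: lebesgue_integral_count_space_finite)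
  also have "\<dots> = (\<Sum>j<n. integral {0..1} (\<lambda>t. f (\<gamma> j t) * of_real (norm (vector_derivative (\<gamma> j) (at t)))))"
  proof (rule sum.cong)
    fix j assume "j \<in> {..<n}"
    then have j: "j < n" by simp
    interpret smooth_loop "\<gamma> j" using loop_\<gamma>[OF j] .
    have "continuous_on {0..1} (\<lambda>t. f (\<gamma> j t))"
      by (rule continuous_on_compose2[OF cont continuous_c]) (use \<gamma>_frontier[OF j] in auto)
    then have "continuous_on {0..1} (\<lambda>t. norm (c' t) *\<^sub>R f (\<gamma> j t))"
      by (intro continuous_intros continuous_c')
    then have "set_integrable lborel {0..1} (\<lambda>t. norm (c' t) *\<^sub>R f (\<gamma> j t))"
      unfolding set_integrable_def by (intro borel_integrable_compact) auto
    from set_borel_integral_eq_integral(2)[OF this]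
    show "(LINT t | restrict_space lborel {0..1}. ?g j t)
        = integral {0..1} (\<lambda>t. f (\<gamma> j t) * of_real (norm (c' t)))"
      by (simp add: integral_restrict_space set_lebesgue_integral_def scaleR_conv_of_real mult.commute)
  qed simp
  finally show ?thesis .
qed

lemma unit_tangent_eq:
  assumes j: "j < n"
  shows "unit_tangent n \<gamma> (\<gamma> j t) = sgn (vector_derivative (\<gamma> j) (at t))"
  unfolding unit_tangent_def
proof (rule the_equality)
  show "\<exists>i<n. \<exists>s. \<gamma> i s = \<gamma> j t \<and> sgn (vector_derivative (\<gamma> j) (at t)) = sgn (vector_derivative (\<gamma> i) (at s))"
    using j by blast
next
  fix \<tau> assume "\<exists>i<n. \<exists>s. \<gamma> i s = \<gamma> j t \<and> \<tau> = sgn (vector_derivative (\<gamma> i) (at s))"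
  then obtain i s where i: "i < n" "\<gamma> i s = \<gamma> j t" "\<tau> = sgn (vector_derivative (\<gamma> i) (at s))" by blast
  have "i = j" using disjoint_\<gamma>[OF i(1) j] i(2) by (metis disjoint_iff rangeI)
  then show "\<tau> = sgn (vector_derivative (\<gamma> j) (at t))"
    using i smooth_loop.c'_cong[OF loop_\<gamma>[OF j]] by metis
qed

text \<open>The unit tangent is a factor of the density of the Cauchy transform that defines the adjoint, which
  has to be Lipschitz for that transform to have boundary values.\<close>

lemma unit_tangent_lipschitz:
  obtains L where "L-lipschitz_on (frontier \<Omega>) (unit_tangent n \<gamma>)"
proof -
  have "\<exists>L\<ge>0. \<forall>s t. norm (unit_tangent n \<gamma> (\<gamma> j s) - unit_tangent n \<gamma> (\<gamma> j t)) \<le> L * \<bar>s - t\<bar>"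
    if j: "j < n" for j
  proof -
    interpret smooth_loop "\<gamma> j" using loop_\<gamma>[OF j] .
    obtain m B where m: "0 < m" "\<And>t. m \<le> norm (c' t)" using c'_bounds by metis
    obtain M where M: "0 < M" "\<And>s t. norm (c' s - c' t) \<le> M * \<bar>s - t\<bar>"
      using quadratic_approximation by metis
    have "norm (sgn (c' s) - sgn (c' t)) \<le> 2 * M / m * \<bar>s - t\<bar>" for s t
    proof -
      let ?a = "c' s" and ?b = "c' t"
      have nz: "norm ?a > 0" "norm ?b > 0" using c'_nonzero by auto
      have "sgn ?a - sgn ?b = (?a - ?b) /\<^sub>R norm ?a + ((norm ?b - norm ?a) / norm ?a) *\<^sub>R sgn ?b"
      proof -
        have "(y - x) / x = inverse x * y - 1" if "0 < x" for x y :: real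
          using that by (simp add: field_simps)
        from this[OF nz(1)] have "(norm ?b - norm ?a) / norm ?a = inverse (norm ?a) * norm ?b - 1" .
        moreover have "norm ?b *\<^sub>R sgn ?b = ?b" using nz by (simp add: sgn_div_norm)
        ultimately have "((norm ?b - norm ?a) / norm ?a) *\<^sub>R sgn ?b = ?b /\<^sub>R norm ?a - sgn ?b"
          by (metis scaleR_diff_left scaleR_one scaleR_scaleR)
        then show ?thesis by (simp add: scaleR_diff_right sgn_div_norm)
      qed
      also have "norm \<dots> \<le> norm (?a - ?b) / norm ?a + norm (?a - ?b) / norm ?a"
      proof (rule norm_triangle_mono)
        show "norm ((?a - ?b) /\<^sub>R norm ?a) \<le> norm (?a - ?b) / norm ?a"
          by (simp add: divide_inverse mult.commute)
        have "\<bar>norm ?b - norm ?a\<bar> \<le> norm (?a - ?b)"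
          by (metis norm_triangle_ineq3 norm_minus_commute)
        then show "norm (((norm ?b - norm ?a) / norm ?a) *\<^sub>R sgn ?b) \<le> norm (?a - ?b) / norm ?a"
          using nz by (simp add: norm_sgn divide_right_mono)
      qed
      also have "\<dots> = 2 * norm (?a - ?b) / norm ?a" by simp
      also have "\<dots> \<le> 2 * (M * \<bar>s - t\<bar>) / m"
        using M m nz by (intro frac_le mult_left_mono) auto
      finally show ?thesis by simp
    qed
    then show ?thesis
      unfolding unit_tangent_eq[OF j] using M m by (intro exI[of _ "2 * M / m"]) auto
  qed
  then show ?thesis using lipschitz_on_frontier[of "unit_tangent n \<gamma>"] that by blast
qed

text \<open>The identity \<open>T ds = dz\<close>.\<close>

lemma integral_unit_tangent:
  assumes cont: "continuous_on (frontier \<Omega>) f"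
  shows "(LINT z | arc_length \<Omega> n \<gamma>. f z * unit_tangent n \<gamma> z) = (\<Sum>j<n. contour_integral (\<gamma> j) f)"
proof -
  obtain L where "L-lipschitz_on (frontier \<Omega>) (unit_tangent n \<gamma>)" using unit_tangent_lipschitz .
  then have "continuous_on (frontier \<Omega>) (\<lambda>z. f z * unit_tangent n \<gamma> z)"
    using lipschitz_on_continuous_on by (intro continuous_on_mult cont) blast
  from integral_arc_length[OF this] show ?thesis
    unfolding contour_integral_integral
    by (auto simp: unit_tangent_eq sgn_eq mult.assoc intro!: sum.cong)
       (simp add: smooth_loop.c'_nonzero loop_\<gamma>)
qed

end


section \<open>The Hardy space and the weighted projection\<close>

lemma A_infinity_continuous:
  assumes "f \<in> A_infinity \<Omega>" shows "continuous_on (closure \<Omega>) f"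
proof -
  obtain D :: "nat \<Rightarrow> nat \<Rightarrow> complex \<Rightarrow> complex"
    where D: "\<forall>z\<in>closure \<Omega>. D 0 0 z = f z" "\<forall>a b. continuous_on (closure \<Omega>) (D a b)"
    using assms unfolding A_infinity_def smooth_on_closure_def by blast
  have "continuous_on (closure \<Omega>) f \<longleftrightarrow> continuous_on (closure \<Omega>) (D 0 0)"
    by (rule continuous_on_cong) (simp_all add: D(1))
  then show ?thesis using D(2) by blast
qed

lemma A_infinity_diff:
  assumes "f \<in> A_infinity \<Omega>" "g \<in> A_infinity \<Omega>"
  shows "(\<lambda>z. f z - g z) \<in> A_infinity \<Omega>"
proof -
  obtain D where D: "\<forall>z\<in>closure \<Omega>. D 0 0 z = f z" "\<forall>a b. continuous_on (closure \<Omega>) (D a b)"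
     "\<forall>a b. \<forall>z\<in>\<Omega>. (D a b has_derivative
            (\<lambda>h. of_real (Re h) * D (Suc a) b z + of_real (Im h) * D a (Suc b) z)) (at z)"
    using assms(1) unfolding A_infinity_def smooth_on_closure_def by blast
  obtain E where E: "\<forall>z\<in>closure \<Omega>. E 0 0 z = g z" "\<forall>a b. continuous_on (closure \<Omega>) (E a b)"
     "\<forall>a b. \<forall>z\<in>\<Omega>. (E a b has_derivative
            (\<lambda>h. of_real (Re h) * E (Suc a) b z + of_real (Im h) * E a (Suc b) z)) (at z)"
    using assms(2) unfolding A_infinity_def smooth_on_closure_def by blast
  have "smooth_on_closure \<Omega> (\<lambda>z. f z - g z)"
    unfolding smooth_on_closure_def
  proof (intro exI[of _ "\<lambda>a b z. D a b z - E a b z"] conjI allI ballI)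
    fix a b z assume z: "z \<in> \<Omega>"
    show "((\<lambda>z. D a b z - E a b z) has_derivative (\<lambda>h. of_real (Re h) * (D (Suc a) b z - E (Suc a) b z)
        + of_real (Im h) * (D a (Suc b) z - E a (Suc b) z))) (at z)"
      using has_derivative_diff[OF D(3)[rule_format, OF z, of a b] E(3)[rule_format, OF z, of a b]]
      by (simp add: right_diff_distrib add_diff_add)
  next
    show "D 0 0 z - E 0 0 z = f z - g z" if "z \<in> closure \<Omega>" for z
      using D(1) E(1) that by simp
    show "continuous_on (closure \<Omega>) (\<lambda>z. D a b z - E a b z)" for a b
      using D(2) E(2) by (intro continuous_on_diff) blast+
  qed
  then show ?thesis using assms by (auto simp: A_infinity_def intro: holomorphic_on_diff)
qed

lemma lipschitz_on_mult_bounded: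
  fixes f g :: "'a::metric_space \<Rightarrow> 'b::real_normed_algebra"
  assumes f: "L-lipschitz_on S f" "\<And>x. x \<in> S \<Longrightarrow> norm (f x) \<le> A"
    and g: "M-lipschitz_on S g" "\<And>x. x \<in> S \<Longrightarrow> norm (g x) \<le> B" and "0 \<le> A" "0 \<le> B"
  shows "(A * M + L * B)-lipschitz_on S (\<lambda>x. f x * g x)"
proof (rule lipschitz_onI)
  fix x y assume xy: "x \<in> S" "y \<in> S"
  have "f x * g x - f y * g y = f x * (g x - g y) + (f x - f y) * g y" by (simp add: algebra_simps)
  also have "norm \<dots> \<le> A * (M * dist x y) + L * dist x y * B"
  proof (rule norm_triangle_mono)
    have "norm (f x * (g x - g y)) \<le> norm (f x) * norm (g x - g y)" by (rule norm_mult_ineq)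
    also have "\<dots> \<le> A * (M * dist x y)"
      using lipschitz_onD[OF g(1) xy] f(2)[OF xy(1)] \<open>0 \<le> A\<close>
      by (intro mult_mono) (auto simp: dist_norm)
    finally show "norm (f x * (g x - g y)) \<le> A * (M * dist x y)" .
    have "norm ((f x - f y) * g y) \<le> norm (f x - f y) * norm (g y)" by (rule norm_mult_ineq)
    also have "\<dots> \<le> L * dist x y * B"
      using lipschitz_onD[OF f(1) xy] g(2)[OF xy(2)] lipschitz_on_nonneg[OF f(1)]
      by (intro mult_mono) (auto simp: dist_norm)
    finally show "norm ((f x - f y) * g y) \<le> L * dist x y * B" .
  qed
  finally show "dist (f x * g x) (f y * g y) \<le> (A * M + L * B) * dist x y"
    by (simp add: dist_norm algebra_simps)
qed (use assms lipschitz_on_nonneg[OF f(1)] lipschitz_on_nonneg[OF g(1)] in auto)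

lemma norm_diff_squared_le: "(norm (a - b))\<^sup>2 \<le> 2 * (norm a)\<^sup>2 + 2 * (norm b)\<^sup>2" for a b :: complex
proof -
  have "(norm (a - b))\<^sup>2 \<le> (norm a + norm b)\<^sup>2" by (intro power_mono norm_triangle_ineq4) auto
  also have "\<dots> \<le> 2 * (norm a)\<^sup>2 + 2 * (norm b)\<^sup>2"
    using sum_squares_bound[of "norm a" "norm b"] by (simp add: power2_sum)
  finally show ?thesis .
qed

context smooth_domain begin

lemma lipschitz_frontier_mult:
  fixes f g :: "complex \<Rightarrow> complex"
  assumes "L-lipschitz_on (frontier \<Omega>) f" "M-lipschitz_on (frontier \<Omega>) g"
  obtains K where "K-lipschitz_on (frontier \<Omega>) (\<lambda>z. f z * g z)"
proof -
  obtain A where "0 < A" "\<And>z. z \<in> frontier \<Omega> \<Longrightarrow> norm (f z) \<le> A"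
    using bounded_on_frontier[OF lipschitz_on_continuous_on[OF assms(1)]] by blast
  moreover obtain B where "0 < B" "\<And>z. z \<in> frontier \<Omega> \<Longrightarrow> norm (g z) \<le> B"
    using bounded_on_frontier[OF lipschitz_on_continuous_on[OF assms(2)]] by blast
  ultimately show ?thesis
    using lipschitz_on_mult_bounded[OF assms(1) _ assms(2), of A B] by (intro that) auto
qed

abbreviation L2 :: "(complex \<Rightarrow> complex) set" where
  "L2 \<equiv> L2_boundary \<Omega> n \<gamma> (\<lambda>_. 1)"

lemma L2_iff: "u \<in> L2 \<longleftrightarrow> u \<in> borel_measurable (arc_length \<Omega> n \<gamma>) \<and>
    integrable (arc_length \<Omega> n \<gamma>) (\<lambda>z. (norm (u z))\<^sup>2)"
  by (simp add: L2_boundary_def)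

lemma continuous_L2: "continuous_on (frontier \<Omega>) u \<Longrightarrow> u \<in> L2"
  unfolding L2_iff
  by (auto intro!: continuous_borel_measurable_arc_length continuous_integrable_arc_length continuous_intros)

lemma L2_diff:
  assumes "u \<in> L2" "v \<in> L2" shows "(\<lambda>z. u z - v z) \<in> L2"
proof -
  have [measurable]: "u \<in> borel_measurable (arc_length \<Omega> n \<gamma>)" "v \<in> borel_measurable (arc_length \<Omega> n \<gamma>)"
    using assms by (auto simp: L2_iff)
  have "integrable (arc_length \<Omega> n \<gamma>) (\<lambda>z. 2 * (norm (u z))\<^sup>2 + 2 * (norm (v z))\<^sup>2)"
    using assms by (auto simp: L2_iff)
  then have "integrable (arc_length \<Omega> n \<gamma>) (\<lambda>z. (norm (u z - v z))\<^sup>2)"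
    by (rule Bochner_Integration.integrable_bound) (auto simp: norm_diff_squared_le)
  then show ?thesis unfolding L2_iff by simp
qed

text \<open>Since \<open>\<phi>\<close> is bounded on the compact boundary, the weighted inner product is defined on the
  unweighted space, by \<open>|u v| \<le> |u|\<^sup>2 + |v|\<^sup>2\<close>.\<close>

lemma L2_product_integrable:
  assumes "u \<in> L2" "v \<in> L2" and \<phi>: "continuous_on (frontier \<Omega>) \<phi>"
  shows "integrable (arc_length \<Omega> n \<gamma>) (\<lambda>z. u z * cnj (v z) * complex_of_real (\<phi> z))"
proof -
  have [measurable]: "u \<in> borel_measurable (arc_length \<Omega> n \<gamma>)" "v \<in> borel_measurable (arc_length \<Omega> n \<gamma>)"
    using assms by (auto simp: L2_iff)
  have [measurable]: "\<phi> \<in> borel_measurable (arc_length \<Omega> n \<gamma>)"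
    by (rule continuous_borel_measurable_arc_length[OF \<phi>])
  have [measurable]: "(\<lambda>z. cnj (v z)) \<in> borel_measurable (arc_length \<Omega> n \<gamma>)"
    by (rule measurable_compose[OF _ borel_measurable_continuous_onI]) (auto intro: continuous_intros)
  obtain B where B: "0 < B" "\<And>z. z \<in> frontier \<Omega> \<Longrightarrow> norm (\<phi> z) \<le> B" using bounded_on_frontier[OF \<phi>] by blast
  have "integrable (arc_length \<Omega> n \<gamma>) (\<lambda>z. B * ((norm (u z))\<^sup>2 + (norm (v z))\<^sup>2))"
    using assms by (auto simp: L2_iff)
  then show ?thesis
  proof (rule Bochner_Integration.integrable_bound)
    show "AE z in arc_length \<Omega> n \<gamma>. norm (u z * cnj (v z) * complex_of_real (\<phi> z))
        \<le> norm (B * ((norm (u z))\<^sup>2 + (norm (v z))\<^sup>2))"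
    proof (rule AE_I2)
      fix z assume "z \<in> space (arc_length \<Omega> n \<gamma>)"
      then have "\<bar>\<phi> z\<bar> \<le> B" using B(2) by simp
      moreover have "norm (u z) * norm (v z) \<le> (norm (u z))\<^sup>2 + (norm (v z))\<^sup>2"
        using sum_squares_bound[of "norm (u z)" "norm (v z)"]
          mult_nonneg_nonneg[OF norm_ge_zero[of "u z"] norm_ge_zero[of "v z"]] by linarith
      ultimately have "norm (u z) * norm (v z) * \<bar>\<phi> z\<bar> \<le> ((norm (u z))\<^sup>2 + (norm (v z))\<^sup>2) * B"
        by (intro mult_mono) auto
      then show "norm (u z * cnj (v z) * complex_of_real (\<phi> z))
        \<le> norm (B * ((norm (u z))\<^sup>2 + (norm (v z))\<^sup>2))"
        using B(1) by (simp add: norm_mult mult.commute abs_mult)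
    qed
  qed measurable
qed

lemma norm_boundary_squared:
  "norm_boundary \<Omega> n \<gamma> (\<lambda>_. 1) u = sqrt (LINT z | arc_length \<Omega> n \<gamma>. (norm (u z))\<^sup>2)"
proof -
  have "inner_boundary \<Omega> n \<gamma> (\<lambda>_. 1) u u = of_real (LINT z | arc_length \<Omega> n \<gamma>. (norm (u z))\<^sup>2)"
    unfolding inner_boundary_def integral_complex_of_real[symmetric]
    by (simp only: complex_norm_square of_real_1 mult_1_right)
  then show ?thesis by (simp add: norm_boundary_def)
qed

lemma A_infinity_continuous_frontier: "f \<in> A_infinity \<Omega> \<Longrightarrow> continuous_on (frontier \<Omega>) f"
  using A_infinity_continuous continuous_on_subset frontier_subset_closed
  by (metis Diff_subset frontier_def)

lemma A_infinity_hardy: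
  assumes "f \<in> A_infinity \<Omega>" shows "f \<in> hardy_space \<Omega> n \<gamma>"
  unfolding hardy_space_def using assms continuous_L2[OF A_infinity_continuous_frontier]
  by (auto intro!: bexI[of _ f] simp: norm_boundary_squared)

lemma hardy_diff_A_infinity:
  assumes h: "h \<in> hardy_space \<Omega> n \<gamma>" and f: "f \<in> A_infinity \<Omega>"
  shows "(\<lambda>z. h z - f z) \<in> hardy_space \<Omega> n \<gamma>"
  unfolding hardy_space_def
proof (intro CollectI conjI allI impI)
  show "(\<lambda>z. h z - f z) \<in> L2"
    using h continuous_L2[OF A_infinity_continuous_frontier[OF f]] by (auto simp: hardy_space_def intro: L2_diff)
  fix \<epsilon> :: real assume "0 < \<epsilon>"
  then obtain g where g: "g \<in> A_infinity \<Omega>" "norm_boundary \<Omega> n \<gamma> (\<lambda>_. 1) (\<lambda>z. h z - g z) < \<epsilon>"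
    using h by (auto simp: hardy_space_def)
  then show "\<exists>g\<in>A_infinity \<Omega>. norm_boundary \<Omega> n \<gamma> (\<lambda>_. 1) (\<lambda>z. h z - f z - g z) < \<epsilon>"
    by (intro bexI[of _ "\<lambda>z. g z - f z"]) (auto intro: A_infinity_diff f)
qed

text \<open>Orthogonality passes from \<open>A\<^sup>\<infinity>(\<Omega>)\<close> to its closure.  For a bounded function \<open>e\<close> the elementary inequality
  \<open>x \<le> \<epsilon> + x\<^sup>2 / \<epsilon>\<close> under the integral takes the place of the Cauchy-Schwarz inequality.\<close>

lemma orthogonal_hardy:
  assumes e: "continuous_on (frontier \<Omega>) e" and \<phi>: "continuous_on (frontier \<Omega>) \<phi>"
    and orth: "\<And>f. f \<in> A_infinity \<Omega> \<Longrightarrow> inner_boundary \<Omega> n \<gamma> \<phi> e f = 0"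
    and g: "g \<in> hardy_space \<Omega> n \<gamma>"
  shows "inner_boundary \<Omega> n \<gamma> \<phi> e g = 0"
proof -
  let ?M = "arc_length \<Omega> n \<gamma>"
  interpret finite_measure ?M by (rule finite_measure_arc_length)
  define m where "m = measure ?M (space ?M)"
  have m: "m \<ge> 0" by (simp add: m_def)
  have "continuous_on (frontier \<Omega>) (\<lambda>z. e z * of_real (\<phi> z))"
    using e \<phi> by (intro continuous_intros)
  then obtain K where K: "0 < K" "\<And>z. z \<in> frontier \<Omega> \<Longrightarrow> norm (e z * of_real (\<phi> z)) \<le> K"
    using bounded_on_frontier by blast
  have eL: "e \<in> L2" and gL: "g \<in> L2" using continuous_L2[OF e] g by (auto simp: hardy_space_def)
  have bound: "norm (inner_boundary \<Omega> n \<gamma> \<phi> e g) \<le> K * (m + 1) * \<epsilon>" if \<epsilon>: "0 < \<epsilon>" for \<epsilon>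
  proof -
    obtain f where f: "f \<in> A_infinity \<Omega>" "norm_boundary \<Omega> n \<gamma> (\<lambda>_. 1) (\<lambda>z. g z - f z) < \<epsilon>"
      using g \<epsilon> by (auto simp: hardy_space_def)
    have fL: "f \<in> L2" by (rule continuous_L2[OF A_infinity_continuous_frontier[OF f(1)]])
    have dL: "(\<lambda>z. g z - f z) \<in> L2" by (rule L2_diff[OF gL fL])
    then have dI: "integrable ?M (\<lambda>z. (norm (g z - f z))\<^sup>2)" by (simp add: L2_iff)
    have small: "(LINT z | ?M. (norm (g z - f z))\<^sup>2) \<le> \<epsilon>\<^sup>2"
      using f(2) \<epsilon> unfolding norm_boundary_squared
      by (intro sqrt_le_D) simp
    have "inner_boundary \<Omega> n \<gamma> \<phi> e g = inner_boundary \<Omega> n \<gamma> \<phi> e g - inner_boundary \<Omega> n \<gamma> \<phi> e f"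
      using orth[OF f(1)] by simp
    also have "\<dots> = (LINT z | ?M. e z * cnj (g z) * of_real (\<phi> z) - e z * cnj (f z) * of_real (\<phi> z))"
      unfolding inner_boundary_def
      by (rule Bochner_Integration.integral_diff[symmetric]; rule L2_product_integrable[OF eL _ \<phi>])
         (use gL fL in auto)
    also have "norm \<dots> \<le> (LINT z | ?M. K * ((\<epsilon> + (norm (g z - f z))\<^sup>2 / \<epsilon>)))"
    proof (rule order_trans[OF integral_norm_bound Bochner_Integration.integral_mono])
      show "integrable ?M (\<lambda>z. norm (e z * cnj (g z) * of_real (\<phi> z) - e z * cnj (f z) * of_real (\<phi> z)))"
        by (intro integrable_norm Bochner_Integration.integrable_diff L2_product_integrable eL gL fL \<phi>)
      show "integrable ?M (\<lambda>z. K * ((\<epsilon> + (norm (g z - f z))\<^sup>2 / \<epsilon>)))"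
        using dI by auto
      fix z assume "z \<in> space ?M"
      then have z: "norm (e z * of_real (\<phi> z)) \<le> K" using K(2) by simp
      have "e z * cnj (g z) * of_real (\<phi> z) - e z * cnj (f z) * of_real (\<phi> z)
          = (e z * of_real (\<phi> z)) * cnj (g z - f z)" by (simp add: algebra_simps)
      also have "norm \<dots> \<le> K * norm (g z - f z)"
        unfolding norm_mult[of "e z * of_real (\<phi> z)"] using z by (simp only: complex_mod_cnj) (intro mult_right_mono, auto)
      also have "norm (g z - f z) \<le> \<epsilon> + (norm (g z - f z))\<^sup>2 / \<epsilon>"
      proof -
        have "\<epsilon> * norm (g z - f z) \<le> \<epsilon>\<^sup>2 + (norm (g z - f z))\<^sup>2"
          using sum_squares_bound[of \<epsilon> "norm (g z - f z)"]
            mult_nonneg_nonneg[OF less_imp_le[OF \<epsilon>] norm_ge_zero[of "g z - f z"]] by linarith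
        then have "\<epsilon> * norm (g z - f z) / \<epsilon> \<le> (\<epsilon>\<^sup>2 + (norm (g z - f z))\<^sup>2) / \<epsilon>"
          using \<epsilon> by (intro divide_right_mono) auto
        then show ?thesis using \<epsilon> by (simp add: add_divide_distrib power2_eq_square)
      qed
      finally show "norm (e z * cnj (g z) * of_real (\<phi> z) - e z * cnj (f z) * of_real (\<phi> z))
          \<le> K * ((\<epsilon> + (norm (g z - f z))\<^sup>2 / \<epsilon>))" using K(1) by (simp add: mult_left_mono)
    qed
    also have "\<dots> = K * (\<epsilon> * m + (LINT z | ?M. (norm (g z - f z))\<^sup>2) / \<epsilon>)"
      using dI by (simp add: m_def)
    also have "\<dots> \<le> K * (\<epsilon> * m + \<epsilon>\<^sup>2 / \<epsilon>)"
      using small K(1) \<epsilon> by (intro mult_left_mono add_left_mono divide_right_mono) auto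
    also have "\<dots> = K * (m + 1) * \<epsilon>" using \<epsilon> by (simp add: power2_eq_square algebra_simps)
    finally show ?thesis .
  qed
  have "norm (inner_boundary \<Omega> n \<gamma> \<phi> e g) \<le> 0"
  proof (rule field_le_epsilon)
    fix r :: real assume r: "0 < r"
    have p: "K * (m + 1) > 0" using K(1) m by simp
    then have "0 < r / (K * (m + 1))" using r by simp
    from bound[OF this] have "norm (inner_boundary \<Omega> n \<gamma> \<phi> e g) \<le> K * (m + 1) * (r / (K * (m + 1)))" .
    moreover have "K * (m + 1) * (r / (K * (m + 1))) = r"
    proof -
      have "x * (r / x) = r" if "0 < x" for x :: real using that by simp
      from this[OF p] show ?thesis .
    qed
    ultimately show "norm (inner_boundary \<Omega> n \<gamma> \<phi> e g) \<le> 0 + r" by linarith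
  qed
  then show ?thesis by simp
qed

text \<open>Any two functions with the defining properties of the projection differ by an element \<open>d\<close> of the Hardy space that
  is orthogonal to itself; as the weight is positive, \<open>d\<close> vanishes almost everywhere.  In particular the value of the
  choice operator is identified by exhibiting one candidate \<open>f\<close>.\<close>

lemma szego_projection_unique:
  assumes \<phi>: "continuous_on (frontier \<Omega>) \<phi>" and pos: "\<And>z. z \<in> frontier \<Omega> \<Longrightarrow> \<phi> z > 0"
    and f: "f \<in> A_infinity \<Omega>" and v: "v \<in> L2"
    and orth: "\<And>g. g \<in> hardy_space \<Omega> n \<gamma> \<Longrightarrow> inner_boundary \<Omega> n \<gamma> \<phi> (\<lambda>z. v z - f z) g = 0"
  shows "AE z in arc_length \<Omega> n \<gamma>. szego_projection \<Omega> n \<gamma> \<phi> v z = f z"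
proof -
  let ?M = "arc_length \<Omega> n \<gamma>"
  define h where "h = szego_projection \<Omega> n \<gamma> \<phi> v"
  have "h \<in> hardy_space \<Omega> n \<gamma> \<and>
      (\<forall>g\<in>hardy_space \<Omega> n \<gamma>. inner_boundary \<Omega> n \<gamma> \<phi> (\<lambda>z. v z - h z) g = 0)"
    unfolding h_def szego_projection_def
    by (rule someI[of _ f]) (use A_infinity_hardy[OF f] orth in blast)
  then have h: "h \<in> hardy_space \<Omega> n \<gamma>"
    "\<And>g. g \<in> hardy_space \<Omega> n \<gamma> \<Longrightarrow> inner_boundary \<Omega> n \<gamma> \<phi> (\<lambda>z. v z - h z) g = 0" by blast+
  define d where "d = (\<lambda>z. h z - f z)"
  have d: "d \<in> hardy_space \<Omega> n \<gamma>" unfolding d_def by (rule hardy_diff_A_infinity[OF h(1) f])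
  have L: "h \<in> L2" "d \<in> L2" "f \<in> L2"
    using h(1) d continuous_L2[OF A_infinity_continuous_frontier[OF f]] by (auto simp: hardy_space_def)
  have "inner_boundary \<Omega> n \<gamma> \<phi> d d
      = (LINT z | ?M. (v z - f z) * cnj (d z) * of_real (\<phi> z) - (v z - h z) * cnj (d z) * of_real (\<phi> z))"
    unfolding inner_boundary_def
    by (rule Bochner_Integration.integral_cong) (auto simp: d_def algebra_simps)
  also have "\<dots> = inner_boundary \<Omega> n \<gamma> \<phi> (\<lambda>z. v z - f z) d - inner_boundary \<Omega> n \<gamma> \<phi> (\<lambda>z. v z - h z) d"
    unfolding inner_boundary_def
    by (rule Bochner_Integration.integral_diff; rule L2_product_integrable[OF _ L(2) \<phi>])
       (auto intro: L2_diff v L)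
  also have "\<dots> = 0" using orth[OF d] h(2)[OF d] by simp
  finally have zero: "inner_boundary \<Omega> n \<gamma> \<phi> d d = 0" .
  have eq: "d z * cnj (d z) * complex_of_real (\<phi> z) = complex_of_real ((norm (d z))\<^sup>2 * \<phi> z)" for z
    by (simp only: of_real_mult complex_norm_square)
  have int: "integrable ?M (\<lambda>z. (norm (d z))\<^sup>2 * \<phi> z)"
    using L2_product_integrable[OF L(2) L(2) \<phi>] unfolding eq by (simp only: complex_of_real_integrable_eq)
  have "(LINT z | ?M. (norm (d z))\<^sup>2 * \<phi> z) = 0"
    using zero unfolding inner_boundary_def eq integral_complex_of_real by simp
  then have "AE z in ?M. (norm (d z))\<^sup>2 * \<phi> z = 0"
    by (subst (asm) integral_nonneg_eq_0_iff_AE[OF int]) (auto intro!: AE_I2 simp: pos less_imp_le)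
  moreover have "AE z in ?M. \<phi> z > 0" by (rule AE_I2) (simp add: pos)
  ultimately show ?thesis
    unfolding h_def[symmetric] by eventually_elim (simp add: d_def)
qed

text \<open>For \<open>w = cnj (v * \<phi> * T)\<close> the function paired with \<open>f\<close> is \<open>v - \<C>\<^sup>*v\<close>.  The weight cancels and the
  inner product becomes the conjugate of the contour integral of the product of \<open>\<C>w\<close> and \<open>f\<close>, which is holomorphic in \<open>\<Omega>\<close> and continuous
  on the closure.\<close>

lemma cauchy_adjoint_defect_orthogonal:
  assumes w: "L-lipschitz_on (frontier \<Omega>) w" and f: "f \<in> A_infinity \<Omega>"
    and pos: "\<And>z. z \<in> frontier \<Omega> \<Longrightarrow> \<phi> z > (0::real)"
  shows "inner_boundary \<Omega> n \<gamma> \<phi>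
    (\<lambda>z. cnj (unit_tangent n \<gamma> z) * inverse (of_real (\<phi> z)) * cnj (cauchy_transform \<Omega> n \<gamma> w z)) f = 0"
proof -
  let ?G = "cauchy_transform \<Omega> n \<gamma> w" and ?T = "unit_tangent n \<gamma>"
  have cw: "continuous_on (frontier \<Omega>) w" by (rule lipschitz_on_continuous_on[OF w])
  have hol: "?G holomorphic_on \<Omega>"
    by (rule holomorphic_transform[OF cauchy_integral_holomorphic[OF cw]])
       (simp add: cauchy_transform_interior[OF cw])
  have cont: "continuous_on (closure \<Omega>) ?G" by (rule cauchy_transform_continuous[OF w])
  have fh: "f holomorphic_on \<Omega>" using f by (simp add: A_infinity_def)
  have zero: "(\<Sum>j<n. contour_integral (\<gamma> j) (\<lambda>z. ?G z * f z)) = 0"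
    by (rule Cauchy_theorem_closure)
       (intro holomorphic_on_mult hol fh, intro continuous_on_mult cont A_infinity_continuous f)
  have "inner_boundary \<Omega> n \<gamma> \<phi> (\<lambda>z. cnj (?T z) * inverse (of_real (\<phi> z)) * cnj (?G z)) f
      = (LINT z | arc_length \<Omega> n \<gamma>. cnj (?G z * f z * ?T z))"
    unfolding inner_boundary_def
  proof (rule Bochner_Integration.integral_cong[OF refl])
    fix z assume "z \<in> space (arc_length \<Omega> n \<gamma>)"
    then have "\<phi> z \<noteq> 0" using pos[of z] by simp
    then show "cnj (?T z) * inverse (of_real (\<phi> z)) * cnj (?G z) * cnj (f z) * of_real (\<phi> z)
      = cnj (?G z * f z * ?T z)" by (simp add: field_simps)
  qed
  also have "\<dots> = cnj (LINT z | arc_length \<Omega> n \<gamma>. ?G z * f z * ?T z)"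
    by (rule Bochner_Integration.integral_cnj)
  also have "(LINT z | arc_length \<Omega> n \<gamma>. ?G z * f z * ?T z) = 0"
    unfolding zero[symmetric]
    by (rule integral_unit_tangent)
       (intro continuous_on_mult continuous_on_subset[OF cont] A_infinity_continuous_frontier f,
        simp add: frontier_def)
  finally show ?thesis by simp
qed

end

theorem proposition2p1:
  fixes \<Omega> :: "complex set" and n :: nat and \<gamma> :: "nat \<Rightarrow> real \<Rightarrow> complex"
    and \<phi> :: "complex \<Rightarrow> real"
  assumes "smooth_connected_domain \<Omega> n"
    and "boundary_param \<Omega> n \<gamma>" and "positively_oriented \<Omega> n \<gamma>"
    and "smooth_on_boundary n \<gamma> \<phi>" and "\<forall>z\<in>frontier \<Omega>. \<phi> z > 0"
  shows "\<forall>u :: complex \<Rightarrow> complex. smooth_on_boundary n \<gamma> u \<longrightarrow>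
    (AE z in arc_length \<Omega> n \<gamma>.
      szego_projection \<Omega> n \<gamma> \<phi> (\<lambda>\<zeta>. u \<zeta> + kerzman_stein \<Omega> n \<gamma> \<phi> u \<zeta>) z
        = cauchy_transform \<Omega> n \<gamma> u z)"
proof (intro allI impI)
  fix u :: "complex \<Rightarrow> complex" assume u: "smooth_on_boundary n \<gamma> u"
  interpret smooth_domain \<Omega> n \<gamma> using assms(1-3) by unfold_locales
  let ?T = "unit_tangent n \<gamma>" and ?h = "cauchy_transform \<Omega> n \<gamma> u"
  define w where "w = (\<lambda>\<zeta>. cnj (u \<zeta> * of_real (\<phi> \<zeta>)) * cnj (?T \<zeta>))"
  define e where "e = (\<lambda>z. cnj (?T z) * inverse (of_real (\<phi> z)) * cnj (cauchy_transform \<Omega> n \<gamma> w z))"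
  have pos: "\<phi> z > 0" if "z \<in> frontier \<Omega>" for z using assms(5) that by blast
  obtain L1 where L1: "L1-lipschitz_on (frontier \<Omega>) u" using smooth_on_boundary_lipschitz[OF u] .
  obtain M where M: "M-lipschitz_on (frontier \<Omega>) \<phi>" using smooth_on_boundary_lipschitz[OF assms(4)] .
  obtain L3 where L3: "L3-lipschitz_on (frontier \<Omega>) ?T" using unit_tangent_lipschitz .
  have c\<phi>: "continuous_on (frontier \<Omega>) \<phi>" by (rule lipschitz_on_continuous_on[OF M])
  have "M-lipschitz_on (frontier \<Omega>) (\<lambda>z. complex_of_real (\<phi> z))"
    using M by (simp add: lipschitz_on_def dist_of_real)
  then obtain L4 where "L4-lipschitz_on (frontier \<Omega>) (\<lambda>z. u z * of_real (\<phi> z))"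
    using lipschitz_frontier_mult[OF L1] by blast
  then obtain L5 where L5: "L5-lipschitz_on (frontier \<Omega>) (\<lambda>z. u z * of_real (\<phi> z) * ?T z)"
    using lipschitz_frontier_mult[OF _ L3] by blast
  have w_cnj: "w z = cnj (u z * of_real (\<phi> z) * ?T z)" for z by (simp add: w_def)
  have dist_cnj: "dist (cnj a) (cnj b) = dist a b" for a b
    by (simp add: dist_norm flip: complex_cnj_diff)
  have w: "L5-lipschitz_on (frontier \<Omega>) w"
    using L5 unfolding lipschitz_on_def w_cnj dist_cnj .
  have cT: "continuous_on (frontier \<Omega>) ?T" by (rule lipschitz_on_continuous_on[OF L3])
  have cG: "continuous_on (frontier \<Omega>) (cauchy_transform \<Omega> n \<gamma> w)"
    by (rule continuous_on_subset[OF cauchy_transform_continuous[OF w]]) (simp add: frontier_def)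
  have ce: "continuous_on (frontier \<Omega>) e"
    unfolding e_def by (intro continuous_intros cT cG c\<phi>) (auto dest!: pos)
  have hA: "?h \<in> A_infinity \<Omega>" by (rule cauchy_transform_A_infinity[OF u])
  \<comment> \<open>\<open>u + \<A>u = \<C>u + (u - \<C>\<^sup>*u)\<close>, and \<open>e\<close> is the second summand.\<close>
  have v: "(\<lambda>\<zeta>. u \<zeta> + kerzman_stein \<Omega> n \<gamma> \<phi> u \<zeta>) = (\<lambda>z. ?h z + e z)"
    by (simp add: fun_eq_iff kerzman_stein_def cauchy_adjoint_def e_def w_def)
  show "AE z in arc_length \<Omega> n \<gamma>.
      szego_projection \<Omega> n \<gamma> \<phi> (\<lambda>\<zeta>. u \<zeta> + kerzman_stein \<Omega> n \<gamma> \<phi> u \<zeta>) z = ?h z"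
    unfolding v
  proof (rule szego_projection_unique[OF c\<phi> pos hA])
    show "(\<lambda>z. ?h z + e z) \<in> L2"
      by (intro continuous_L2 continuous_on_add ce A_infinity_continuous_frontier hA)
    show "inner_boundary \<Omega> n \<gamma> \<phi> (\<lambda>z. ?h z + e z - ?h z) g = 0" if "g \<in> hardy_space \<Omega> n \<gamma>" for g
    proof -
      have "inner_boundary \<Omega> n \<gamma> \<phi> e f = 0" if "f \<in> A_infinity \<Omega>" for f
        unfolding e_def by (rule cauchy_adjoint_defect_orthogonal[OF w that pos])
      from orthogonal_hardy[OF ce c\<phi> this that] show ?thesis by simp
    qed
  qed
qed

end
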